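(* Let $n\in\mathbb{N}^{\ast}$ and $X=K^{n}$. Let $(\omega_i)_{i\geq1}\subset Lip(T)$ have Lipschitz constants $r_i=\|\omega_i\|_L$ forming a bounded sequence, and let $(R_i)_{i\geq1}\subset\mathcal{L}(K^n)$ be such that $\sum_{i=1}^{\infty}\|R_i\|_o<\infty$. Put $R=\sum_{i=1}^{\infty}R_i\in\mathcal{L}(K^n)$ and let $H:cabv(K^n)\to cabv(K^n)$ be given by $H(\mu)=\sum_{i=1}^{\infty}R_i\circ\omega_i(\mu)$. Assume: (a) $R=Id_{K^n}$; (b) $c=\sum_{i=1}^{\infty}\|R_i\|_o\,r_i<1$ (this holds if all $\omega_i$ are contractions and $\sum_{i=1}^{\infty}\|R_i\|_o=1$); (c) $0<a<\infty$ and $v\in K^n$ are such that $\|v\|\leq a$ (hence $B_a(K^n,v)\neq\emptyset$); (d) $\emptyset\neq A\subseteq B_a(K^n,v)$ is such that $H(A)\subseteq A$ and $A$ is weak$^{\ast}$ closed. (In the particular case when $\|H(\mu)\|\leq\|\mu\|$ for any $\mu\in cabv(K^n)$, one can take $A=B_a(K^n,v)$. More particularly, if $\sum_{i=1}^{\infty}\|R_i\|_o=1$, it follows that $\|H(\mu)\|\leq\|\mu\|$ for any $\mu\in cabv(K^n)$.) Under these hypotheses, define $H_1:A\to A$ via $H_1(\mu)=H(\mu)$ for any $\mu\in A$. Then $H_1$ is a contraction with contraction factor $\leq c$ if $A$ is equipped with the metric $d_{MK}^{\ast}(\mu,\nu)=\|\mu-\nu\|_{MK}^{\ast}$. There exists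 a unique $\mu^{\ast}\in A$ such that $H_1(\mu^{\ast})=\mu^{\ast}$.
   Context: $K$ is $\mathbb{R}$ or $\mathbb{C}$; $K^n$ carries the standard scalar product $\langle x,y\rangle=\sum_i x_i\overline{y_i}$ and the Euclidean norm. $(T,d)$ is a compact metric space with at least two elements, $\mathcal{B}$ its Borel $\sigma$-algebra. $\mathbb{N}^{\ast}=\{1,2,\dots\}$. For $f:T\to Y$, $(Y,\rho)$ metric, $\|f\|_L=\sup\{\rho(f(x),f(y))/d(x,y): x\neq y\}$; $Lip(T,Y)$ is the set of $f$ with $\|f\|_L<\infty$, $Lip(T)=Lip(T,T)$; a contraction is a Lipschitz self-map with $\|f\|_L<1$, and $\|f\|_L$ is its contraction factor. $\mathcal{L}(X)$ is the space of continuous linear operators on $X$, with operator norm $\|\cdot\|_o$. $cabv(X)$ is the space of $\sigma$-additive $\mu:\mathcal{B}\to X$ with finite total variation $\|\mu\|=|\mu|(T)=\sup\sum_i\|\mu(A_i)\|$ (supremum over finite Borel partitions $(A_i)$ of $T$); this is the variational norm. For continuous $h:T\to T$, $h(\mu)(B)=\mu(h^{-1}(B))$ for $B\in\mathcal{B}$; for $R\in\mathcal{L}(X)$, $(R\circ h(\mu))(B)=R(\mu(h^{-1}(B)))$. The series defining $H(\mu)$ converges absolutely in $cabv(X)$ for the variational norm. $B_a(X)=\{\mu\in cabv(X):\|\mu\|\leq a\}$, $cabv(X,v)=\{\mu\in cabv(X):\mu(T)=v\}$, $B_a(X,v)=B_a(X)\cap cabv(X,v)$. Integral: for a simple function $f=\sum_i\varphi_{A_i}x_i$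 ($(A_i)$ a finite Borel partition of $T$, $x_i\in X$, $\varphi_{A}$ the indicator function of $A$), $\int f\,d\mu=\sum_i\langle x_i,\mu(A_i)\rangle$; for $f$ a uniform limit of simple functions $f_m$ (in particular for $f\in C(T,X)$, the continuous functions), $\int f\,d\mu=\lim_m\int f_m\,d\mu$. For $\mu\in cabv(X,0)$, $\|\mu\|_{MK}^{\ast}=\sup\{|\int f\,d\mu|: f\in Lip(T,X),\ \|f\|_L\leq 1\}$ (a norm on $cabv(X,0)$). The weak$^{\ast}$ topology on $cabv(K^n)$ is the one obtained from the identification $cabv(X)\equiv C(T,X)'$, $\mu\mapsto(f\mapsto\int f\,d\mu)$, i.e. the coarsest topology making all maps $\mu\mapsto\int f\,d\mu$, $f\in C(T,X)$, continuous. *)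

theory Defs
  imports "HOL-Analysis.Analysis"
begin

section \<open>Lipschitz constants and contractions\<close>

text \<open>
  The supremum is taken in \<open>[0, \<infinity>]\<close>; in particular it is \<open>0\<close> if \<open>M\<close> has at most one element.
\<close>

definition lip_const :: "'a set \<Rightarrow> ('a \<Rightarrow> 'a \<Rightarrow> real) \<Rightarrow> ('b \<Rightarrow> 'b \<Rightarrow> real) \<Rightarrow> ('a \<Rightarrow> 'b) \<Rightarrow> ennreal" where
  "lip_const M d d' f =
     (SUP (x, y) \<in> {(x, y). x \<in> M \<and> y \<in> M \<and> x \<noteq> y}. ennreal (d' (f x) (f y) / d x y))"

definition contraction :: "'a set \<Rightarrow> ('a \<Rightarrow> 'a \<Rightarrow> real) \<Rightarrow> ('a \<Rightarrow> 'a) \<Rightarrow> bool" where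
  "contraction M d f \<longleftrightarrow> f \<in> M \<rightarrow> M \<and> lip_const M d d f < 1"

abbreviation lip :: "('a::metric_space \<Rightarrow> 'b::metric_space) \<Rightarrow> ennreal" where
  "lip \<equiv> lip_const UNIV dist dist"


section \<open>Vector measures of bounded variation\<close>

definition borel_partitions :: "'t::topological_space set set set" where
  "borel_partitions = {P. finite P \<and> P \<subseteq> sets borel \<and> partition_on UNIV P}"

definition var_sums :: "('t::topological_space set \<Rightarrow> 'x::real_normed_vector) \<Rightarrow> real set" where
  "var_sums m = (\<lambda>P. \<Sum>A\<in>P. norm (m A)) ` borel_partitions"

definition sigma_additive :: "('t::topological_space set \<Rightarrow> 'x::real_normed_vector) \<Rightarrow> bool" where
  "sigma_additive m \<longleftrightarrow>
     (\<forall>A :: nat \<Rightarrow> 't set. range A \<subseteq> sets borel \<longrightarrow> disjoint_family A \<longrightarrow>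
        (\<lambda>i. m (A i)) sums m (\<Union>i. A i))"

lemma borel_partitions_UNIV: "{UNIV} \<in> borel_partitions"
  by (auto simp: borel_partitions_def partition_on_def)

lemma var_sums_nonempty: "var_sums m \<noteq> {}"
  using borel_partitions_UNIV by (auto simp: var_sums_def)

text \<open>
  A measure is only meaningful on Borel sets; it is extended by \<open>0\<close> to all other sets, so that
  equality in the type below is equality on the Borel sets.
\<close>

typedef (overloaded) ('t::topological_space, 'x::real_normed_vector) cabv =
  "{m :: 't set \<Rightarrow> 'x. sigma_additive m \<and> bdd_above (var_sums m) \<and> (\<forall>B. B \<notin> sets borel \<longrightarrow> m B = 0)}"
  morphisms cabv_on Abs_cabv
  by (rule exI[of _ "\<lambda>_. 0"]) (auto simp: sigma_additive_def var_sums_def)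

setup_lifting type_definition_cabv

lemma cabv_eqI: "(\<And>B. B \<in> sets borel \<Longrightarrow> cabv_on \<mu> B = cabv_on \<nu> B) \<Longrightarrow> \<mu> = \<nu>"
  by transfer (metis ext)

lemma var_sums_le:
  assumes "bdd_above (var_sums m)" "P \<in> borel_partitions"
  shows "(\<Sum>A\<in>P. norm (m A)) \<le> Sup (var_sums m)"
  using assms by (auto simp: var_sums_def intro: cSUP_upper)

lemma var_sums_bounded_by:
  assumes "bdd_above (var_sums m)" "C \<ge> 0"
    and "\<And>A. A \<in> sets borel \<Longrightarrow> norm (m' A) \<le> C * norm (m A)"
  shows "bdd_above (var_sums m')" "Sup (var_sums m') \<le> C * Sup (var_sums m)"
proof -
  have *: "x \<le> C * Sup (var_sums m)" if "x \<in> var_sums m'" for x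
  proof -
    from that obtain P where P: "P \<in> borel_partitions" "x = (\<Sum>A\<in>P. norm (m' A))"
      by (auto simp: var_sums_def)
    have "x \<le> (\<Sum>A\<in>P. C * norm (m A))"
      unfolding P(2) using P(1) assms(3) by (intro sum_mono) (auto simp: borel_partitions_def)
    also have "\<dots> = C * (\<Sum>A\<in>P. norm (m A))" by (simp add: sum_distrib_left)
    also have "\<dots> \<le> C * Sup (var_sums m)"
      using assms P by (intro mult_left_mono var_sums_le) auto
    finally show ?thesis .
  qed
  then show "bdd_above (var_sums m')" by (auto simp: bdd_above_def)
  show "Sup (var_sums m') \<le> C * Sup (var_sums m)"
    using * by (intro cSup_least var_sums_nonempty)
qed

lemma var_sums_add:
  assumes "bdd_above (var_sums m)" "bdd_above (var_sums m')"
  shows "bdd_above (var_sums (\<lambda>B. m B + m' B))"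
    and "Sup (var_sums (\<lambda>B. m B + m' B)) \<le> Sup (var_sums m) + Sup (var_sums m')"
proof -
  have *: "x \<le> Sup (var_sums m) + Sup (var_sums m')"
    if "x \<in> var_sums (\<lambda>B. m B + m' B)" for x
  proof -
    from that obtain P where P: "P \<in> borel_partitions" "x = (\<Sum>A\<in>P. norm (m A + m' A))"
      by (auto simp: var_sums_def)
    have "x \<le> (\<Sum>A\<in>P. norm (m A)) + (\<Sum>A\<in>P. norm (m' A))"
      unfolding P(2) sum.distrib[symmetric] by (intro sum_mono norm_triangle_ineq)
    also have "\<dots> \<le> Sup (var_sums m) + Sup (var_sums m')"
      using assms P by (intro add_mono var_sums_le)
    finally show ?thesis .
  qed
  then show "bdd_above (var_sums (\<lambda>B. m B + m' B))" by (auto simp: bdd_above_def)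
  show "Sup (var_sums (\<lambda>B. m B + m' B)) \<le> Sup (var_sums m) + Sup (var_sums m')"
    using * by (intro cSup_least var_sums_nonempty)
qed

lemma norm_le_Sup_var_sums:
  assumes "bdd_above (var_sums m)" "B \<in> sets (borel :: 't::topological_space measure)"
    and "B \<noteq> {}"
  shows "norm (m B) \<le> Sup (var_sums m)"
proof -
  define P where "P = {B, - B} - {{}}"
  have P: "P \<in> borel_partitions"
    using assms(2) by (auto simp: P_def borel_partitions_def partition_on_def disjoint_def)
  have "norm (m B) \<le> (\<Sum>A\<in>P. norm (m A))"
    using assms(3) by (intro member_le_sum) (auto simp: P_def)
  also have "\<dots> \<le> Sup (var_sums m)" by (rule var_sums_le[OF assms(1) P])
  finally show ?thesis .
qed

lemma sigma_additive_empty: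
  fixes m :: "'a::topological_space set \<Rightarrow> 'b::real_normed_vector"
  shows "sigma_additive m \<Longrightarrow> m {} = 0"
proof -
  assume m: "sigma_additive m"
  have "range (\<lambda>_::nat. {}) \<subseteq> sets (borel :: 'a measure)" by simp
  moreover have "disjoint_family (\<lambda>_::nat. {} :: 'a set)" by (simp add: disjoint_family_on_def)
  ultimately have "(\<lambda>i::nat. m {}) sums m (\<Union>i::nat. {})"
    using m unfolding sigma_additive_def by blast
  then have "summable (\<lambda>i::nat. m {})" by (rule sums_summable)
  then show ?thesis by (simp only: summable_const_iff)
qed

instantiation cabv :: (topological_space, real_normed_vector) real_normed_vector
begin

lift_definition zero_cabv :: "('a, 'b) cabv" is "\<lambda>_. 0"
  by (auto simp: sigma_additive_def var_sums_def)

lift_definition plus_cabv :: "('a, 'b) cabv \<Rightarrow> ('a, 'b) cabv \<Rightarrow> ('a, 'b) cabv" is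
  "\<lambda>m m' B. m B + m' B"
  unfolding sigma_additive_def
  by (intro conjI allI impI sums_add var_sums_add) simp_all

lift_definition scaleR_cabv :: "real \<Rightarrow> ('a, 'b) cabv \<Rightarrow> ('a, 'b) cabv" is
  "\<lambda>c m B. c *\<^sub>R m B"
  subgoal for c m
    using var_sums_bounded_by(1)[of m "\<bar>c\<bar>" "\<lambda>B. c *\<^sub>R m B"]
    unfolding sigma_additive_def by (simp add: sums_scaleR_right)
  done

lift_definition uminus_cabv :: "('a, 'b) cabv \<Rightarrow> ('a, 'b) cabv" is "\<lambda>m B. - m B"
  subgoal for m
    using var_sums_bounded_by(1)[of m 1 "\<lambda>B. - m B"]
    unfolding sigma_additive_def by (simp add: sums_minus)
  done

definition minus_cabv :: "('a, 'b) cabv \<Rightarrow> ('a, 'b) cabv \<Rightarrow> ('a, 'b) cabv" where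
  "minus_cabv \<mu> \<nu> = \<mu> + - \<nu>"

lift_definition norm_cabv :: "('a, 'b) cabv \<Rightarrow> real" is "\<lambda>m. Sup (var_sums m)" .

definition dist_cabv :: "('a, 'b) cabv \<Rightarrow> ('a, 'b) cabv \<Rightarrow> real" where
  "dist_cabv \<mu> \<nu> = norm (\<mu> - \<nu>)"

definition sgn_cabv :: "('a, 'b) cabv \<Rightarrow> ('a, 'b) cabv" where
  "sgn_cabv \<mu> = inverse (norm \<mu>) *\<^sub>R \<mu>"

definition uniformity_cabv :: "(('a, 'b) cabv \<times> ('a, 'b) cabv) filter" where
  "uniformity_cabv = (INF e\<in>{0<..}. principal {(\<mu>, \<nu>). dist \<mu> \<nu> < e})"

definition open_cabv :: "('a, 'b) cabv set \<Rightarrow> bool" where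
  "open_cabv U = (\<forall>\<mu>\<in>U. eventually (\<lambda>(\<mu>', \<nu>). \<mu>' = \<mu> \<longrightarrow> \<nu> \<in> U) uniformity)"

instance
proof
  fix \<mu> \<nu> \<kappa> :: "('a, 'b) cabv" and c d :: real
  show "\<mu> + \<nu> + \<kappa> = \<mu> + (\<nu> + \<kappa>)" by transfer (simp add: add.assoc)
  show "\<mu> + \<nu> = \<nu> + \<mu>" by transfer (simp add: add.commute)
  show "0 + \<mu> = \<mu>" by transfer simp
  show "- \<mu> + \<mu> = 0" by transfer simp
  show "\<mu> - \<nu> = \<mu> + - \<nu>" by (rule minus_cabv_def)
  show "c *\<^sub>R (\<mu> + \<nu>) = c *\<^sub>R \<mu> + c *\<^sub>R \<nu>" by transfer (simp add: scaleR_add_right)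
  show "(c + d) *\<^sub>R \<mu> = c *\<^sub>R \<mu> + d *\<^sub>R \<mu>" by transfer (simp add: scaleR_add_left)
  show "c *\<^sub>R d *\<^sub>R \<mu> = (c * d) *\<^sub>R \<mu>" by transfer simp
  show "1 *\<^sub>R \<mu> = \<mu>" by transfer simp
  show "dist \<mu> \<nu> = norm (\<mu> - \<nu>)" by (rule dist_cabv_def)
  show "sgn \<mu> = inverse (norm \<mu>) *\<^sub>R \<mu>" by (rule sgn_cabv_def)
  show "uniformity = (INF e\<in>{0<..}. principal {(\<mu> :: ('a, 'b) cabv, \<nu>). dist \<mu> \<nu> < e})"
    by (rule uniformity_cabv_def)
  show "open U = (\<forall>\<mu>\<in>U. \<forall>\<^sub>F (\<mu>', \<nu>) in uniformity. \<mu>' = \<mu> \<longrightarrow> \<nu> \<in> U)"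
    for U :: "('a, 'b) cabv set"
    by (rule open_cabv_def)
  show "(norm \<mu> = 0) = (\<mu> = 0)"
  proof
    assume "norm \<mu> = 0"
    then show "\<mu> = 0"
    proof (transfer, intro ext)
      fix m :: "'a set \<Rightarrow> 'b" and B
      assume m: "sigma_additive m \<and> bdd_above (var_sums m) \<and> (\<forall>B. B \<notin> sets borel \<longrightarrow> m B = 0)"
        and "Sup (var_sums m) = 0"
      then show "m B = 0"
        using norm_le_Sup_var_sums[of m B] sigma_additive_empty[of m]
        by (cases "B \<in> sets borel \<and> B \<noteq> {}") auto
    qed
  next
    have *: "var_sums (\<lambda>_::'a set. 0::'b) = {0}"
      using var_sums_nonempty[of "\<lambda>_::'a set. 0::'b"] by (auto simp: var_sums_def)
    assume "\<mu> = 0"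
    then show "norm \<mu> = 0" by (simp, transfer) (simp add: *)
  qed
  show "norm (\<mu> + \<nu>) \<le> norm \<mu> + norm \<nu>"
    by transfer (simp add: var_sums_add)
  have le: "norm (c *\<^sub>R \<mu>) \<le> \<bar>c\<bar> * norm \<mu>" for c and \<mu> :: "('a, 'b) cabv"
    by transfer (rule var_sums_bounded_by, simp_all)
  show "norm (c *\<^sub>R \<mu>) = \<bar>c\<bar> * norm \<mu>"
  proof (cases "c = 0")
    case True
    have "var_sums (\<lambda>_::'a set. 0::'b) = {0}"
      using var_sums_nonempty[of "\<lambda>_::'a set. 0::'b"] by (auto simp: var_sums_def)
    then show ?thesis using True by (simp, transfer) simp
  next
    case False
    have "inverse c *\<^sub>R c *\<^sub>R \<mu> = \<mu>" using False by transfer simp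
    with le[of "inverse c" "c *\<^sub>R \<mu>"] have "norm \<mu> \<le> norm (c *\<^sub>R \<mu>) / \<bar>c\<bar>"
      by (simp add: field_simps)
    then have "\<bar>c\<bar> * norm \<mu> \<le> norm (c *\<^sub>R \<mu>)" using False by (simp add: field_simps)
    with le[of c \<mu>] show ?thesis by simp
  qed
qed

end

text \<open>
  The image measure \<open>h(\<mu>)\<close>; it is set to \<open>0\<close> if \<open>h\<close> is not Borel measurable.
\<close>

lift_definition cabv_image ::
  "('t::topological_space \<Rightarrow> 't) \<Rightarrow> ('t, 'x::real_normed_vector) cabv \<Rightarrow> ('t, 'x) cabv" is
  "\<lambda>h m B. if h \<in> borel \<rightarrow>\<^sub>M borel \<and> B \<in> sets borel then m (h -` B) else 0"
proof -
  fix h :: "'t \<Rightarrow> 't" and m :: "'t set \<Rightarrow> 'x"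
  assume m: "sigma_additive m \<and> bdd_above (var_sums m) \<and> (\<forall>B. B \<notin> sets borel \<longrightarrow> m B = 0)"
  define m' where "m' B = (if h \<in> borel \<rightarrow>\<^sub>M borel \<and> B \<in> sets borel then m (h -` B) else 0)" for B
  have "sigma_additive m' \<and> bdd_above (var_sums m')"
  proof (cases "h \<in> borel \<rightarrow>\<^sub>M borel")
    case False
    then have "m' = (\<lambda>_. 0)" by (auto simp: m'_def)
    then show ?thesis by (auto simp: sigma_additive_def var_sums_def)
  next
    case True
    have vi: "h -` B \<in> sets borel" if "B \<in> sets borel" for B
      using measurable_sets[OF True that] by simp
    have "sigma_additive m'"
      unfolding sigma_additive_def
    proof (intro allI impI)
      fix A :: "nat \<Rightarrow> 't set"
      assume A: "range A \<subseteq> sets borel" "disjoint_family A"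
      have "(\<lambda>i. m (h -` A i)) sums m (\<Union>i. h -` A i)"
        using m A vi unfolding sigma_additive_def
        by (elim conjE allE[of _ "\<lambda>i. h -` A i"]) (auto simp: disjoint_family_on_def)
      moreover have "(\<Union>i. A i) \<in> sets borel" using A(1) by (intro sets.countable_UN) auto
      ultimately show "(\<lambda>i. m' (A i)) sums m' (\<Union>i. A i)"
        using A(1) True by (auto simp: m'_def vimage_UN range_subsetD)
    qed
    moreover have "x \<le> Sup (var_sums m)" if "x \<in> var_sums m'" for x
    proof -
      from that obtain P where P: "P \<in> borel_partitions" "x = (\<Sum>A\<in>P. norm (m' A))"
        by (auto simp: var_sums_def)
      then have Pf: "finite P" "P \<subseteq> sets borel" "disjoint P" "\<Union>P = UNIV"
        by (auto simp: borel_partitions_def partition_on_def)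
      define P1 where "P1 = {A\<in>P. h -` A \<noteq> {}}"
      define Q where "Q = (\<lambda>A. h -` A) ` P1"
      have "partition_on UNIV Q"
        unfolding partition_on_def
      proof (intro conjI)
        show "\<Union>Q = UNIV"
        proof -
          have "\<exists>A\<in>P1. y \<in> h -` A" for y
          proof -
            have "h y \<in> \<Union>P" by (simp add: Pf(4))
            then obtain A where "A \<in> P" "h y \<in> A" by (rule UnionE)
            then show ?thesis by (auto simp: P1_def)
          qed
          then show ?thesis by (auto simp: Q_def)
        qed
        show "disjoint Q"
        proof (rule disjointI)
          fix C D assume "C \<in> Q" "D \<in> Q" and ne: "C \<noteq> D"
          then obtain A B where AB: "A \<in> P" "B \<in> P" "C = h -` A" "D = h -` B"
            by (auto simp: Q_def P1_def)
          then have "A \<inter> B = {}" using disjointD[OF Pf(3) AB(1,2)] ne by auto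
          then show "C \<inter> D = {}" unfolding AB(3,4) by (metis vimage_Int vimage_empty)
        qed
        show "{} \<notin> Q" by (auto simp: Q_def P1_def)
      qed
      then have Q: "Q \<in> borel_partitions"
        using Pf vi by (auto simp: borel_partitions_def Q_def P1_def)
      have inj: "inj_on (\<lambda>A. h -` A) P1"
      proof (rule inj_onI)
        fix A B assume "A \<in> P1" "B \<in> P1" and eq: "h -` A = h -` B"
        then obtain y where "y \<in> h -` A" "A \<in> P" "B \<in> P" by (auto simp: P1_def)
        then have "h y \<in> A \<inter> B" using eq by blast
        then show "A = B" using disjointD[OF Pf(3) \<open>A \<in> P\<close> \<open>B \<in> P\<close>] by blast
      qed
      have "x = (\<Sum>A\<in>P. norm (m (h -` A)))"
        unfolding P(2) using Pf(2) True by (intro sum.cong) (auto simp: m'_def)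
      also have "\<dots> = (\<Sum>A\<in>P1. norm (m (h -` A)))"
        using Pf(1) sigma_additive_empty[of m] m
        by (intro sum.mono_neutral_right) (auto simp: P1_def)
      also have "\<dots> = (\<Sum>A\<in>Q. norm (m A))"
        unfolding Q_def using inj by (simp add: sum.reindex)
      also have "\<dots> \<le> Sup (var_sums m)" using m Q by (intro var_sums_le) auto
      finally show ?thesis .
    qed
    ultimately show ?thesis by (auto simp: bdd_above_def)
  qed
  then show "sigma_additive (\<lambda>B. if h \<in> borel \<rightarrow>\<^sub>M borel \<and> B \<in> sets borel then m (h -` B) else 0) \<and>
    bdd_above (var_sums (\<lambda>B. if h \<in> borel \<rightarrow>\<^sub>M borel \<and> B \<in> sets borel then m (h -` B) else 0)) \<and>
    (\<forall>B. B \<notin> sets borel \<longrightarrow>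
      (if h \<in> borel \<rightarrow>\<^sub>M borel \<and> B \<in> sets borel then m (h -` B) else 0) = 0)"
    by (simp add: m'_def[abs_def])
qed

lift_definition cabv_apply ::
  "('x::real_normed_vector \<Rightarrow>\<^sub>L 'x) \<Rightarrow> ('t::topological_space, 'x) cabv \<Rightarrow> ('t, 'x) cabv" is
  "\<lambda>R m B. blinfun_apply R (m B)"
proof -
  fix R :: "'x \<Rightarrow>\<^sub>L 'x" and m :: "'t set \<Rightarrow> 'x"
  assume m: "sigma_additive m \<and> bdd_above (var_sums m) \<and> (\<forall>B. B \<notin> sets borel \<longrightarrow> m B = 0)"
  have "sigma_additive (\<lambda>B. blinfun_apply R (m B))"
    unfolding sigma_additive_def
  proof (intro allI impI)
    fix A :: "nat \<Rightarrow> 't set"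
    assume "range A \<subseteq> sets borel" "disjoint_family A"
    then have "(\<lambda>i. m (A i)) sums m (\<Union>i. A i)"
      using m unfolding sigma_additive_def by blast
    then show "(\<lambda>i. blinfun_apply R (m (A i))) sums blinfun_apply R (m (\<Union>i. A i))"
      by (rule bounded_linear.sums[OF blinfun.bounded_linear_right])
  qed
  moreover have "bdd_above (var_sums (\<lambda>B. blinfun_apply R (m B)))"
    by (rule var_sums_bounded_by(1)[of m "norm R"]) (use m norm_blinfun[of R] in auto)
  ultimately show "sigma_additive (\<lambda>B. blinfun_apply R (m B)) \<and>
      bdd_above (var_sums (\<lambda>B. blinfun_apply R (m B))) \<and>
      (\<forall>B. B \<notin> sets borel \<longrightarrow> blinfun_apply R (m B) = 0)"
    using m by simp
qed

text \<open>
  The series is taken in the variational norm, which is the norm of the type of measures.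
\<close>

definition markov_op ::
  "(nat \<Rightarrow> 'x::real_normed_vector \<Rightarrow>\<^sub>L 'x) \<Rightarrow> (nat \<Rightarrow> 't::topological_space \<Rightarrow> 't) \<Rightarrow>
     ('t, 'x) cabv \<Rightarrow> ('t, 'x) cabv" where
  "markov_op R \<omega> \<mu> = (\<Sum>i. cabv_apply (R i) (cabv_image (\<omega> i) \<mu>))"

definition cabv_ball_at ::
  "real \<Rightarrow> 'x::real_normed_vector \<Rightarrow> ('t::topological_space, 'x) cabv set" where
  "cabv_ball_at a v = {\<mu>. norm \<mu> \<le> a \<and> cabv_on \<mu> UNIV = v}"


section \<open>The scalar field\<close>

text \<open>
  A common class for the fields of real and of complex numbers, with their absolute value and
  their conjugation \<open>cj\<close>.  Up to isometric isomorphism compatible with \<open>cj\<close> it has no other members: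
  see the lemma \<open>real_or_complex_exhaust\<close> below.
\<close>

class real_or_complex = real_normed_field + euclidean_space +
  fixes cj :: "'a \<Rightarrow> 'a"
  assumes add_cj: "x + cj x = (2 * (x \<bullet> 1)) *\<^sub>R 1"
    and mult_cj: "x * cj x = (norm x)\<^sup>2 *\<^sub>R 1"

instantiation real :: real_or_complex
begin
definition cj_real :: "real \<Rightarrow> real" where "cj_real x = x"
instance by standard (auto simp: cj_real_def power2_eq_square)
end

instantiation complex :: real_or_complex
begin
definition cj_complex :: "complex \<Rightarrow> complex" where "cj_complex = cnj"
instance
proof
  fix z :: complex
  show "z + cj z = (2 * (z \<bullet> 1)) *\<^sub>R 1"
    by (simp add: cj_complex_def inner_complex_def complex_add_cnj scaleR_conv_of_real)
  show "z * cj z = (norm z)\<^sup>2 *\<^sub>R 1"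
    using complex_norm_square[of z] by (simp add: cj_complex_def scaleR_conv_of_real)
qed
end

lemma real_or_complex_exhaust:
  fixes dummy :: "'k::real_or_complex itself"
  shows "(\<exists>\<psi> :: real \<Rightarrow> 'k. bij \<psi> \<and> (\<forall>x y. \<psi> (x + y) = \<psi> x + \<psi> y \<and> \<psi> (x * y) = \<psi> x * \<psi> y) \<and>
            (\<forall>x. norm (\<psi> x) = norm x \<and> cj (\<psi> x) = \<psi> x)) \<or>
         (\<exists>\<psi> :: complex \<Rightarrow> 'k. bij \<psi> \<and> (\<forall>x y. \<psi> (x + y) = \<psi> x + \<psi> y \<and> \<psi> (x * y) = \<psi> x * \<psi> y) \<and>
            (\<forall>x. norm (\<psi> x) = norm x \<and> cj (\<psi> x) = \<psi> (cnj x)))"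
proof -
  have n1: "(1::'k) \<bullet> 1 = 1" by (simp add: dot_square_norm)
  have ofr: "(of_real a :: 'k) \<bullet> 1 = a" for a
    by (simp add: of_real_def n1)
  have cj_eq: "cj x = of_real (2 * (x \<bullet> 1)) - x" for x :: 'k
    using add_cj[of x] by (simp add: of_real_def algebra_simps)
  define im where "im x = x - of_real (x \<bullet> 1)" for x :: 'k
  have im1: "im x \<bullet> 1 = 0" for x by (simp add: im_def inner_diff_left ofr)
  have perp: "x * x = - of_real ((norm x)\<^sup>2)" if "x \<bullet> 1 = 0" for x :: 'k
    using mult_cj[of x] that by (simp add: cj_eq of_real_def) (metis minus_minus)
  show ?thesis
  proof (cases "\<forall>x::'k. im x = 0")
    case True
    have "bij (of_real :: real \<Rightarrow> 'k)"
    proof (rule bijI)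
      show "inj (of_real :: real \<Rightarrow> 'k)" by (rule injI) simp
      show "surj (of_real :: real \<Rightarrow> 'k)"
        using True by (metis im_def eq_iff_diff_eq_0 surj_def)
    qed
    moreover have "cj (of_real x :: 'k) = of_real x" for x
      by (simp add: cj_eq ofr)
    ultimately show ?thesis by (intro disjI1 exI[of _ of_real]) auto
  next
    case False
    then obtain x0 :: 'k where x0: "im x0 \<noteq> 0" by auto
    define e where "e = im x0 / of_real (norm (im x0))"
    have "e = (1 / norm (im x0)) *\<^sub>R im x0"
      by (simp add: e_def scaleR_conv_of_real field_simps)
    then have e1: "e \<bullet> 1 = 0" by (simp add: im1)
    have ne: "norm e = 1" using x0 by (simp add: e_def norm_divide)
    have ee: "e * e = -1" using perp[OF e1] ne by simp
    define \<psi> where "\<psi> z = of_real (Re z) + of_real (Im z) * e" for z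
    have inner_\<psi>: "\<psi> z \<bullet> 1 = Re z" for z
    proof -
      have "of_real (Im z) * e = Im z *\<^sub>R e" by (simp add: scaleR_conv_of_real)
      then show ?thesis by (simp add: \<psi>_def inner_add_left ofr e1)
    qed
    have cj\<psi>: "cj (\<psi> z) = \<psi> (cnj z)" for z
      unfolding cj_eq inner_\<psi> by (simp add: \<psi>_def)
    have add: "\<psi> (x + y) = \<psi> x + \<psi> y" for x y by (simp add: \<psi>_def algebra_simps)
    have mul: "\<psi> (x * y) = \<psi> x * \<psi> y" for x y
    proof -
      have "\<psi> x * \<psi> y = of_real (Re x * Re y) + of_real (Im x * Im y) * (e * e)
              + of_real (Re x * Im y + Im x * Re y) * e"
        by (simp add: \<psi>_def algebra_simps)
      then show ?thesis unfolding ee by (simp add: \<psi>_def algebra_simps)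
    qed
    have nrm: "norm (\<psi> z) = norm z" for z
    proof -
      have "(of_real ((norm (\<psi> z))\<^sup>2) :: 'k) = \<psi> (z * cnj z)"
        using mult_cj[of "\<psi> z"] by (simp add: cj\<psi> mul of_real_def)
      also have "\<dots> = of_real ((norm z)\<^sup>2)"
        unfolding cmod_power2 by (simp add: \<psi>_def power2_eq_square)
      finally have "(norm (\<psi> z))\<^sup>2 = (norm z)\<^sup>2" by (simp only: of_real_eq_iff)
      then show ?thesis by simp
    qed
    have inj: "inj \<psi>"
    proof (rule injI)
      fix x y assume "\<psi> x = \<psi> y"
      moreover have "\<psi> (x - y) + \<psi> y = \<psi> x" by (simp flip: add)
      ultimately have "norm (\<psi> (x - y)) = 0" by simp
      then show "x = y" by (simp add: nrm)
    qed
    have "\<exists>z. y = \<psi> z" for y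
    proof -
      let ?b = "norm (im y)"
      have "im y * im y = (of_real ?b * e) * (of_real ?b * e)"
      proof -
        have "(of_real ?b * e) * (of_real ?b * e) = of_real (?b\<^sup>2) * (e * e)"
          by (simp add: power2_eq_square)
        then show ?thesis by (simp add: perp im1 ee)
      qed
      then have "im y = of_real ?b * e \<or> im y = of_real (- ?b) * e"
        by (simp add: square_eq_iff)
      then obtain b where "im y = of_real b * e" by blast
      then have "y = \<psi> (Complex (y \<bullet> 1) b)" by (simp add: \<psi>_def im_def algebra_simps)
      then show ?thesis by blast
    qed
    then have "bij \<psi>" using inj by (simp add: bij_def surj_def)
    then show ?thesis using add mul nrm cj\<psi> by blast
  qed
qed

definition scalar_prod :: "'k::real_or_complex ^ 'n::finite \<Rightarrow> 'k ^ 'n \<Rightarrow> 'k" where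
  "scalar_prod x y = (\<Sum>i\<in>UNIV. x $ i * cj (y $ i))"


section \<open>The integral, the Monge-Kantorovich norm and the weak* topology\<close>

definition simple_vint ::
  "('t::topological_space \<Rightarrow> 'k::real_or_complex ^ 'n::finite) \<Rightarrow> ('t, 'k ^ 'n) cabv \<Rightarrow> 'k" where
  "simple_vint f \<mu> = (\<Sum>x\<in>range f. scalar_prod x (cabv_on \<mu> (f -` {x})))"

text \<open>
  Meaningful for uniform limits of simple functions, where the limit exists and does not depend
  on the approximating sequence; unspecified for other functions.
\<close>

definition vint ::
  "('t::topological_space \<Rightarrow> 'k::real_or_complex ^ 'n::finite) \<Rightarrow> ('t, 'k ^ 'n) cabv \<Rightarrow> 'k" where
  "vint f \<mu> = (THE L. \<exists>g. (\<forall>m. simple_function borel (g m)) \<and> uniform_limit UNIV g f sequentially \<and>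
     (\<lambda>m. simple_vint (g m) \<mu>) \<longlonglongrightarrow> L)"

text \<open>
  Only meaningful for \<open>\<mu>\<close> of total mass \<open>0\<close>, where the supremum is finite.
\<close>

definition mk_norm :: "('t::metric_space, 'k::real_or_complex ^ 'n::finite) cabv \<Rightarrow> real" where
  "mk_norm \<mu> = enn2real (SUP f \<in> {f. lip f \<le> 1}. ennreal (norm (vint f \<mu>)))"

definition mk_dist ::
  "('t::metric_space, 'k::real_or_complex ^ 'n::finite) cabv \<Rightarrow> ('t, 'k ^ 'n) cabv \<Rightarrow> real" where
  "mk_dist \<mu> \<nu> = mk_norm (\<mu> - \<nu>)"

definition weak_star :: "('t::topological_space, 'k::real_or_complex ^ 'n::finite) cabv topology" where
  "weak_star = topology_generated_by {vint f -` U | f U. continuous_on UNIV f \<and> open U}"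

end

theory Submission
  imports Defs
begin

text \<open>
  The operator contracts for a simple reason.  Moving \<open>H\<close> from the measure to the
  integrand gives \<open>\<integral> f d(H \<mu>) = \<Sum>\<^sub>i \<integral> R\<^sub>i\<^sup>* \<circ> f \<circ> \<omega>\<^sub>i d\<mu>\<close> (lemma \<open>vint_apply_image\<close>), and if \<open>f\<close> has
  Lipschitz constant at most 1, then the \<open>i\<close>-th integrand has Lipschitz constant at most
  \<open>\<parallel>R\<^sub>i\<parallel> r\<^sub>i\<close>.  So \<open>\<parallel>H \<rho>\<parallel>\<close> is at most \<open>c \<parallel>\<rho>\<parallel>\<close> in the Monge-Kantorovich norm whenever \<open>\<rho>\<close> has
  total mass 0 (lemma \<open>mk_norm_markov_op_le\<close>), in particular for a difference of two elements
  of \<open>A\<close>, all of which have total mass \<open>v\<close>.  As \<open>\<Sum>\<^sub>i R\<^sub>i = Id\<close>, the operator preserves total mass.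

  It remains to see that \<open>A\<close> is complete, for then Banach's theorem applies.  A Cauchy sequence
  \<open>\<sigma>\<close> in \<open>A\<close> has convergent integrals \<open>\<integral> f d\<sigma>\<^sub>k\<close> for every Lipschitz function \<open>f\<close>; since Lipschitz
  functions are uniformly dense in the continuous ones and \<open>\<parallel>\<sigma>\<^sub>k\<parallel> \<le> a\<close>, the integrals converge
  for every continuous \<open>f\<close>.  The limit is a bounded functional on \<open>C(T, X)\<close>, hence by the Riesz
  representation theorem it is integration against a measure \<open>\<mu>\<close>.  So \<open>\<sigma>\<close> converges to \<open>\<mu>\<close> in
  the weak* topology, \<open>\<mu>\<close> lies in the weak* closed set \<open>A\<close>, and the Cauchy property, applied
  uniformly over 1-Lipschitz functions, turns this into convergence in the metric
  (lemma \<open>mcomplete_mk_dist\<close>).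

  Two representation results carry the argument.

  \<^item> A vector measure is a combination \<open>\<Sum>\<^sub>e N\<^sub>e e\<close> of finite positive measures, with \<open>e\<close> running
    over the basis vectors and their negatives.  This is a Jordan decomposition obtained from
    the variation measure \<open>|\<mu>|\<close> by \<open>N\<^sub>e = (|\<mu>| + \<mu> \<bullet> e) / 2\<close>, and it reduces \<open>vint\<close> to Lebesgue
    integrals (lemmas \<open>ex_represents\<close> and \<open>vint_represents\<close>).

  \<^item> Conversely a bounded functional \<open>\<Phi>\<close> is split in the same way.  The functional
    \<open>|\<Phi>|(\<phi>) = sup {\<Phi> g : |g| \<le> \<phi>}\<close> is positive and additive, so that each
    \<open>(|\<Phi>|(\<phi>) + \<Phi>(\<phi> e)) / 2\<close> is a positive functional of \<open>\<phi>\<close>, and those are represented by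
    measures (lemmas \<open>riesz_representation\<close> and \<open>vector_riesz_representation\<close>).

  That \<open>\<parallel>\<mu>\<parallel>\<close> is the supremum of \<open>|\<integral> f d\<mu>|\<close> over Lipschitz functions bounded by 1 (lemma
  \<open>ex_lipschitz_vint_gt\<close>) gives both the definiteness of the Monge-Kantorovich norm and the
  weak* closedness of balls.
\<close>

section \<open>The scalar product\<close>

lemma cj_eq: "cj x = (2 * (x \<bullet> 1)) *\<^sub>R 1 - (x::'k::real_or_complex)"
  using add_cj[of x] by (simp add: algebra_simps)

lemma cj_zero [simp]: "cj (0::'k::real_or_complex) = 0"
  by (simp add: cj_eq)

lemma cj_add: "cj (x + y) = cj x + cj (y::'k::real_or_complex)"
  by (simp add: cj_eq inner_add_left distrib_left scaleR_add_left)

lemma cj_scaleR: "cj (c *\<^sub>R x) = c *\<^sub>R cj (x::'k::real_or_complex)"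
  by (simp add: cj_eq scaleR_right_diff_distrib mult.left_commute)

lemma norm_cj [simp]: "norm (cj x) = norm (x::'k::real_or_complex)"
proof (cases "x = 0")
  case False
  have "norm x * norm (cj x) = norm ((norm x)\<^sup>2 *\<^sub>R (1::'k))"
    by (simp only: mult_cj[symmetric] norm_mult)
  then have "norm x * norm (cj x) = norm x * norm x"
    by (simp add: power2_eq_square)
  then show ?thesis using False by simp
qed simp

text \<open>
  In \<open>x (cj y) = 2 (y \<bullet> 1) x - x y\<close> the component along 1 is symmetric in \<open>x\<close> and \<open>y\<close>, so the
  identity follows from \<open>mult_cj\<close> by polarization.
\<close>

lemma inner_mult_cj: "(x * cj y) \<bullet> 1 = x \<bullet> (y::'k::real_or_complex)"
proof -
  have sym: "(x * cj y) \<bullet> 1 = (y * cj x) \<bullet> 1"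
    by (simp add: cj_eq right_diff_distrib inner_diff_left mult.commute)
  have sq: "(z * cj z) \<bullet> 1 = z \<bullet> z" for z :: 'k
    by (simp add: mult_cj dot_square_norm)
  have "((x + y) * cj (x + y)) \<bullet> 1 = (x + y) \<bullet> (x + y)" by (rule sq)
  then have "(x * cj x) \<bullet> 1 + (x * cj y) \<bullet> 1 + (y * cj x) \<bullet> 1 + (y * cj y) \<bullet> 1
      = x \<bullet> x + 2 * (x \<bullet> y) + y \<bullet> y"
    by (simp add: cj_add distrib_left distrib_right inner_add_left inner_add_right inner_commute)
  then show ?thesis using sym sq[of x] sq[of y] by simp
qed

lemma scalar_prod_add_left: "scalar_prod (x + y) z = scalar_prod x z + scalar_prod y z"
  by (simp add: scalar_prod_def distrib_right sum.distrib)

lemma scalar_prod_add_right: "scalar_prod x (y + z) = scalar_prod x y + scalar_prod x z"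
  by (simp add: scalar_prod_def cj_add distrib_left sum.distrib)

lemma scalar_prod_scaleR_left: "scalar_prod (c *\<^sub>R x) y = c *\<^sub>R scalar_prod x y"
  by (simp add: scalar_prod_def scaleR_sum_right)

lemma scalar_prod_scaleR_right: "scalar_prod x (c *\<^sub>R y) = c *\<^sub>R scalar_prod x y"
  by (simp add: scalar_prod_def cj_scaleR scaleR_sum_right)

lemma scalar_prod_scale_left: "scalar_prod (c *s x) y = c * scalar_prod x y"
  by (simp add: scalar_prod_def sum_distrib_left mult.assoc)

lemma norm_scalar_prod_le: "norm (scalar_prod x y) \<le> norm x * norm y"
proof -
  have "norm (scalar_prod x y) \<le> (\<Sum>i\<in>UNIV. \<bar>norm (x $ i)\<bar> * \<bar>norm (y $ i)\<bar>)"
    unfolding scalar_prod_def by (rule order_trans[OF norm_sum]) (simp add: norm_mult)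
  also have "\<dots> \<le> norm x * norm y"
    unfolding norm_vec_def by (rule L2_set_mult_ineq)
  finally show ?thesis .
qed

lemma bounded_bilinear_scalar_prod:
  "bounded_bilinear (scalar_prod :: 'k::real_or_complex ^ 'n::finite \<Rightarrow> _)"
  by (rule bounded_bilinear.intro)
     (auto simp: scalar_prod_add_left scalar_prod_add_right scalar_prod_scaleR_left
       scalar_prod_scaleR_right intro!: exI[of _ 1] norm_scalar_prod_le)

interpretation scalar_prod: bounded_bilinear
  "scalar_prod :: 'k::real_or_complex ^ 'n::finite \<Rightarrow> _"
  by (rule bounded_bilinear_scalar_prod)

text \<open>
  The real part of the scalar product is the Euclidean inner product.  This allows real
  methods (bases, orthogonal projections, real functionals) to be used over both fields.
\<close>

lemma inner_scalar_prod: "scalar_prod x y \<bullet> 1 = x \<bullet> y"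
  by (simp add: scalar_prod_def inner_sum_left inner_mult_cj inner_vec_def)

lemma scalar_prod_self: "scalar_prod x x = of_real ((norm x)\<^sup>2)"
proof -
  have "scalar_prod x x = (\<Sum>i\<in>UNIV. (norm (x $ i))\<^sup>2) *\<^sub>R 1"
    by (simp add: scalar_prod_def mult_cj scaleR_left.sum)
  also have "(\<Sum>i\<in>UNIV. (norm (x $ i))\<^sup>2) = (norm x)\<^sup>2"
    unfolding norm_vec_def L2_set_def by (simp add: sum_nonneg)
  finally show ?thesis by (simp add: of_real_def)
qed

definition kadjoint :: "('k::real_or_complex ^ 'n::finite \<Rightarrow> 'k ^ 'n) \<Rightarrow> 'k ^ 'n \<Rightarrow> 'k ^ 'n" where
  "kadjoint A x = (\<chi> j. scalar_prod x (A (axis j 1)))"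

text \<open>
  Expand \<open>y\<close> in the standard basis.  Linearity over the scalar field is what lets the
  coordinates of \<open>y\<close> leave \<open>A\<close>, and they leave the second argument conjugated.
\<close>

lemma scalar_prod_kadjoint:
  fixes A :: "'k::real_or_complex ^ 'n::finite \<Rightarrow> 'k ^ 'n"
  assumes "Vector_Spaces.linear (*s) (*s) A"
  shows "scalar_prod (kadjoint A x) y = scalar_prod x (A y)"
proof -
  interpret A: Vector_Spaces.linear "(*s)" "(*s)" A by fact
  have cjm: "cj (a * b) = cj a * cj b" for a b :: 'k
  proof (cases "a = 0 \<or> b = 0")
    case False
    have "(a * b) * cj (a * b) = (a * cj a) * (b * cj b)"
      by (simp add: mult_cj norm_mult power_mult_distrib)
    then have "(a * b) * cj (a * b) = (a * b) * (cj a * cj b)"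
      by (simp add: ac_simps)
    then show ?thesis using False by simp
  qed auto
  have "scalar_prod x (A y) = scalar_prod x (\<Sum>j\<in>UNIV. (y $ j) *s A (axis j 1))"
    by (subst (1) basis_expansion[symmetric, of y]) (simp add: A.sum A.scale)
  also have "\<dots> = (\<Sum>j\<in>UNIV. scalar_prod x ((y $ j) *s A (axis j 1)))"
    by (rule scalar_prod.sum_right)
  also have "\<dots> = (\<Sum>j\<in>UNIV. scalar_prod x (A (axis j 1)) * cj (y $ j))"
    by (simp add: scalar_prod_def cjm sum_distrib_left sum_distrib_right ac_simps)
  finally show ?thesis by (simp add: kadjoint_def scalar_prod_def[of "\<chi> j. _ j"])
qed

lemma kadjoint_diff: "kadjoint A x - kadjoint A y = kadjoint A (x - y)"
  by (simp add: vec_eq_iff kadjoint_def scalar_prod.diff_left)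

text \<open>
  Apply the adjoint identity to \<open>y = R\<^sup>* x\<close>: then \<open>\<parallel>R\<^sup>* x\<parallel>\<^sup>2 = \<langle>x, R (R\<^sup>* x)\<rangle>\<close>.
\<close>

lemma norm_kadjoint_le:
  fixes R :: "('k::real_or_complex ^ 'n::finite) \<Rightarrow>\<^sub>L ('k ^ 'n)"
  assumes "Vector_Spaces.linear (*s) (*s) (blinfun_apply R)"
  shows "norm (kadjoint (blinfun_apply R) x) \<le> norm R * norm x"
proof -
  let ?y = "kadjoint (blinfun_apply R) x"
  have "(norm ?y)\<^sup>2 = norm (scalar_prod ?y ?y)"
    by (simp add: scalar_prod_self norm_power)
  also have "\<dots> \<le> norm x * norm (R ?y)"
    unfolding scalar_prod_kadjoint[OF assms] by (rule norm_scalar_prod_le)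
  also have "\<dots> \<le> norm x * (norm R * norm ?y)"
    by (intro mult_left_mono norm_blinfun) simp
  finally show ?thesis
    by (cases "norm ?y = 0") (simp_all add: power2_eq_square mult.commute mult.left_commute)
qed

lemma bounded_linear_kadjoint:
  fixes R :: "('k::real_or_complex ^ 'n::finite) \<Rightarrow>\<^sub>L ('k ^ 'n)"
  assumes "Vector_Spaces.linear (*s) (*s) (blinfun_apply R)"
  shows "bounded_linear (kadjoint R)"
proof (rule bounded_linear_intro)
  show "kadjoint R (x + y) = kadjoint R x + kadjoint R y" for x y
    by (simp add: vec_eq_iff kadjoint_def scalar_prod.add_left)
  show "kadjoint R (c *\<^sub>R x) = c *\<^sub>R kadjoint R x" for c x
    by (simp add: vec_eq_iff kadjoint_def scalar_prod.scaleR_left)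
  show "norm (kadjoint R x) \<le> norm x * norm R" for x
    using norm_kadjoint_le[OF assms, of x] by (simp add: mult.commute)
qed

section \<open>The variation as a measure\<close>

lemma sums_cabv_on:
  assumes "range A \<subseteq> sets borel" "disjoint_family A"
  shows "(\<lambda>i. cabv_on \<mu> (A i)) sums cabv_on \<mu> (\<Union>i. A i)"
  using assms cabv_on[of \<mu>] by (auto simp: sigma_additive_def)

lemma cabv_on_empty [simp]: "cabv_on \<mu> {} = 0"
  using cabv_on[of \<mu>] by (auto intro: sigma_additive_empty)

lemma cabv_on_simps [simp]:
  "cabv_on 0 B = 0"
  "cabv_on (\<mu> + \<nu>) B = cabv_on \<mu> B + cabv_on \<nu> B"
  "cabv_on (- \<mu>) B = - cabv_on \<mu> B"
  "cabv_on (\<mu> - \<nu>) B = cabv_on \<mu> B - cabv_on \<nu> B"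
  "cabv_on (c *\<^sub>R \<mu>) B = c *\<^sub>R cabv_on \<mu> B"
  "cabv_on (cabv_apply R \<mu>) B = R (cabv_on \<mu> B)"
  by (simp_all only: zero_cabv.rep_eq plus_cabv.rep_eq uminus_cabv.rep_eq minus_cabv_def
      scaleR_cabv.rep_eq cabv_apply.rep_eq diff_conv_add_uminus)

lemma cabv_on_image:
  assumes "h \<in> borel \<rightarrow>\<^sub>M borel" "B \<in> sets borel"
  shows "cabv_on (cabv_image h \<mu>) B = cabv_on \<mu> (h -` B)"
  using assms by (simp add: cabv_image.rep_eq)

lemma ennreal_norm_sums_le:
  fixes f :: "nat \<Rightarrow> 'a::real_normed_vector"
  assumes "f sums s"
  shows "ennreal (norm s) \<le> (\<Sum>i. ennreal (norm (f i)))"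
proof (rule LIMSEQ_le_const2)
  show "(\<lambda>n. ennreal (norm (\<Sum>i<n. f i))) \<longlonglongrightarrow> ennreal (norm s)"
    using assms by (intro tendsto_ennrealI tendsto_norm) (simp add: sums_def)
  have "ennreal (norm (\<Sum>i<n. f i)) \<le> (\<Sum>i<n. ennreal (norm (f i)))" for n
    by (simp add: norm_sum ennreal_leI)
  also have "\<dots> n \<le> (\<Sum>i. ennreal (norm (f i)))" for n
    by (rule sum_le_suminf) auto
  finally show "\<exists>N. \<forall>n\<ge>N. ennreal (norm (\<Sum>i<n. f i)) \<le> (\<Sum>i. ennreal (norm (f i)))"
    by blast
qed

text \<open>
  Disjoint families inside \<open>B\<close> replace partitions of \<open>B\<close>: the supremum is the same, and the
  union of families inside disjoint sets is again such a family.  The empty set is excluded so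
  that families inside disjoint sets have no common member.
\<close>

definition disjoint_subfamilies :: "'t::topological_space set \<Rightarrow> 't set set set" where
  "disjoint_subfamilies B = {D. finite D \<and> D \<subseteq> sets borel \<and> disjoint D \<and> {} \<notin> D \<and> \<Union>D \<subseteq> B}"

definition variation :: "('t::topological_space, 'x::real_normed_vector) cabv \<Rightarrow> 't set \<Rightarrow> ennreal" where
  "variation \<mu> B = (SUP D \<in> disjoint_subfamilies B. ennreal (\<Sum>A\<in>D. norm (cabv_on \<mu> A)))"

lemma variation_upper:
  "D \<in> disjoint_subfamilies B \<Longrightarrow> ennreal (\<Sum>A\<in>D. norm (cabv_on \<mu> A)) \<le> variation \<mu> B"
  unfolding variation_def by (rule SUP_upper)

lemma sum_norm_le_variation:
  assumes "finite I" "\<And>i. i \<in> I \<Longrightarrow> A i \<in> sets borel" "\<And>i. i \<in> I \<Longrightarrow> A i \<subseteq> B"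
    and disj: "\<And>i j. i \<in> I \<Longrightarrow> j \<in> I \<Longrightarrow> i \<noteq> j \<Longrightarrow> A i \<inter> A j = {}"
  shows "ennreal (\<Sum>i\<in>I. norm (cabv_on \<mu> (A i))) \<le> variation \<mu> B"
proof -
  have "A ` I - {{}} \<in> disjoint_subfamilies B"
    unfolding disjoint_subfamilies_def mem_Collect_eq
  proof (intro conjI)
    show "disjoint (A ` I - {{}})"
    proof (rule disjointI)
      fix C C' assume "C \<in> A ` I - {{}}" "C' \<in> A ` I - {{}}" "C \<noteq> C'"
      then obtain i j where "i \<in> I" "j \<in> I" "C = A i" "C' = A j" "i \<noteq> j" by blast
      then show "C \<inter> C' = {}" using disj by simp
    qed
  qed (use assms(1-3) in auto)
  then have "ennreal (\<Sum>C\<in>A ` I - {{}}. norm (cabv_on \<mu> C)) \<le> variation \<mu> B"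
    by (rule variation_upper)
  also have "(\<Sum>C\<in>A ` I - {{}}. norm (cabv_on \<mu> C)) = (\<Sum>C\<in>A ` I. norm (cabv_on \<mu> C))"
    using assms(1) by (intro sum.mono_neutral_left) auto
  also have "\<dots> = (\<Sum>i\<in>I. norm (cabv_on \<mu> (A i)))"
  proof (subst sum.reindex_nontrivial[OF assms(1)])
    fix i j assume "i \<in> I" "j \<in> I" "i \<noteq> j" "A i = A j"
    then show "norm (cabv_on \<mu> (A i)) = 0" using disj[of i j] by simp
  qed simp
  finally show ?thesis .
qed

lemma variation_mono: "A \<subseteq> B \<Longrightarrow> variation \<mu> A \<le> variation \<mu> B"
  unfolding variation_def by (rule SUP_subset_mono) (auto simp: disjoint_subfamilies_def)

lemma variation_empty: "variation \<mu> {} = 0"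
proof -
  have "disjoint_subfamilies {} = {{} :: 'a set set}"
    by (auto simp: disjoint_subfamilies_def)
  then show ?thesis by (simp add: variation_def)
qed

lemma variation_superadditive:
  assumes "A \<inter> B = {}"
  shows "variation \<mu> A + variation \<mu> B \<le> variation \<mu> (A \<union> B)"
proof -
  let ?s = "\<lambda>D. ennreal (\<Sum>A\<in>D. norm (cabv_on \<mu> A))"
  have *: "?s D + ?s E \<le> variation \<mu> (A \<union> B)"
    if D: "D \<in> disjoint_subfamilies A" and E: "E \<in> disjoint_subfamilies B" for D E
  proof -
    have DE: "D \<inter> E = {}"
    proof (rule ccontr)
      assume "D \<inter> E \<noteq> {}"
      then obtain C where "C \<in> D" "C \<in> E" by auto
      then have "C \<subseteq> A" "C \<subseteq> B" "C \<noteq> {}"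
        using D E by (auto simp: disjoint_subfamilies_def)
      then show False using assms by auto
    qed
    have "?s D + ?s E = ?s (D \<union> E)"
      using D E DE
      by (simp add: disjoint_subfamilies_def sum.union_disjoint sum_nonneg flip: ennreal_plus)
    also have "D \<union> E \<in> disjoint_subfamilies (A \<union> B)"
    proof -
      have "disjoint (D \<union> E)"
      proof (rule disjoint_union)
        have "\<Union>D \<subseteq> A" "\<Union>E \<subseteq> B" using D E by (auto simp: disjoint_subfamilies_def)
        then show "\<Union>D \<inter> \<Union>E = {}" using assms by blast
      qed (use D E in \<open>auto simp: disjoint_subfamilies_def\<close>)
      then show ?thesis using D E by (auto simp: disjoint_subfamilies_def)
    qed
    then have "?s (D \<union> E) \<le> variation \<mu> (A \<union> B)" by (rule variation_upper)
    finally show ?thesis .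
  qed
  have ne: "disjoint_subfamilies C \<noteq> {}" for C :: "'a set"
    by (auto simp: disjoint_subfamilies_def intro!: exI[of _ "{}"])
  have "variation \<mu> A + ?s E \<le> variation \<mu> (A \<union> B)" if "E \<in> disjoint_subfamilies B" for E
    unfolding variation_def[of \<mu> A] ennreal_SUP_add_left[OF ne, symmetric]
    using * that by (intro SUP_least) auto
  then show ?thesis
    unfolding variation_def[of \<mu> B] ennreal_SUP_add_right[OF ne]
    by (intro SUP_least) auto
qed

text \<open>
  Every member of a family inside the union is cut along the sets \<open>B i\<close>; countable
  additivity and the triangle inequality bound its norm by the norms of the pieces.
\<close>

lemma variation_subadditive:
  assumes B: "range B \<subseteq> sets borel" "disjoint_family B"
  shows "variation \<mu> (\<Union>i. B i) \<le> (\<Sum>i. variation \<mu> (B i))"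
  unfolding variation_def[of \<mu> "\<Union>i. B i"]
proof (rule SUP_least)
  fix D assume D: "D \<in> disjoint_subfamilies (\<Union>i. B i)"
  then have fin: "finite D" and Db: "\<And>A. A \<in> D \<Longrightarrow> A \<in> sets borel"
    and disj: "disjoint D" and sub: "\<And>A. A \<in> D \<Longrightarrow> A \<subseteq> (\<Union>i. B i)"
    by (auto simp: disjoint_subfamilies_def)
  have piece: "(\<Sum>A\<in>D. ennreal (norm (cabv_on \<mu> (A \<inter> B i)))) \<le> variation \<mu> (B i)" for i
  proof -
    have "ennreal (\<Sum>A\<in>D. norm (cabv_on \<mu> (A \<inter> B i))) \<le> variation \<mu> (B i)"
      using fin Db B(1) disjointD[OF disj] by (intro sum_norm_le_variation) blast+
    then show ?thesis by (simp add: sum_ennreal)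
  qed
  have "ennreal (\<Sum>A\<in>D. norm (cabv_on \<mu> A)) = (\<Sum>A\<in>D. ennreal (norm (cabv_on \<mu> A)))"
    by (simp add: sum_ennreal)
  also have "\<dots> \<le> (\<Sum>A\<in>D. \<Sum>i. ennreal (norm (cabv_on \<mu> (A \<inter> B i))))"
  proof (intro sum_mono ennreal_norm_sums_le)
    fix A assume A: "A \<in> D"
    have "(\<lambda>i. cabv_on \<mu> (A \<inter> B i)) sums cabv_on \<mu> (\<Union>i. A \<inter> B i)"
      using B Db[OF A] by (intro sums_cabv_on) (auto simp: disjoint_family_on_def)
    moreover have "(\<Union>i. A \<inter> B i) = A" using sub[OF A] by auto
    ultimately show "(\<lambda>i. cabv_on \<mu> (A \<inter> B i)) sums cabv_on \<mu> A" by simp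
  qed
  also have "\<dots> = (\<Sum>i. \<Sum>A\<in>D. ennreal (norm (cabv_on \<mu> (A \<inter> B i))))"
    by (intro suminf_sum[symmetric]) auto
  also have "\<dots> \<le> (\<Sum>i. variation \<mu> (B i))"
    by (intro suminf_le piece) auto
  finally show "ennreal (\<Sum>A\<in>D. norm (cabv_on \<mu> A)) \<le> (\<Sum>i. variation \<mu> (B i))" .
qed

lemma countably_additive_variation: "countably_additive (sets borel) (variation \<mu>)"
proof (rule countably_additiveI)
  fix B :: "nat \<Rightarrow> 'a set"
  assume B: "range B \<subseteq> sets borel" "disjoint_family B"
  have "(\<Sum>i<n. variation \<mu> (B i)) \<le> variation \<mu> (\<Union>i<n. B i)" for n
  proof (induction n)
    case (Suc n)
    have "(\<Union>i<n. B i) \<inter> B n = {}"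
    proof -
      have "B i \<inter> B n = {}" if "i < n" for i
        using B(2) that unfolding disjoint_family_on_def by (metis UNIV_I less_irrefl)
      then show ?thesis by auto
    qed
    from variation_superadditive[OF this, of \<mu>]
    have "variation \<mu> (\<Union>i<n. B i) + variation \<mu> (B n) \<le> variation \<mu> (\<Union>i<Suc n. B i)"
      by (simp add: lessThan_Suc Un_commute)
    then show ?case
      using order_trans[OF add_right_mono[OF Suc.IH]] by (simp only: sum.lessThan_Suc)
  qed simp
  also have "variation \<mu> (\<Union>i<n. B i) \<le> variation \<mu> (\<Union>i. B i)" for n
    by (rule variation_mono) auto
  finally have "(\<Sum>i. variation \<mu> (B i)) \<le> variation \<mu> (\<Union>i. B i)"
    unfolding suminf_eq_SUP by (intro SUP_least)
  with variation_subadditive[OF B]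
  show "(\<Sum>i. variation \<mu> (B i)) = variation \<mu> (\<Union>i. B i)" by (rule antisym[rotated])
qed

lemma variation_UNIV: "variation \<mu> UNIV = ennreal (norm \<mu>)"
proof -
  have bdd: "bdd_above (var_sums (cabv_on \<mu>))" using cabv_on[of \<mu>] by simp
  have norm: "norm \<mu> = Sup (var_sums (cabv_on \<mu>))" by (simp add: norm_cabv.rep_eq)
  show ?thesis
  proof (rule antisym)
    show "variation \<mu> UNIV \<le> ennreal (norm \<mu>)"
      unfolding variation_def
    proof (intro SUP_least ennreal_leI)
      fix D :: "'a set set" assume D: "D \<in> disjoint_subfamilies UNIV"
      then have fin: "finite D" and sets: "D \<subseteq> sets borel" by (auto simp: disjoint_subfamilies_def)
      define P where "P = D \<union> ({- \<Union>D} - {{}})"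
      have "\<Union>D \<in> sets borel" using fin sets by (intro sets.finite_Union) auto
      have P: "P \<in> borel_partitions"
        unfolding borel_partitions_def partition_on_def mem_Collect_eq
      proof (intro conjI)
        show "finite P" using fin by (simp add: P_def)
        show "P \<subseteq> sets borel" using sets \<open>\<Union>D \<in> sets borel\<close> by (auto simp: P_def)
        show "\<Union>P = UNIV" by (auto simp: P_def)
        have "disjoint D" using D by (simp add: disjoint_subfamilies_def)
        then show "disjoint P"
          unfolding P_def by (rule disjoint_union) (auto simp: disjoint_def)
        show "{} \<notin> P" using D by (auto simp: P_def disjoint_subfamilies_def)
      qed
      have "(\<Sum>A\<in>D. norm (cabv_on \<mu> A)) \<le> (\<Sum>A\<in>P. norm (cabv_on \<mu> A))"
        using fin by (intro sum_mono2) (auto simp: P_def)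
      also have "\<dots> \<le> norm \<mu>" unfolding norm by (rule var_sums_le[OF bdd P])
      finally show "(\<Sum>A\<in>D. norm (cabv_on \<mu> A)) \<le> norm \<mu>" .
    qed
    have "x \<le> enn2real (variation \<mu> UNIV)" if "x \<in> var_sums (cabv_on \<mu>)" for x
    proof -
      from that obtain P where P: "P \<in> borel_partitions" "x = (\<Sum>A\<in>P. norm (cabv_on \<mu> A))"
        by (auto simp: var_sums_def)
      then have "P \<in> disjoint_subfamilies UNIV"
        by (auto simp: borel_partitions_def partition_on_def disjoint_subfamilies_def)
      from variation_upper[OF this, of \<mu>] have "ennreal x \<le> variation \<mu> UNIV" by (simp add: P)
      moreover have "variation \<mu> UNIV < top"
        using \<open>variation \<mu> UNIV \<le> ennreal (norm \<mu>)\<close> by (rule le_less_trans) simp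
      ultimately have "enn2real (ennreal x) \<le> enn2real (variation \<mu> UNIV)"
        by (rule enn2real_mono)
      moreover have "0 \<le> x" unfolding P(2) by (rule sum_nonneg) simp
      ultimately show ?thesis by simp
    qed
    then have "norm \<mu> \<le> enn2real (variation \<mu> UNIV)"
      unfolding norm by (intro cSup_least var_sums_nonempty)
    then have "ennreal (norm \<mu>) \<le> ennreal (enn2real (variation \<mu> UNIV))"
      by (rule ennreal_leI)
    also have "\<dots> \<le> variation \<mu> UNIV"
      by (simp add: ennreal_enn2real_if)
    finally show "ennreal (norm \<mu>) \<le> variation \<mu> UNIV" .
  qed
qed

definition variation_measure ::
  "('t::topological_space, 'x::real_normed_vector) cabv \<Rightarrow> 't measure" where
  "variation_measure \<mu> = measure_of UNIV (sets borel) (variation \<mu>)"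

lemma sets_variation_measure [simp, measurable_cong]:
    "sets (variation_measure \<mu>) = sets borel"
  and space_variation_measure [simp]: "space (variation_measure \<mu>) = UNIV"
proof -
  have "sigma_algebra UNIV (sets (borel :: 'a measure))"
    using sets.sigma_algebra_axioms[of "borel :: 'a measure"] by simp
  then show "sets (variation_measure \<mu>) = sets borel"
    by (simp add: variation_measure_def sigma_algebra.sigma_sets_eq sets_measure_of_conv)
  show "space (variation_measure \<mu>) = UNIV"
    by (simp add: variation_measure_def space_measure_of_conv)
qed

lemma emeasure_variation_measure:
  "B \<in> sets borel \<Longrightarrow> emeasure (variation_measure \<mu>) B = variation \<mu> B"
  unfolding variation_measure_def
  using sets.sigma_algebra_axioms[of "borel :: 'a measure"]
  by (intro emeasure_measure_of_sigma countably_additive_variation)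
     (auto simp: positive_def variation_empty)

lemma finite_variation_measure: "finite_measure (variation_measure \<mu>)"
  by (rule finite_measureI) (simp add: emeasure_variation_measure variation_UNIV)

lemma measure_variation_measure_UNIV: "measure (variation_measure \<mu>) UNIV = norm \<mu>"
  by (simp add: measure_def emeasure_variation_measure variation_UNIV)

text \<open>
  The variation dominates the vector measure setwise.  Besides the estimate of integrals, this
  makes \<open>|\<mu>| + \<mu> \<bullet> e\<close> a positive measure for every unit vector \<open>e\<close>.
\<close>

lemma norm_cabv_on_le_variation:
  assumes "B \<in> sets borel"
  shows "norm (cabv_on \<mu> B) \<le> measure (variation_measure \<mu>) B"
proof -
  have "ennreal (norm (cabv_on \<mu> B)) \<le> emeasure (variation_measure \<mu>) B"
    using sum_norm_le_variation[of "{B}" id B \<mu>] assms by (simp add: emeasure_variation_measure)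
  then show ?thesis
    by (simp add: finite_measure.emeasure_eq_measure[OF finite_variation_measure])
qed

lemma norm_cabv_on_le: "norm (cabv_on \<mu> B) \<le> norm \<mu>"
proof (cases "B \<in> sets borel")
  case True
  have "norm (cabv_on \<mu> B) \<le> measure (variation_measure \<mu>) B"
    by (rule norm_cabv_on_le_variation[OF True])
  also have "\<dots> \<le> measure (variation_measure \<mu>) UNIV"
    by (rule finite_measure.finite_measure_mono[OF finite_variation_measure]) auto
  finally show ?thesis by (simp add: measure_variation_measure_UNIV)
next
  case False
  then show ?thesis using cabv_on[of \<mu>] by simp
qed

lemma finite_borel_measure_of_real:
  fixes m :: "'t::topological_space set \<Rightarrow> real"
  assumes "\<And>B. B \<in> sets borel \<Longrightarrow> 0 \<le> m B"
    and "\<And>A. range A \<subseteq> sets borel \<Longrightarrow> disjoint_family A \<Longrightarrow> (\<lambda>i::nat. m (A i)) sums m (\<Union>i. A i)"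
  obtains N where "finite_measure N" "sets N = sets borel"
    "\<And>B. B \<in> sets borel \<Longrightarrow> measure N B = m B"
proof -
  define N where "N = measure_of UNIV (sets borel) (\<lambda>B. ennreal (m B))"
  have salg: "sigma_algebra UNIV (sets (borel :: 't measure))"
    using sets.sigma_algebra_axioms[of "borel :: 't measure"] by simp
  have sets: "sets N = sets borel"
    using salg by (simp add: N_def sigma_algebra.sigma_sets_eq sets_measure_of_conv)
  have "(\<lambda>i::nat. m {}) sums m {}"
    using assms(2)[of "\<lambda>_. {}"] by (simp add: disjoint_family_on_def)
  then have "m {} = 0" using sums_summable summable_const_iff by blast
  have em: "emeasure N B = ennreal (m B)" if "B \<in> sets borel" for B
    unfolding N_def
  proof (rule emeasure_measure_of_sigma[OF salg _ _ that])
    show "positive (sets borel) (\<lambda>B. ennreal (m B))"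
      by (simp add: positive_def \<open>m {} = 0\<close>)
    show "countably_additive (sets borel) (\<lambda>B. ennreal (m B))"
    proof (rule countably_additiveI)
      fix A :: "nat \<Rightarrow> 't set"
      assume A: "range A \<subseteq> sets borel" "disjoint_family A"
      have "\<And>i. 0 \<le> m (A i)" using A(1) by (intro assms(1)) auto
      then show "(\<Sum>i. ennreal (m (A i))) = ennreal (m (\<Union>i. A i))"
        using assms(2)[OF A] by (intro suminf_ennreal_eq)
    qed
  qed
  show thesis
  proof
    show "finite_measure N"
      using sets_eq_imp_space_eq[OF sets] em[of UNIV] by (intro finite_measureI) simp
    show "measure N B = m B" if "B \<in> sets borel" for B
      using em[OF that] assms(1)[OF that] by (simp add: measure_def)
  qed fact
qed

text \<open>
  Using \<open>\<plusminus>e\<close> for all basis vectors \<open>e\<close> lets positive measures alone represent a vector measure,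
  without separate positive and negative parts.
\<close>

definition signed_Basis :: "'x::euclidean_space set" where
  "signed_Basis = Basis \<union> uminus ` Basis"

lemma norm_signed_Basis: "e \<in> signed_Basis \<Longrightarrow> norm e = 1"
  by (auto simp: signed_Basis_def)

lemma sum_signed_Basis:
  "(\<Sum>e\<in>signed_Basis. F e) = (\<Sum>b\<in>(Basis :: 'x::euclidean_space set). F b + F (- b))"
proof -
  have "b \<noteq> - b'" if "b \<in> Basis" "b' \<in> Basis" for b b' :: 'x
  proof
    assume "b = - b'"
    then have "b \<bullet> b = - (b' \<bullet> b)" by (metis inner_minus_left)
    moreover have "b \<bullet> b = 1" "b' \<bullet> b \<ge> 0" using that by (auto simp: inner_Basis)
    ultimately show False by simp
  qed
  then have "Basis \<inter> uminus ` Basis = ({} :: 'x set)" by fastforce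
  then show ?thesis
    by (simp add: signed_Basis_def sum.union_disjoint sum.reindex sum.distrib)
qed

definition represents ::
  "('x \<Rightarrow> 't measure) \<Rightarrow> ('t::topological_space, 'x::euclidean_space) cabv \<Rightarrow> bool" where
  "represents N \<mu> \<longleftrightarrow>
     (\<forall>e\<in>signed_Basis. finite_measure (N e) \<and> sets (N e) = sets borel) \<and>
     (\<forall>B\<in>sets borel. cabv_on \<mu> B = (\<Sum>e\<in>signed_Basis. measure (N e) B *\<^sub>R e))"

text \<open>
  With \<open>N\<^sub>e = (|\<mu>| + \<mu> \<bullet> e) / 2\<close> the contributions of \<open>|\<mu>|\<close> at \<open>e\<close> and \<open>- e\<close> cancel, and those of
  \<open>\<mu> \<bullet> e\<close> add up to the component of \<open>\<mu>\<close> along \<open>e\<close>.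
\<close>

lemma ex_represents: "\<exists>N. represents N \<mu>"
proof -
  interpret V: finite_measure "variation_measure \<mu>" by (rule finite_variation_measure)
  let ?m = "\<lambda>e B. (measure (variation_measure \<mu>) B + cabv_on \<mu> B \<bullet> e) / 2"
  have "\<exists>N. finite_measure N \<and> sets N = sets borel \<and> (\<forall>B\<in>sets borel. measure N B = ?m e B)"
    if e: "e \<in> signed_Basis" for e
  proof (rule finite_borel_measure_of_real[of "?m e"])
    show "0 \<le> ?m e B" if "B \<in> sets borel" for B
      using norm_cabv_on_le_variation[OF that, of \<mu>] norm_signed_Basis[OF e]
        Cauchy_Schwarz_ineq2[of "cabv_on \<mu> B" e] by (simp add: abs_le_iff)
    show "(\<lambda>i::nat. ?m e (A i)) sums ?m e (\<Union>i. A i)"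
      if "range A \<subseteq> sets borel" "disjoint_family A" for A
      using that
      by (intro sums_divide sums_add V.finite_measure_UNION
          bounded_linear.sums[OF bounded_linear_inner_left] sums_cabv_on) auto
  qed blast
  then obtain N where N: "\<And>e. e \<in> signed_Basis \<Longrightarrow> finite_measure (N e) \<and>
      sets (N e) = sets borel \<and> (\<forall>B\<in>sets borel. measure (N e) B = ?m e B)"
    by metis
  have "cabv_on \<mu> B = (\<Sum>e\<in>signed_Basis. measure (N e) B *\<^sub>R e)" if "B \<in> sets borel" for B
  proof -
    have "(\<Sum>e\<in>signed_Basis. measure (N e) B *\<^sub>R e) = (\<Sum>e\<in>signed_Basis. ?m e B *\<^sub>R e)"
      using N that by (intro sum.cong) auto
    also have "\<dots> = (\<Sum>b\<in>Basis. (cabv_on \<mu> B \<bullet> b) *\<^sub>R b)"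
      unfolding sum_signed_Basis
      by (intro sum.cong refl) (simp add: scaleR_diff_left[symmetric] diff_divide_distrib[symmetric])
    finally show ?thesis by (simp add: euclidean_representation)
  qed
  then show ?thesis
    unfolding represents_def using N by (intro exI[of _ N] conjI ballI) blast+
qed

lemma ex_represented:
  fixes N :: "'x::euclidean_space \<Rightarrow> 't::topological_space measure"
  assumes "\<And>e. e \<in> signed_Basis \<Longrightarrow> finite_measure (N e)"
    and "\<And>e. e \<in> signed_Basis \<Longrightarrow> sets (N e) = sets borel"
  shows "\<exists>\<mu>. represents N \<mu>"
proof -
  define m where "m B = (if B \<in> sets borel then \<Sum>e\<in>signed_Basis. measure (N e) B *\<^sub>R e else 0)" for B
  have "sigma_additive m"
    unfolding sigma_additive_def
  proof (intro allI impI)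
    fix A :: "nat \<Rightarrow> 't set" assume A: "range A \<subseteq> sets borel" "disjoint_family A"
    have "(\<lambda>i. \<Sum>e\<in>signed_Basis. measure (N e) (A i) *\<^sub>R e) sums
        (\<Sum>e\<in>signed_Basis. measure (N e) (\<Union>i. A i) *\<^sub>R e)"
      using A assms by (intro sums_sum sums_scaleR_left finite_measure.finite_measure_UNION) auto
    moreover have "(\<Union>i. A i) \<in> sets borel" using A by auto
    ultimately show "(\<lambda>i. m (A i)) sums m (\<Union>i. A i)"
      using A(1) by (simp add: m_def range_subsetD)
  qed
  moreover have "bdd_above (var_sums m)"
  proof (rule bdd_aboveI)
    fix x assume "x \<in> var_sums m"
    then obtain P where P: "P \<in> borel_partitions" and x: "x = (\<Sum>A\<in>P. norm (m A))"
      by (auto simp: var_sums_def)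
    have Pb: "finite P" "P \<subseteq> sets borel" "disjoint P"
      using P by (auto simp: borel_partitions_def partition_on_def)
    have "x \<le> (\<Sum>A\<in>P. \<Sum>e\<in>signed_Basis. measure (N e) A)"
      unfolding x
    proof (rule sum_mono)
      fix A assume "A \<in> P"
      then have "norm (m A) = norm (\<Sum>e\<in>signed_Basis. measure (N e) A *\<^sub>R e)"
        using Pb by (auto simp: m_def)
      also have "\<dots> \<le> (\<Sum>e\<in>signed_Basis. measure (N e) A)"
        by (rule sum_norm_le) (simp add: norm_signed_Basis)
      finally show "norm (m A) \<le> (\<Sum>e\<in>signed_Basis. measure (N e) A)" .
    qed
    also have "\<dots> = (\<Sum>e\<in>signed_Basis. \<Sum>A\<in>P. measure (N e) A)" by (rule sum.swap)
    also have "\<dots> = (\<Sum>e\<in>signed_Basis. measure (N e) (\<Union>A\<in>P. A))"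
      using Pb assms
      by (intro sum.cong refl finite_measure.finite_measure_finite_Union[symmetric])
         (auto simp: disjoint_family_on_def disjoint_def)
    also have "(\<Union>A\<in>P. A) = UNIV" using P by (auto simp: borel_partitions_def partition_on_def)
    finally show "x \<le> (\<Sum>e\<in>signed_Basis. measure (N e) UNIV)" .
  qed
  ultimately have "cabv_on (Abs_cabv m) = m"
    by (intro Abs_cabv_inverse) (auto simp: m_def)
  then have "represents N (Abs_cabv m)" using assms by (simp add: represents_def m_def)
  then show ?thesis ..
qed

section \<open>The integral\<close>

text \<open>
  Summing over the range of \<open>g\<close>, and not over that of \<open>\<phi> \<circ> g \<circ> h\<close>, avoids reindexing when a
  simple integral is transported by an operator and by an image of the measure.
\<close>

lemma integral_simple_compose:
  fixes g :: "'s::topological_space \<Rightarrow> 'a::t2_space" and \<phi> :: "'a \<Rightarrow> 'b::{banach, second_countable_topology}"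
  assumes N: "finite_measure N" "sets N = sets borel"
    and g: "simple_function borel g" and h: "h \<in> borel_measurable borel"
  shows "(\<integral>t. \<phi> (g (h t)) \<partial>N) = (\<Sum>x\<in>range g. measure N (h -` g -` {x}) *\<^sub>R \<phi> x)"
proof -
  interpret finite_measure N by fact
  have fin: "finite (range g)" and gm: "\<And>x. g -` {x} \<in> sets borel"
    using g simple_functionD(2)[OF g] by (auto simp: simple_function_def)
  have hm: "h -` g -` {x} \<in> sets N" for x
    using measurable_sets[OF h gm[of x]] N by simp
  have "\<phi> (g (h t)) = (\<Sum>x\<in>range g. indicator (h -` g -` {x}) t *\<^sub>R \<phi> x)" for t
    by (subst sum.remove[OF fin, of "g (h t)"]) (auto intro!: sum.neutral simp: indicator_def)
  then have "(\<integral>t. \<phi> (g (h t)) \<partial>N) = (\<integral>t. (\<Sum>x\<in>range g. indicator (h -` g -` {x}) t *\<^sub>R \<phi> x) \<partial>N)"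
    by simp
  also have "\<dots> = (\<Sum>x\<in>range g. \<integral>t. indicator (h -` g -` {x}) t *\<^sub>R \<phi> x \<partial>N)"
    using hm by (intro Bochner_Integration.integral_sum integrable_scaleR_left)
      (auto simp: emeasure_eq_measure)
  also have "\<dots> = (\<Sum>x\<in>range g. measure N (h -` g -` {x}) *\<^sub>R \<phi> x)"
  proof (intro sum.cong refl)
    fix x
    have "(\<integral>t. indicator (h -` g -` {x}) t *\<^sub>R \<phi> x \<partial>N)
        = (\<integral>t. indicator (h -` g -` {x}) t \<partial>N) *\<^sub>R \<phi> x"
      using hm by (intro integral_scaleR_left) (auto simp: emeasure_eq_measure)
    also have "(\<integral>t. indicator (h -` g -` {x}) t \<partial>N) = measure N (h -` g -` {x})"
      using hm[of x] by (simp add: sets_eq_imp_space_eq[OF N(2)])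
    finally show "(\<integral>t. indicator (h -` g -` {x}) t *\<^sub>R \<phi> x \<partial>N) = measure N (h -` g -` {x}) *\<^sub>R \<phi> x" .
  qed
  finally show ?thesis .
qed

lemma tendsto_integral_uniform:
  fixes u :: "'a \<Rightarrow> 'b::{banach, second_countable_topology}"
  assumes "finite_measure N" and [measurable]: "\<And>m. s m \<in> borel_measurable N" "u \<in> borel_measurable N"
    and lim: "uniform_limit UNIV s u sequentially" and bdd: "bounded (range u)"
  shows "(\<lambda>m. \<integral>t. s m t \<partial>N) \<longlonglongrightarrow> (\<integral>t. u t \<partial>N)"
proof -
  interpret finite_measure N by fact
  obtain C where C: "\<And>t. norm (u t) \<le> C" using bdd by (auto simp: bounded_iff)
  have "\<forall>\<^sub>F m in sequentially. \<forall>t\<in>UNIV. dist (s m t) (u t) < 1"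
    using lim by (rule uniform_limitD) simp
  then obtain M where M: "\<And>m t. m \<ge> M \<Longrightarrow> dist (s m t) (u t) < 1"
    by (auto simp: eventually_sequentially)
  have "(\<lambda>m. \<integral>t. s (m + M) t \<partial>N) \<longlonglongrightarrow> (\<integral>t. u t \<partial>N)"
  proof (rule integral_dominated_convergence[where w = "\<lambda>_. C + 1"])
    show "AE t in N. (\<lambda>m. s (m + M) t) \<longlonglongrightarrow> u t"
      using tendsto_uniform_limitI[OF lim] by (intro AE_I2 LIMSEQ_ignore_initial_segment) auto
    show "AE t in N. norm (s (m + M) t) \<le> C + 1" for m
    proof (rule AE_I2)
      fix t
      have "norm (s (m + M) t) \<le> norm (u t) + norm (s (m + M) t - u t)"
        by (rule norm_triangle_sub)
      also have "\<dots> \<le> C + 1"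
        using C[of t] M[of "m + M" t] by (simp add: dist_norm)
      finally show "norm (s (m + M) t) \<le> C + 1" .
    qed
  qed auto
  then show ?thesis by (rule LIMSEQ_offset)
qed

lemma simple_vint_0: "simple_vint (\<lambda>_. 0) \<mu> = 0"
  by (simp add: simple_vint_def scalar_prod.zero_left)

lemma simple_vint_const: "simple_vint (\<lambda>_. x) \<mu> = scalar_prod x (cabv_on \<mu> UNIV)"
  by (simp add: simple_vint_def)

lemma simple_vint_add:
  "simple_vint g (\<mu> + \<nu>) = simple_vint g \<mu> + simple_vint g \<nu>"
  by (simp add: simple_vint_def scalar_prod.add_right sum.distrib)

lemma simple_vint_scaleR: "simple_vint g (c *\<^sub>R \<mu>) = c *\<^sub>R simple_vint g \<mu>"
  by (simp add: simple_vint_def scalar_prod.scaleR_right scaleR_sum_right)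

lemma simple_function_borel_vimage:
  "simple_function borel g \<Longrightarrow> g -` {x} \<in> sets borel"
  using simple_functionD(2)[of borel g] by simp

text \<open>
  Here \<open>\<nu>\<close> is the measure \<open>A \<circ> h(\<mu>)\<close> and \<open>S\<close> is the adjoint of \<open>A\<close>, which moves the operator from the
  measure to the integrand.
\<close>

lemma simple_vint_transport:
  fixes \<mu> \<nu> :: "('t::topological_space, 'k::real_or_complex ^ 'n::finite) cabv"
  assumes N: "represents N \<mu>" and g: "simple_function borel g" and h: "h \<in> borel \<rightarrow>\<^sub>M borel"
    and \<nu>: "\<And>B. B \<in> sets borel \<Longrightarrow> cabv_on \<nu> B = A (cabv_on \<mu> (h -` B))"
    and S: "\<And>x y. scalar_prod (S x) y = scalar_prod x (A y)"
  shows "simple_vint g \<nu> = (\<Sum>e\<in>signed_Basis. \<integral>t. scalar_prod (S (g (h t))) e \<partial>N e)"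
proof -
  let ?m = "\<lambda>e x. measure (N e) (h -` g -` {x})"
  have h': "h -` g -` {x} \<in> sets borel" for x
    using measurable_sets[OF h simple_function_borel_vimage[OF g, of x]] by simp
  have "simple_vint g \<nu> = (\<Sum>x\<in>range g. scalar_prod (S x) (\<Sum>e\<in>signed_Basis. ?m e x *\<^sub>R e))"
    using N h' simple_function_borel_vimage[OF g]
    by (simp add: simple_vint_def represents_def S \<nu>)
  also have "\<dots> = (\<Sum>x\<in>range g. \<Sum>e\<in>signed_Basis. ?m e x *\<^sub>R scalar_prod (S x) e)"
    by (simp add: scalar_prod.sum_right scalar_prod.scaleR_right)
  also have "\<dots> = (\<Sum>e\<in>signed_Basis. \<Sum>x\<in>range g. ?m e x *\<^sub>R scalar_prod (S x) e)"
    by (rule sum.swap)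
  also have "\<dots> = (\<Sum>e\<in>signed_Basis. \<integral>t. scalar_prod (S (g (h t))) e \<partial>N e)"
  proof (intro sum.cong refl)
    fix e :: "'k ^ 'n" assume "e \<in> signed_Basis"
    then have "finite_measure (N e)" "sets (N e) = sets borel" using N by (auto simp: represents_def)
    from integral_simple_compose[OF this g h, of "\<lambda>x. scalar_prod (S x) e"]
    show "(\<Sum>x\<in>range g. ?m e x *\<^sub>R scalar_prod (S x) e)
        = (\<integral>t. scalar_prod (S (g (h t))) e \<partial>N e)"
      by simp
  qed
  finally show ?thesis .
qed

lemma simple_vint_represents:
  assumes "represents N \<mu>" and "simple_function borel g"
  shows "simple_vint g \<mu> = (\<Sum>e\<in>signed_Basis. \<integral>t. scalar_prod (g t) e \<partial>N e)"
  using simple_vint_transport[OF assms measurable_ident, of \<mu> id id] by simp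

lemma norm_simple_vint_le:
  assumes g: "simple_function borel g"
  shows "norm (simple_vint g \<mu>) \<le> (\<integral>t. norm (g t) \<partial>variation_measure \<mu>)"
proof -
  have "norm (simple_vint g \<mu>)
      \<le> (\<Sum>x\<in>range g. measure (variation_measure \<mu>) (g -` {x}) *\<^sub>R norm x)"
    unfolding simple_vint_def
  proof (rule sum_norm_le)
    fix x
    have "norm (scalar_prod x (cabv_on \<mu> (g -` {x}))) \<le> norm x * norm (cabv_on \<mu> (g -` {x}))"
      by (rule norm_scalar_prod_le)
    also have "\<dots> \<le> norm x * measure (variation_measure \<mu>) (g -` {x})"
      using simple_function_borel_vimage[OF g]
      by (intro mult_left_mono norm_cabv_on_le_variation) auto
    finally show "norm (scalar_prod x (cabv_on \<mu> (g -` {x})))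
        \<le> measure (variation_measure \<mu>) (g -` {x}) *\<^sub>R norm x"
      by (simp add: mult.commute)
  qed
  also have "\<dots> = (\<integral>t. norm (g t) \<partial>variation_measure \<mu>)"
    using integral_simple_compose[OF finite_variation_measure[of \<mu>]
        sets_variation_measure[of \<mu>] g measurable_ident, where \<phi> = norm] by simp
  finally show ?thesis .
qed

text \<open>
  The parameter \<open>T\<close> only names the type of points, so that statements can refer to it.
\<close>

locale compact_metric =
  fixes T :: "'t::metric_space itself"
  assumes compact_UNIV: "compact (UNIV :: 't set)"
begin

lemma continuous_bounded:
  fixes f :: "'t \<Rightarrow> 'b::metric_space"
  shows "continuous_on UNIV f \<Longrightarrow> bounded (range f)"
  using compact_UNIV by (intro compact_imp_bounded compact_continuous_image)

lemma continuous_norm_bounded: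
  fixes f :: "'t \<Rightarrow> 'b::real_normed_vector"
  assumes "continuous_on UNIV f"
  obtains C where "0 \<le> C" "\<And>t. norm (f t) \<le> C"
  using continuous_bounded[OF assms] by (auto simp: bounded_pos intro: less_imp_le)

lemma ex_simple_close:
  fixes f :: "'t \<Rightarrow> 'b::metric_space"
  assumes f: "continuous_on UNIV f" and "0 < \<epsilon>"
  shows "\<exists>g. simple_function borel g \<and> (\<forall>t. dist (g t) (f t) < \<epsilon>)"
proof -
  have "compact (range f)"
    using compact_UNIV f by (rule compact_continuous_image[rotated])
  then obtain k where k: "finite k" "range f \<subseteq> (\<Union>x\<in>k. ball x \<epsilon>)"
    using \<open>0 < \<epsilon>\<close> by (auto simp: compact_eq_totally_bounded)
  from k(1) obtain y and n :: nat where y: "k = y ` {..<n}"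
    by (auto simp: finite_conv_nat_seg_image lessThan_def)
  define i where "i t = (LEAST i. dist (y i) (f t) < \<epsilon>)" for t
  have i: "dist (y (i t)) (f t) < \<epsilon> \<and> i t < n" for t
  proof -
    have "f t \<in> (\<Union>x\<in>k. ball x \<epsilon>)" using k(2) by blast
    then obtain j where j: "j < n" "dist (y j) (f t) < \<epsilon>" by (auto simp: y)
    show ?thesis
      using LeastI[of "\<lambda>i. dist (y i) (f t) < \<epsilon>", OF j(2)]
        Least_le[of "\<lambda>i. dist (y i) (f t) < \<epsilon>", OF j(2)] j(1)
      by (auto simp: i_def)
  qed
  have "(\<lambda>t. dist (y j) (f t)) \<in> borel_measurable borel" for j
    using f by (intro borel_measurable_continuous_onI continuous_intros)
  note [measurable] = this
  have "i \<in> measurable borel (count_space UNIV)"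
    unfolding i_def by measurable
  then have "(\<lambda>t. y (i t)) \<in> borel_measurable borel"
    by (rule measurable_compose) simp
  moreover have "range (\<lambda>t. y (i t)) \<subseteq> y ` {..<n}" using i by auto
  then have "finite (range (\<lambda>t. y (i t)))" by (rule finite_subset) simp
  ultimately have "simple_function borel (\<lambda>t. y (i t))"
    using i by (intro simple_function_borel_measurable) auto
  then show ?thesis using i by (intro exI[of _ "\<lambda>t. y (i t)"]) auto
qed

lemma ex_simple_uniform_limit:
  fixes f :: "'t \<Rightarrow> 'b::metric_space"
  assumes f: "continuous_on UNIV f"
  obtains g where "\<And>m. simple_function borel (g m)" "uniform_limit UNIV g f sequentially"
proof -
  have "\<forall>m. \<exists>g. simple_function borel g \<and> (\<forall>t. dist (g t) (f t) < inverse (Suc m))"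
    using ex_simple_close[OF f] by simp
  then obtain g where g: "\<And>m. simple_function borel (g m)"
      "\<And>m t. dist (g m t) (f t) < inverse (Suc m)"
    by metis
  have "uniform_limit UNIV g f sequentially"
  proof (rule uniform_limitI)
    fix \<epsilon> :: real assume "0 < \<epsilon>"
    then obtain M where M: "inverse (Suc M) < \<epsilon>" using reals_Archimedean by blast
    show "\<forall>\<^sub>F m in sequentially. \<forall>t\<in>UNIV. dist (g m t) (f t) < \<epsilon>"
    proof (rule eventually_sequentiallyI[of M], intro ballI)
      fix m t assume "M \<le> m"
      then have "inverse (real (Suc m)) \<le> inverse (Suc M)" by (intro le_imp_inverse_le) auto
      then have "inverse (real (Suc m)) < \<epsilon>" using M by (rule le_less_trans)
      with g(2) show "dist (g m t) (f t) < \<epsilon>" by (rule less_trans)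
    qed
  qed
  then show thesis using g(1) that by blast
qed

lemma integrable_continuous:
  fixes u :: "'t \<Rightarrow> 'b::{banach, second_countable_topology}"
  assumes "finite_measure N" "sets N = sets borel" "continuous_on UNIV u"
  shows "integrable N u"
proof -
  interpret finite_measure N by fact
  obtain C where "\<And>t. norm (u t) \<le> C" using continuous_norm_bounded[OF assms(3)] by blast
  moreover have "u \<in> borel_measurable N"
    using borel_measurable_continuous_onI[OF assms(3)] measurable_cong_sets[OF assms(2) refl] by blast
  ultimately show ?thesis by (intro integrable_const_bound[of _ C]) auto
qed

text \<open>
  A uniform limit of simple functions may be integrated termwise against each of the finite
  measures \<open>N e\<close>.  As the right-hand side does not depend on \<open>g\<close>, the limit that
  defines \<open>vint\<close> is unique.
\<close>

lemma simple_vint_tendsto_integral: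
  fixes f :: "'t \<Rightarrow> 'k::real_or_complex ^ 'n::finite"
  assumes f: "continuous_on UNIV f" and N: "represents N \<mu>"
    and g: "\<And>m. simple_function borel (g m)" "uniform_limit UNIV g f sequentially"
  shows "(\<lambda>m. simple_vint (g m) \<mu>) \<longlonglongrightarrow> (\<Sum>e\<in>signed_Basis. \<integral>t. scalar_prod (f t) e \<partial>N e)"
proof -
  have "(\<lambda>m. \<integral>t. scalar_prod (g m t) e \<partial>N e) \<longlonglongrightarrow> (\<integral>t. scalar_prod (f t) e \<partial>N e)"
    if "e \<in> signed_Basis" for e :: "'k ^ 'n"
  proof -
    have Ne: "finite_measure (N e)" "sets (N e) = sets borel"
      using N that by (auto simp: represents_def)
    have cont: "continuous_on UNIV (\<lambda>t. scalar_prod (f t) e)"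
      by (intro bounded_linear.continuous_on[OF scalar_prod.bounded_linear_left] f)
    show ?thesis
    proof (rule tendsto_integral_uniform[OF Ne(1)])
      show "(\<lambda>t. scalar_prod (g m t) e) \<in> borel_measurable (N e)" for m
        using simple_function_compose1[OF g(1)[of m], of "\<lambda>x. scalar_prod x e"]
        unfolding measurable_cong_sets[OF Ne(2) refl] by (rule borel_measurable_simple_function)
      show "(\<lambda>t. scalar_prod (f t) e) \<in> borel_measurable (N e)"
        using integrable_continuous[OF Ne cont] by auto
      show "uniform_limit UNIV (\<lambda>m t. scalar_prod (g m t) e) (\<lambda>t. scalar_prod (f t) e) sequentially"
        by (rule bounded_linear.uniform_limit[OF scalar_prod.bounded_linear_left g(2)])
    qed (rule continuous_bounded[OF cont])
  qed
  then show ?thesis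
    unfolding simple_vint_represents[OF N g(1)] by (rule tendsto_sum)
qed

lemma vint_represents:
  fixes f :: "'t \<Rightarrow> 'k::real_or_complex ^ 'n::finite"
  assumes f: "continuous_on UNIV f" and N: "represents N \<mu>"
  shows "vint f \<mu> = (\<Sum>e\<in>signed_Basis. \<integral>t. scalar_prod (f t) e \<partial>N e)"
  unfolding vint_def
proof (rule the_equality)
  obtain g where "\<And>m. simple_function borel (g m)" "uniform_limit UNIV g f sequentially"
    using ex_simple_uniform_limit[OF f] by blast
  then show "\<exists>g. (\<forall>m. simple_function borel (g m)) \<and> uniform_limit UNIV g f sequentially \<and>
      (\<lambda>m. simple_vint (g m) \<mu>) \<longlonglongrightarrow> (\<Sum>e\<in>signed_Basis. \<integral>t. scalar_prod (f t) e \<partial>N e)"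
    using simple_vint_tendsto_integral[OF f N] by blast
next
  fix L assume "\<exists>g. (\<forall>m. simple_function borel (g m)) \<and> uniform_limit UNIV g f sequentially \<and>
      (\<lambda>m. simple_vint (g m) \<mu>) \<longlonglongrightarrow> L"
  then show "L = (\<Sum>e\<in>signed_Basis. \<integral>t. scalar_prod (f t) e \<partial>N e)"
    using simple_vint_tendsto_integral[OF f N] LIMSEQ_unique by blast
qed

lemma simple_vint_tendsto_vint:
  fixes f :: "'t \<Rightarrow> 'k::real_or_complex ^ 'n::finite"
  assumes f: "continuous_on UNIV f"
    and g: "\<And>m. simple_function borel (g m)" "uniform_limit UNIV g f sequentially"
  shows "(\<lambda>m. simple_vint (g m) \<mu>) \<longlonglongrightarrow> vint f \<mu>"
proof -
  obtain N where "represents N \<mu>" using ex_represents by blast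
  then show ?thesis
    using simple_vint_tendsto_integral[OF f _ g] vint_represents[OF f] by simp
qed

text \<open>
  The change of variables behind the contraction property.  Both sides are limits of the same
  sums, formed with simple approximations \<open>g m\<close> of \<open>f\<close> on the left and with the simple
  functions \<open>R\<^sup>* \<circ> g m \<circ> h\<close> on the right.
\<close>

lemma vint_apply_image:
  fixes f :: "'t \<Rightarrow> 'k::real_or_complex ^ 'n::finite"
  assumes f: "continuous_on UNIV f" and h: "continuous_on UNIV h"
    and R: "Vector_Spaces.linear (*s) (*s) (blinfun_apply R)"
  shows "vint f (cabv_apply R (cabv_image h \<mu>)) = vint (\<lambda>t. kadjoint R (f (h t))) \<mu>"
proof -
  obtain N where N: "represents N \<mu>" using ex_represents by blast
  obtain g where g: "\<And>m. simple_function borel (g m)" "uniform_limit UNIV g f sequentially"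
    using ex_simple_uniform_limit[OF f] by blast
  have hm: "h \<in> borel \<rightarrow>\<^sub>M borel" by (rule borel_measurable_continuous_onI[OF h])
  define R' where "R' = kadjoint (blinfun_apply R)"
  have R': "bounded_linear R'" unfolding R'_def by (rule bounded_linear_kadjoint[OF R])
  have cont: "continuous_on UNIV (\<lambda>t. R' (f (h t)))"
    by (intro bounded_linear.continuous_on[OF R'] continuous_on_compose2[OF f h]) auto
  have simp': "simple_function borel (\<lambda>t. R' (g m (h t)))" for m
  proof -
    have "simple_function borel (\<lambda>t. g m (h t))"
    proof (rule simple_function_borel_measurable)
      show "(\<lambda>t. g m (h t)) \<in> borel_measurable borel"
        using hm borel_measurable_simple_function[OF g(1)[of m]] by (rule measurable_compose)
      have "range (\<lambda>t. g m (h t)) \<subseteq> range (g m)" "finite (range (g m))"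
        using g(1)[of m] by (auto simp: simple_function_def)
      then show "finite ((\<lambda>t. g m (h t)) ` space borel)" by (simp add: finite_subset)
    qed
    then show ?thesis by (rule simple_function_compose1)
  qed
  have unif: "uniform_limit UNIV (\<lambda>m t. R' (g m (h t))) (\<lambda>t. R' (f (h t))) sequentially"
  proof (rule bounded_linear.uniform_limit[OF R'])
    show "uniform_limit UNIV (\<lambda>m t. g m (h t)) (\<lambda>t. f (h t)) sequentially"
      by (intro uniform_limitI, rule eventually_mono[OF uniform_limitD[OF g(2)]]) auto
  qed
  have "simple_vint (g m) (cabv_apply R (cabv_image h \<mu>)) = simple_vint (\<lambda>t. R' (g m (h t))) \<mu>" for m
    using simple_vint_transport[OF N g(1) hm, of "cabv_apply R (cabv_image h \<mu>)" R R' m]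
      simple_vint_represents[OF N simp', of m]
    by (simp add: cabv_on_image[OF hm] scalar_prod_kadjoint[OF R] R'_def)
  moreover have "(\<lambda>m. simple_vint (\<lambda>t. R' (g m (h t))) \<mu>) \<longlonglongrightarrow> vint (\<lambda>t. R' (f (h t))) \<mu>"
    by (rule simple_vint_tendsto_vint[OF cont simp' unif])
  ultimately show ?thesis
    using simple_vint_tendsto_vint[OF f g, of "cabv_apply R (cabv_image h \<mu>)"] LIMSEQ_unique
    by (auto simp: R'_def)
qed

lemma vint_const: "vint (\<lambda>_. x) \<mu> = scalar_prod x (cabv_on (\<mu> :: ('t, _) cabv) UNIV)"
proof -
  have "(\<lambda>m::nat. simple_vint (\<lambda>_. x) \<mu>) \<longlonglongrightarrow> vint (\<lambda>_. x) \<mu>"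
    by (rule simple_vint_tendsto_vint) (auto intro: uniform_limit_const)
  then show ?thesis by (simp add: simple_vint_const LIMSEQ_const_iff)
qed

text \<open>
  The estimate \<open>|\<integral> u d\<mu>| \<le> \<integral> \<parallel>u\<parallel> d|\<mu>|\<close> for \<open>u = f - s\<close>, stated for a continuous and a simple
  function because their difference need be neither.
\<close>

lemma norm_vint_diff_simple_le:
  fixes f :: "'t \<Rightarrow> 'k::real_or_complex ^ 'n::finite"
  assumes f: "continuous_on UNIV f" and s: "simple_function borel s"
  shows "norm (vint f \<mu> - simple_vint s \<mu>) \<le> (\<integral>t. norm (f t - s t) \<partial>variation_measure \<mu>)"
proof -
  interpret V: finite_measure "variation_measure \<mu>" by (rule finite_variation_measure)
  obtain N where N: "represents N \<mu>" using ex_represents by blast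
  obtain g where g: "\<And>m. simple_function borel (g m)" "uniform_limit UNIV g f sequentially"
    using ex_simple_uniform_limit[OF f] by blast
  have simp': "simple_function borel (\<lambda>t. g m t - s t)" for m
    using g(1) s by (intro simple_function_diff)
  have diff: "simple_vint (\<lambda>t. g m t - s t) \<mu> = simple_vint (g m) \<mu> - simple_vint s \<mu>" for m
  proof -
    have "(\<integral>t. scalar_prod (g m t - s t) e \<partial>N e)
        = (\<integral>t. scalar_prod (g m t) e \<partial>N e) - (\<integral>t. scalar_prod (s t) e \<partial>N e)"
      if "e \<in> signed_Basis" for e :: "'k ^ 'n"
    proof -
      have Ne: "finite_measure (N e)" "sets (N e) = sets borel"
        using N that by (auto simp: represents_def)
      interpret finite_measure "N e" by fact
      have int: "integrable (N e) (\<lambda>t. scalar_prod (p t) e)" if "simple_function borel p" for p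
      proof -
        have sp: "simple_function borel (\<lambda>t. scalar_prod (p t) e)"
          using that by (rule simple_function_compose1)
        then have "finite (range (\<lambda>t. scalar_prod (p t) e))" by (simp add: simple_function_def)
        then obtain C where "\<And>t. norm (scalar_prod (p t) e) \<le> C"
          using finite_imp_bounded[of "range (\<lambda>t. scalar_prod (p t) e)"] by (auto simp: bounded_iff)
        moreover have "(\<lambda>t. scalar_prod (p t) e) \<in> borel_measurable (N e)"
          using borel_measurable_simple_function[OF sp]
          unfolding measurable_cong_sets[OF Ne(2) refl] .
        ultimately show ?thesis by (intro integrable_const_bound[of _ C]) auto
      qed
      show ?thesis
        using int[OF g(1)] int[OF s] by (simp add: scalar_prod.diff_left)
    qed
    then show ?thesis
      by (simp add: simple_vint_represents[OF N] simp' g(1) s sum_subtractf)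
  qed
  have m: "(\<lambda>t. norm (g m t - s t)) \<in> borel_measurable (variation_measure \<mu>)" for m
    using borel_measurable_simple_function[OF simp'] by simp
  have fm: "f \<in> borel_measurable borel" by (rule borel_measurable_continuous_onI[OF f])
  have sm: "s \<in> borel_measurable borel" by (rule borel_measurable_simple_function[OF s])
  have "(\<lambda>m. \<integral>t. norm (g m t - s t) \<partial>variation_measure \<mu>)
      \<longlonglongrightarrow> (\<integral>t. norm (f t - s t) \<partial>variation_measure \<mu>)"
  proof (rule tendsto_integral_uniform[OF V.finite_measure_axioms m])
    show "(\<lambda>t. norm (f t - s t)) \<in> borel_measurable (variation_measure \<mu>)"
      using fm sm by simp
    show "uniform_limit UNIV (\<lambda>m t. norm (g m t - s t)) (\<lambda>t. norm (f t - s t)) sequentially"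
      by (intro uniform_limit_intros g(2))
    have "finite (range s)" using s by (simp add: simple_function_def)
    then obtain D where D: "\<And>t. norm (s t) \<le> D"
      using finite_imp_bounded[of "range s"] by (auto simp: bounded_iff)
    obtain C where C: "\<And>t. norm (f t) \<le> C" using continuous_norm_bounded[OF f] by blast
    have "norm (f t - s t) \<le> C + D" for t
      using norm_triangle_ineq4[of "f t" "s t"] C[of t] D[of t] by simp
    then show "bounded (range (\<lambda>t. norm (f t - s t)))" by (auto simp: bounded_iff)
  qed
  moreover have "(\<lambda>m. norm (simple_vint (g m) \<mu> - simple_vint s \<mu>)) \<longlonglongrightarrow> norm (vint f \<mu> - simple_vint s \<mu>)"
    by (intro tendsto_intros simple_vint_tendsto_vint f g)
  ultimately show ?thesis
    using norm_simple_vint_le[OF simp', of _ \<mu>] unfolding diff by (intro LIMSEQ_le) auto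
qed

lemma norm_vint_le_integral:
  fixes f :: "'t \<Rightarrow> 'k::real_or_complex ^ 'n::finite"
  assumes "continuous_on UNIV f"
  shows "norm (vint f \<mu>) \<le> (\<integral>t. norm (f t) \<partial>variation_measure \<mu>)"
  using norm_vint_diff_simple_le[OF assms, of "\<lambda>_. 0" \<mu>] by (simp add: simple_vint_0)

lemma norm_vint_le:
  fixes f :: "'t \<Rightarrow> 'k::real_or_complex ^ 'n::finite"
  assumes f: "continuous_on UNIV f" and C: "\<And>t. norm (f t) \<le> C"
  shows "norm (vint f \<mu>) \<le> C * norm \<mu>"
proof -
  interpret V: finite_measure "variation_measure \<mu>" by (rule finite_variation_measure)
  have "norm (vint f \<mu>) \<le> (\<integral>t. norm (f t) \<partial>variation_measure \<mu>)"
    by (rule norm_vint_le_integral[OF f])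
  also have "\<dots> \<le> (\<integral>t. C \<partial>variation_measure \<mu>)"
    using C by (intro integral_mono integrable_continuous continuous_intros f
        V.finite_measure_axioms) auto
  finally show ?thesis by (simp add: measure_variation_measure_UNIV mult.commute)
qed

lemma bounded_linear_vint:
  fixes f :: "'t \<Rightarrow> 'k::real_or_complex ^ 'n::finite"
  assumes f: "continuous_on UNIV f"
  shows "bounded_linear (vint f)"
proof -
  obtain g where g: "\<And>m. simple_function borel (g m)" "uniform_limit UNIV g f sequentially"
    using ex_simple_uniform_limit[OF f] by blast
  note lim = simple_vint_tendsto_vint[OF f g]
  obtain C where C: "\<And>t. norm (f t) \<le> C" using continuous_norm_bounded[OF f] by blast
  show ?thesis
  proof (rule bounded_linear_intro)
    show "vint f (\<mu> + \<nu>) = vint f \<mu> + vint f \<nu>" for \<mu> \<nu>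
      using tendsto_add[OF lim lim, of \<mu> \<nu>] lim[of "\<mu> + \<nu>"]
      by (simp add: simple_vint_add LIMSEQ_unique)
    show "vint f (c *\<^sub>R \<mu>) = c *\<^sub>R vint f \<mu>" for c \<mu>
      using tendsto_scaleR[OF tendsto_const lim, of c \<mu>] lim[of "c *\<^sub>R \<mu>"]
      by (simp add: simple_vint_scaleR LIMSEQ_unique)
    show "norm (vint f \<mu>) \<le> norm \<mu> * C" for \<mu>
      using norm_vint_le[OF f C, of \<mu>] by (simp add: mult.commute)
  qed
qed

lemma continuous_scalar_prod_left:
  fixes f :: "'t \<Rightarrow> 'k::real_or_complex ^ 'n::finite"
  shows "continuous_on UNIV f \<Longrightarrow> continuous_on UNIV (\<lambda>t. scalar_prod (f t) x)"
  by (rule bounded_linear.continuous_on[OF scalar_prod.bounded_linear_left])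

lemma integrable_scalar_prod:
  fixes f :: "'t \<Rightarrow> 'k::real_or_complex ^ 'n::finite"
  assumes "represents N \<mu>" "e \<in> signed_Basis" "continuous_on UNIV f"
  shows "integrable (N e) (\<lambda>t. scalar_prod (f t) e)"
  using assms by (intro integrable_continuous continuous_scalar_prod_left) (auto simp: represents_def)

lemma vint_add:
  fixes f g :: "'t \<Rightarrow> 'k::real_or_complex ^ 'n::finite"
  assumes "continuous_on UNIV f" "continuous_on UNIV g"
  shows "vint (\<lambda>t. f t + g t) \<mu> = vint f \<mu> + vint g \<mu>"
proof -
  obtain N where N: "represents N \<mu>" using ex_represents by blast
  show ?thesis
    using assms integrable_scalar_prod[OF N]
    by (simp add: vint_represents[OF _ N] continuous_on_add scalar_prod.add_left sum.distrib)
qed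

lemma vint_scale:
  fixes f :: "'t \<Rightarrow> 'k::real_or_complex ^ 'n::finite"
  assumes "continuous_on UNIV f"
  shows "vint (\<lambda>t. u *s f t) \<mu> = u * vint f \<mu>"
proof -
  obtain N where N: "represents N \<mu>" using ex_represents by blast
  have "continuous_on UNIV (\<lambda>t. u *s f t)"
    unfolding vector_scalar_mult_def using assms by (intro continuous_intros)
  then show ?thesis
    using assms integrable_scalar_prod[OF N]
    by (simp add: vint_represents[OF _ N] scalar_prod_scale_left sum_distrib_left)
qed

lemma vint_scaleR:
  fixes f :: "'t \<Rightarrow> 'k::real_or_complex ^ 'n::finite"
  assumes "continuous_on UNIV f"
  shows "vint (\<lambda>t. c *\<^sub>R f t) \<mu> = c *\<^sub>R vint f \<mu>"
proof -
  have "c *\<^sub>R x = of_real c *s x" for x :: "'k ^ 'n"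
    by (simp only: vec_eq_iff vector_smult_component vector_scaleR_component)
       (simp add: scaleR_conv_of_real)
  then show ?thesis using vint_scale[OF assms, of "of_real c" \<mu>] by (simp add: scaleR_conv_of_real)
qed

lemma vint_diff:
  fixes f g :: "'t \<Rightarrow> 'k::real_or_complex ^ 'n::finite"
  assumes "continuous_on UNIV f" "continuous_on UNIV g"
  shows "vint (\<lambda>t. f t - g t) \<mu> = vint f \<mu> - vint g \<mu>"
  using vint_add[OF assms(1) continuous_on_minus[OF assms(2)], of \<mu>]
    vint_scaleR[OF assms(2), of "-1" \<mu>] by simp

lemma vint_inner_1:
  fixes f :: "'t \<Rightarrow> 'k::real_or_complex ^ 'n::finite"
  assumes f: "continuous_on UNIV f" and N: "represents N \<mu>"
  shows "vint f \<mu> \<bullet> 1 = (\<Sum>e\<in>signed_Basis. \<integral>t. f t \<bullet> e \<partial>N e)"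
proof -
  have "(\<integral>t. scalar_prod (f t) e \<partial>N e) \<bullet> 1 = (\<integral>t. f t \<bullet> e \<partial>N e)" if "e \<in> signed_Basis" for e
    using integral_inner_left[OF integrable_scalar_prod[OF N that f], of 1]
    by (simp add: inner_scalar_prod)
  then show ?thesis by (simp add: vint_represents[OF f N] inner_sum_left)
qed

end

section \<open>Approximation by Lipschitz functions and the norm of a measure\<close>

lemma lip_le_iff: "0 \<le> L \<Longrightarrow> lip f \<le> ennreal L \<longleftrightarrow> L-lipschitz_on UNIV f"
proof -
  assume L: "0 \<le> L"
  have "ennreal (dist (f x) (f y) / dist x y) \<le> ennreal L \<longleftrightarrow> dist (f x) (f y) \<le> L * dist x y"
    if "x \<noteq> y" for x y
    using that L by (simp add: ennreal_le_iff divide_le_eq)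
  then have "lip f \<le> ennreal L \<longleftrightarrow> (\<forall>x y. x \<noteq> y \<longrightarrow> dist (f x) (f y) \<le> L * dist x y)"
    unfolding lip_const_def SUP_le_iff by auto
  also have "\<dots> \<longleftrightarrow> L-lipschitz_on UNIV f"
    using L unfolding lipschitz_on_def by (metis UNIV_I dist_self mult_zero_right order_refl)
  finally show ?thesis .
qed

lemma lipschitz_on_lip: "lip f < \<infinity> \<Longrightarrow> (enn2real (lip f))-lipschitz_on UNIV f"
  by (subst lip_le_iff[symmetric]) (auto simp: less_top)

lemma lipschitz_imp_continuous: "L-lipschitz_on UNIV f \<Longrightarrow> continuous_on UNIV f"
  by (rule lipschitz_on_continuous_on)

lemma lipschitz_max_min:
  fixes f :: "'a::metric_space \<Rightarrow> real"
  assumes "L-lipschitz_on UNIV f"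
  shows "L-lipschitz_on UNIV (\<lambda>t. max c (f t))" "L-lipschitz_on UNIV (\<lambda>t. min c (f t))"
proof -
  have "\<bar>f x - f y\<bar> \<le> L * dist x y" for x y
    using lipschitz_onD[OF assms, of x y] by (simp add: dist_real_def)
  moreover have "\<bar>max c (f x) - max c (f y)\<bar> \<le> \<bar>f x - f y\<bar>"
    "\<bar>min c (f x) - min c (f y)\<bar> \<le> \<bar>f x - f y\<bar>" for x y by linarith+
  ultimately show "L-lipschitz_on UNIV (\<lambda>t. max c (f t))" "L-lipschitz_on UNIV (\<lambda>t. min c (f t))"
    using lipschitz_on_nonneg[OF assms] order_trans by (fastforce simp: lipschitz_on_def dist_real_def)+
qed

lemma lipschitz_scaleR:
  fixes u :: "'a::metric_space \<Rightarrow> real"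
  assumes u: "L-lipschitz_on UNIV u" and x: "norm x \<le> 1"
  shows "L-lipschitz_on UNIV (\<lambda>t. u t *\<^sub>R x)"
proof (rule lipschitz_onI)
  fix t t'
  have "dist (u t *\<^sub>R x) (u t' *\<^sub>R x) = dist (u t) (u t') * norm x"
    by (simp add: dist_norm dist_real_def flip: scaleR_diff_left)
  also have "\<dots> \<le> dist (u t) (u t') * 1" using x by (intro mult_left_mono) auto
  also have "\<dots> \<le> L * dist t t'" using lipschitz_onD[OF u] by simp
  finally show "dist (u t *\<^sub>R x) (u t' *\<^sub>R x) \<le> L * dist t t'" .
qed (rule lipschitz_on_nonneg[OF u])

lemma lipschitz_sum:
  fixes f :: "'i \<Rightarrow> 'a::metric_space \<Rightarrow> 'b::real_normed_vector"
  assumes "finite I" "\<And>i. i \<in> I \<Longrightarrow> \<exists>L. L-lipschitz_on UNIV (f i)"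
  shows "\<exists>L. L-lipschitz_on UNIV (\<lambda>t. \<Sum>i\<in>I. f i t)"
  using assms
proof (induction I rule: finite_induct)
  case empty
  have "0-lipschitz_on UNIV (\<lambda>_::'a. 0::'b)" by (simp add: lipschitz_on_def)
  then show ?case by auto
next
  case (insert i I)
  then obtain L L' where "L-lipschitz_on UNIV (f i)" "L'-lipschitz_on UNIV (\<lambda>t. \<Sum>i\<in>I. f i t)"
    by blast
  then have "(L + L')-lipschitz_on UNIV (\<lambda>t. f i t + (\<Sum>i\<in>I. f i t))" by (rule lipschitz_on_add)
  then show ?case using insert(1,2) by auto
qed

definition unit_lipschitz :: "('t::metric_space \<Rightarrow> real) set" where
  "unit_lipschitz = {\<phi>. (\<exists>L. L-lipschitz_on UNIV \<phi>) \<and> (\<forall>t. 0 \<le> \<phi> t \<and> \<phi> t \<le> 1)}"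

text \<open>
  The indicator of \<open>B\<close> is a limit in \<open>L\<^sup>1(M)\<close> of Lipschitz functions with values in \<open>[0, 1]\<close>.
\<close>

definition lipschitz_approximable :: "'t::metric_space measure \<Rightarrow> 't set \<Rightarrow> bool" where
  "lipschitz_approximable M B \<longleftrightarrow>
     (\<forall>\<epsilon>>0. \<exists>\<phi>\<in>unit_lipschitz. (\<integral>t. \<bar>\<phi> t - indicator B t\<bar> \<partial>M) < (\<epsilon>::real))"

lemma lipschitz_approximableE:
  assumes "lipschitz_approximable M B" "0 < \<epsilon>"
  obtains \<phi> where "\<phi> \<in> unit_lipschitz" "(\<integral>t. \<bar>\<phi> t - indicator B t\<bar> \<partial>M) < \<epsilon>"
  using assms unfolding lipschitz_approximable_def by blast

lemma unit_lipschitz_range: "\<phi> \<in> unit_lipschitz \<Longrightarrow> 0 \<le> \<phi> t \<and> \<phi> t \<le> 1"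
  by (simp add: unit_lipschitz_def)

lemma integrable_unit_lipschitz:
  fixes \<phi> :: "'t::metric_space \<Rightarrow> real"
  assumes "finite_measure M" "sets M = sets borel" "B \<in> sets borel" and \<phi>: "\<phi> \<in> unit_lipschitz"
  shows "integrable M (\<lambda>t. \<bar>\<phi> t - indicator B t\<bar>)"
proof -
  interpret finite_measure M by fact
  have "\<phi> \<in> borel_measurable borel"
    using \<phi> lipschitz_imp_continuous
    by (intro borel_measurable_continuous_onI) (auto simp: unit_lipschitz_def)
  then have "(\<lambda>t. \<bar>\<phi> t - indicator B t\<bar>) \<in> borel_measurable M"
    using assms(3) unfolding measurable_cong_sets[OF assms(2) refl] by simp
  moreover have "\<bar>\<phi> t - indicator B t\<bar> \<le> 1" for t
    using unit_lipschitz_range[OF \<phi>, of t] by (auto simp: indicator_def)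
  ultimately show ?thesis by (intro integrable_const_bound[of _ 1]) auto
qed

text \<open>
  If \<open>C\<close> is not empty, the functions \<open>max 0 (1 - k dist(t, C))\<close> decrease to the indicator of \<open>C\<close>.
\<close>

lemma lipschitz_approximable_closed:
  fixes M :: "'t::metric_space measure"
  assumes M: "finite_measure M" "sets M = sets borel" and C: "closed C"
  shows "lipschitz_approximable M C"
proof (cases "C = {}")
  case True
  have "(\<lambda>_. 0) \<in> (unit_lipschitz :: ('t \<Rightarrow> real) set)"
    by (auto simp: unit_lipschitz_def lipschitz_on_def intro!: exI[of _ 0])
  then show ?thesis
    unfolding lipschitz_approximable_def True by (intro allI impI bexI[of _ "\<lambda>_. 0"]) simp_all
next
  case False
  interpret finite_measure M by fact
  define \<phi> where "\<phi> k t = max 0 (1 - real k * infdist t C)" for k :: nat and t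
  have lip: "(real k)-lipschitz_on UNIV (\<phi> k)" for k
    unfolding \<phi>_def
  proof (rule lipschitz_max_min(1), rule lipschitz_onI)
    fix x y
    have "dist (1 - real k * infdist x C) (1 - real k * infdist y C)
        = real k * \<bar>infdist x C - infdist y C\<bar>"
      by (simp add: dist_real_def abs_mult abs_minus_commute flip: right_diff_distrib)
    also have "\<dots> \<le> real k * dist x y"
      by (intro mult_left_mono infdist_triangle_abs) auto
    finally show "dist (1 - real k * infdist x C) (1 - real k * infdist y C) \<le> real k * dist x y" .
  qed simp
  have range: "0 \<le> \<phi> k t \<and> \<phi> k t \<le> 1" for k t
    by (simp add: \<phi>_def infdist_nonneg)
  have unit: "\<phi> k \<in> unit_lipschitz" for k using lip range by (auto simp: unit_lipschitz_def)
  have int: "integrable M (\<lambda>t. \<bar>\<phi> k t - indicator C t\<bar>)" for k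
    using C by (intro integrable_unit_lipschitz[OF M _ unit]) simp
  have "(\<lambda>k. \<integral>t. \<bar>\<phi> k t - indicator C t\<bar> \<partial>M) \<longlonglongrightarrow> (\<integral>t. 0 \<partial>M)"
  proof (rule integral_dominated_convergence[where w = "\<lambda>_. 1"])
    show "AE t in M. norm \<bar>\<phi> k t - indicator C t\<bar> \<le> 1" for k
    proof (rule AE_I2)
      fix t
      show "norm \<bar>\<phi> k t - indicator C t\<bar> \<le> 1"
        using range[of k t] by (auto simp: indicator_def)
    qed
    show "AE t in M. (\<lambda>k. \<bar>\<phi> k t - indicator C t\<bar>) \<longlonglongrightarrow> 0"
    proof (rule AE_I2)
      fix t
      have "\<forall>\<^sub>F k in sequentially. \<bar>\<phi> k t - indicator C t\<bar> = 0"
      proof (cases "t \<in> C")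
        case True
        then show ?thesis by (simp add: \<phi>_def)
      next
        case False
        then have pos: "0 < infdist t C"
          using in_closed_iff_infdist_zero[OF C \<open>C \<noteq> {}\<close>, of t] infdist_nonneg[of t C] by linarith
        obtain K :: nat where K: "1 < real K * infdist t C"
          using reals_Archimedean3[OF pos] by blast
        show ?thesis
        proof (rule eventually_sequentiallyI[of K])
          fix k assume "K \<le> k"
          then have "real K * infdist t C \<le> real k * infdist t C"
            using pos by (intro mult_right_mono) auto
          then show "\<bar>\<phi> k t - indicator C t\<bar> = 0" using K False by (simp add: \<phi>_def)
        qed
      qed
      then show "(\<lambda>k. \<bar>\<phi> k t - indicator C t\<bar>) \<longlonglongrightarrow> 0" by (rule tendsto_eventually)
    qed
  qed (use int in auto)
  then have lim: "(\<lambda>k. \<integral>t. \<bar>\<phi> k t - indicator C t\<bar> \<partial>M) \<longlonglongrightarrow> 0" by simp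
  show ?thesis
    unfolding lipschitz_approximable_def
  proof (intro allI impI)
    fix \<epsilon> :: real assume "0 < \<epsilon>"
    then have "\<forall>\<^sub>F k in sequentially. (\<integral>t. \<bar>\<phi> k t - indicator C t\<bar> \<partial>M) < \<epsilon>"
      using lim by (rule order_tendstoD(2)[rotated])
    then obtain k where "(\<integral>t. \<bar>\<phi> k t - indicator C t\<bar> \<partial>M) < \<epsilon>"
      by (auto simp: eventually_sequentially)
    then show "\<exists>\<phi>\<in>unit_lipschitz. (\<integral>t. \<bar>\<phi> t - indicator C t\<bar> \<partial>M) < \<epsilon>"
      using unit by blast
  qed
qed

lemma lipschitz_approximable_Compl:
  assumes B: "lipschitz_approximable M B"
  shows "lipschitz_approximable M (- B)"
  unfolding lipschitz_approximable_def
proof (intro allI impI)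
  fix \<epsilon> :: real assume "0 < \<epsilon>"
  with B obtain \<phi> where \<phi>: "\<phi> \<in> unit_lipschitz" "(\<integral>t. \<bar>\<phi> t - indicator B t\<bar> \<partial>M) < \<epsilon>"
    by (rule lipschitz_approximableE)
  have "(\<lambda>t. 1 - \<phi> t) \<in> unit_lipschitz"
    using \<phi>(1) by (simp add: unit_lipschitz_def lipschitz_on_def dist_real_def abs_minus_commute)
  moreover have "\<bar>(1 - \<phi> t) - indicator (- B) t\<bar> = \<bar>\<phi> t - indicator B t\<bar>" for t
    by (auto simp: indicator_def)
  ultimately show "\<exists>\<phi>\<in>unit_lipschitz. (\<integral>t. \<bar>\<phi> t - indicator (- B) t\<bar> \<partial>M) < \<epsilon>"
    using \<phi>(2) by (intro bexI[of _ "\<lambda>t. 1 - \<phi> t"]) simp_all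
qed

lemma lipschitz_approximable_Un:
  assumes M: "finite_measure M" "sets M = sets borel"
    and AB: "A \<in> sets borel" "B \<in> sets borel" "A \<inter> B = {}"
    and A: "lipschitz_approximable M A" and B: "lipschitz_approximable M B"
  shows "lipschitz_approximable M (A \<union> B)"
  unfolding lipschitz_approximable_def
proof (intro allI impI)
  fix \<epsilon> :: real assume "0 < \<epsilon>"
  then have "0 < \<epsilon> / 2" by simp
  obtain \<phi> where \<phi>: "\<phi> \<in> unit_lipschitz" "(\<integral>t. \<bar>\<phi> t - indicator A t\<bar> \<partial>M) < \<epsilon> / 2"
    using A \<open>0 < \<epsilon> / 2\<close> by (rule lipschitz_approximableE)
  obtain \<psi> where \<psi>: "\<psi> \<in> unit_lipschitz" "(\<integral>t. \<bar>\<psi> t - indicator B t\<bar> \<partial>M) < \<epsilon> / 2"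
    using B \<open>0 < \<epsilon> / 2\<close> by (rule lipschitz_approximableE)
  note range = unit_lipschitz_range[OF \<phi>(1)] unit_lipschitz_range[OF \<psi>(1)]
  define w where "w t = min 1 (\<phi> t + \<psi> t)" for t
  obtain K L where "K-lipschitz_on UNIV \<phi>" "L-lipschitz_on UNIV \<psi>"
    using \<phi>(1) \<psi>(1) by (auto simp: unit_lipschitz_def)
  then have "(K + L)-lipschitz_on UNIV w"
    unfolding w_def by (intro lipschitz_max_min(2) lipschitz_on_add)
  then have w: "w \<in> unit_lipschitz"
    using range by (auto simp: unit_lipschitz_def w_def)
  have le: "\<bar>w t - indicator (A \<union> B) t\<bar> \<le> \<bar>\<phi> t - indicator A t\<bar> + \<bar>\<psi> t - indicator B t\<bar>" for t
    using range[of t] AB(3) by (cases "t \<in> A"; cases "t \<in> B") (auto simp: w_def indicator_def)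
  note int = integrable_unit_lipschitz[OF M]
  have "(\<integral>t. \<bar>w t - indicator (A \<union> B) t\<bar> \<partial>M)
      \<le> (\<integral>t. \<bar>\<phi> t - indicator A t\<bar> + \<bar>\<psi> t - indicator B t\<bar> \<partial>M)"
    using AB le \<phi>(1) \<psi>(1) w
    by (intro integral_mono int Bochner_Integration.integrable_add) auto
  also have "\<dots> = (\<integral>t. \<bar>\<phi> t - indicator A t\<bar> \<partial>M) + (\<integral>t. \<bar>\<psi> t - indicator B t\<bar> \<partial>M)"
    using AB \<phi>(1) \<psi>(1) by (intro Bochner_Integration.integral_add int) auto
  also have "\<dots> < \<epsilon>" using \<phi>(2) \<psi>(2) by simp
  finally show "\<exists>\<phi>\<in>unit_lipschitz. (\<integral>t. \<bar>\<phi> t - indicator (A \<union> B) t\<bar> \<partial>M) < \<epsilon>"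
    using w by blast
qed

lemma lipschitz_approximable_UN:
  fixes A :: "nat \<Rightarrow> 't::metric_space set"
  assumes M: "finite_measure M" "sets M = sets borel"
    and A: "range A \<subseteq> sets borel" "disjoint_family A" "\<And>i. lipschitz_approximable M (A i)"
  shows "lipschitz_approximable M (\<Union>i. A i)"
  unfolding lipschitz_approximable_def
proof (intro allI impI)
  interpret finite_measure M by fact
  fix \<epsilon> :: real assume "0 < \<epsilon>"
  let ?U = "\<lambda>n. \<Union>i<n. A i" and ?B = "\<Union>i. A i"
  have Ub: "?U n \<in> sets borel" for n using A(1) by auto
  have Bb: "?B \<in> sets borel" using A(1) by auto
  have "lipschitz_approximable M (?U n)" for n
  proof (induction n)
    case 0
    show ?case using lipschitz_approximable_closed[OF M, of "{}"] by simp
  next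
    case (Suc n)
    have "?U n \<inter> A n = {}"
    proof -
      have "A i \<inter> A n = {}" if "i < n" for i
        using A(2) that unfolding disjoint_family_on_def by (metis UNIV_I less_irrefl)
      then show ?thesis by auto
    qed
    then have "lipschitz_approximable M (?U n \<union> A n)"
      using Ub A(1,3) Suc by (intro lipschitz_approximable_Un[OF M]) auto
    then show ?case by (simp add: lessThan_Suc Un_commute)
  qed
  note approx = this
  have "(\<lambda>n. measure M (?B - ?U n)) \<longlonglongrightarrow> measure M (\<Inter>n. ?B - ?U n)"
  proof (rule finite_Lim_measure_decseq)
    show "range (\<lambda>n. ?B - ?U n) \<subseteq> sets M" using Ub Bb M(2) by auto
    show "decseq (\<lambda>n. ?B - ?U n)" by (auto simp: decseq_def)
  qed
  moreover have "(\<Inter>n. ?B - ?U n) = {}" by (auto intro: lessI)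
  ultimately have "(\<lambda>n. measure M (?B - ?U n)) \<longlonglongrightarrow> 0"
    by (simp only: measure_empty)
  then have "\<forall>\<^sub>F n in sequentially. measure M (?B - ?U n) < \<epsilon> / 2"
    using \<open>0 < \<epsilon>\<close> by (intro order_tendstoD(2)) auto
  then obtain n where n: "measure M (?B - ?U n) < \<epsilon> / 2"
    by (auto simp: eventually_sequentially)
  obtain \<phi> where \<phi>: "\<phi> \<in> unit_lipschitz" "(\<integral>t. \<bar>\<phi> t - indicator (?U n) t\<bar> \<partial>M) < \<epsilon> / 2"
    using approx[of n] half_gt_zero[OF \<open>0 < \<epsilon>\<close>] by (rule lipschitz_approximableE)
  have le: "\<bar>\<phi> t - indicator ?B t\<bar> \<le> \<bar>\<phi> t - indicator (?U n) t\<bar> + indicator (?B - ?U n) t" for t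
    using unit_lipschitz_range[OF \<phi>(1), of t] by (auto simp: indicator_def)
  note int = integrable_unit_lipschitz[OF M]
  have ind: "integrable M (indicat_real (?B - ?U n))"
    using Ub Bb M(2) by (simp add: emeasure_eq_measure)
  have "(\<integral>t. \<bar>\<phi> t - indicator ?B t\<bar> \<partial>M)
      \<le> (\<integral>t. \<bar>\<phi> t - indicator (?U n) t\<bar> + indicator (?B - ?U n) t \<partial>M)"
    using le \<phi>(1) Ub Bb ind by (intro integral_mono int Bochner_Integration.integrable_add) auto
  also have "\<dots> = (\<integral>t. \<bar>\<phi> t - indicator (?U n) t\<bar> \<partial>M) + (\<integral>t. indicator (?B - ?U n) t \<partial>M)"
    using \<phi>(1) Ub ind by (intro Bochner_Integration.integral_add int) auto
  also have "(\<integral>t. indicator (?B - ?U n) t \<partial>M) = measure M (?B - ?U n)"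
    using sets_eq_imp_space_eq[OF M(2)] by simp
  also have "(\<integral>t. \<bar>\<phi> t - indicator (?U n) t\<bar> \<partial>M) + measure M (?B - ?U n) < \<epsilon>"
    using \<phi>(2) n by simp
  finally show "\<exists>\<phi>\<in>unit_lipschitz. (\<integral>t. \<bar>\<phi> t - indicator ?B t\<bar> \<partial>M) < \<epsilon>"
    using \<phi>(1) by blast
qed

text \<open>
  The approximable sets form a Dynkin system that contains the closed sets, which generate the
  Borel sets and are stable under intersection.
\<close>

lemma lipschitz_approximable_borel:
  fixes M :: "'t::metric_space measure"
  assumes M: "finite_measure M" "sets M = sets borel" and B: "B \<in> sets borel"
  shows "lipschitz_approximable M B"
proof -
  have eq: "sigma_sets UNIV (Collect closed) = sets (borel :: 't measure)"
    unfolding borel_eq_closed by simp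
  have "Int_stable (Collect closed :: 't set set)" by (auto simp: Int_stable_def)
  moreover have "Collect closed \<subseteq> Pow (UNIV :: 't set)" by simp
  moreover have "B \<in> sigma_sets UNIV (Collect closed)" using B by (simp add: eq)
  ultimately show ?thesis
  proof (induction rule: sigma_sets_induct_disjoint)
    case (basic A)
    then show ?case by (intro lipschitz_approximable_closed[OF M]) simp
  next
    case empty
    show ?case by (intro lipschitz_approximable_closed[OF M]) simp
  next
    case (compl A)
    then show ?case by (simp add: lipschitz_approximable_Compl flip: Compl_eq_Diff_UNIV)
  next
    case (union A)
    then show ?case by (intro lipschitz_approximable_UN[OF M]) (auto simp: eq)
  qed
qed

lemma simple_vint_step:
  fixes \<mu> :: "('t::topological_space, 'k::real_or_complex ^ 'n::finite) cabv"
  assumes P: "finite P" "P \<subseteq> sets borel"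
  shows "simple_function borel (\<lambda>t. \<Sum>A\<in>P. indicator A t *\<^sub>R x A)"
    and "simple_vint (\<lambda>t. \<Sum>A\<in>P. indicator A t *\<^sub>R x A) \<mu> = (\<Sum>A\<in>P. scalar_prod (x A) (cabv_on \<mu> A))"
proof -
  obtain N where N: "represents N \<mu>" using ex_represents by blast
  show simple: "simple_function borel (\<lambda>t. \<Sum>A\<in>P. indicator A t *\<^sub>R x A)"
  proof (rule simple_function_sum)
    fix A assume "A \<in> P"
    then have "simple_function borel (indicat_real A)"
      using P(2) by (intro simple_function_indicator) auto
    then show "simple_function borel (\<lambda>t. indicat_real A t *\<^sub>R x A)"
      by (rule simple_function_compose1)
  qed
  have "(\<integral>t. scalar_prod (\<Sum>A\<in>P. indicator A t *\<^sub>R x A) e \<partial>N e)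
      = (\<Sum>A\<in>P. measure (N e) A *\<^sub>R scalar_prod (x A) e)" if "e \<in> signed_Basis" for e
  proof -
    have Ne: "finite_measure (N e)" "sets (N e) = sets borel"
      using N that by (auto simp: represents_def)
    interpret finite_measure "N e" by fact
    have ind: "integrable (N e) (indicat_real A)" if "A \<in> P" for A
      using that P Ne by (auto simp: emeasure_eq_measure)
    have "(\<integral>t. scalar_prod (\<Sum>A\<in>P. indicator A t *\<^sub>R x A) e \<partial>N e)
        = (\<integral>t. (\<Sum>A\<in>P. indicator A t *\<^sub>R scalar_prod (x A) e) \<partial>N e)"
      by (simp add: scalar_prod.sum_left scalar_prod.scaleR_left)
    also have "\<dots> = (\<Sum>A\<in>P. \<integral>t. indicator A t *\<^sub>R scalar_prod (x A) e \<partial>N e)"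
      using ind by (intro Bochner_Integration.integral_sum integrable_scaleR_left)
    also have "\<dots> = (\<Sum>A\<in>P. measure (N e) A *\<^sub>R scalar_prod (x A) e)"
      using ind sets_eq_imp_space_eq[OF Ne(2)] by (intro sum.cong refl) simp
    finally show ?thesis .
  qed
  then have "simple_vint (\<lambda>t. \<Sum>A\<in>P. indicator A t *\<^sub>R x A) \<mu>
      = (\<Sum>e\<in>signed_Basis. \<Sum>A\<in>P. measure (N e) A *\<^sub>R scalar_prod (x A) e)"
    by (simp add: simple_vint_represents[OF N simple])
  also have "\<dots> = (\<Sum>A\<in>P. \<Sum>e\<in>signed_Basis. measure (N e) A *\<^sub>R scalar_prod (x A) e)"
    by (rule sum.swap)
  also have "\<dots> = (\<Sum>A\<in>P. scalar_prod (x A) (cabv_on \<mu> A))"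
  proof (intro sum.cong refl)
    fix A assume "A \<in> P"
    then have "cabv_on \<mu> A = (\<Sum>e\<in>signed_Basis. measure (N e) A *\<^sub>R e)"
      using P N by (auto simp: represents_def)
    then show "(\<Sum>e\<in>signed_Basis. measure (N e) A *\<^sub>R scalar_prod (x A) e)
        = scalar_prod (x A) (cabv_on \<mu> A)"
      by (simp add: scalar_prod.sum_right scalar_prod.scaleR_right)
  qed
  finally show "simple_vint (\<lambda>t. \<Sum>A\<in>P. indicator A t *\<^sub>R x A) \<mu>
    = (\<Sum>A\<in>P. scalar_prod (x A) (cabv_on \<mu> A))" .
qed

context compact_metric
begin

text \<open>
  Choose a partition \<open>P\<close> that nearly attains \<open>\<parallel>\<mu>\<parallel>\<close>.  The step function \<open>s\<close> with value
  \<open>\<mu>(A) / \<parallel>\<mu>(A)\<parallel>\<close> on \<open>A\<close> has integral \<open>\<Sum>\<^sub>A \<parallel>\<mu>(A)\<parallel>\<close>.  Replacing indicators by Lipschitz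
  functions that are close in \<open>L\<^sup>1(|\<mu>|)\<close> changes the integral by little; the bound by 1 is
  restored by projecting onto the unit ball, which is 1-Lipschitz and does not move \<open>s\<close>.
\<close>

lemma ex_lipschitz_vint_gt:
  fixes \<mu> :: "('t, 'k::real_or_complex ^ 'n::finite) cabv"
  assumes c: "c < norm \<mu>"
  obtains f L where "L-lipschitz_on UNIV f" "\<And>t. norm (f t) \<le> 1" "c < norm (vint f \<mu>)"
proof -
  let ?V = "variation_measure \<mu>"
  note V = finite_variation_measure[of \<mu>] sets_variation_measure[of \<mu>]
  interpret V: finite_measure ?V by (rule V)
  have "c < Sup (var_sums (cabv_on \<mu>))" using c by (simp add: norm_cabv.rep_eq)
  then obtain z where "z \<in> var_sums (cabv_on \<mu>)" "c < z"
    using var_sums_nonempty by (rule less_cSupE)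
  then obtain P where "P \<in> borel_partitions" and gt: "c < (\<Sum>A\<in>P. norm (cabv_on \<mu> A))"
    by (auto simp: var_sums_def)
  then have P: "finite P" "P \<subseteq> sets borel" "partition_on UNIV P"
    by (auto simp: borel_partitions_def)
  define S where "S = (\<Sum>A\<in>P. norm (cabv_on \<mu> A))"
  define x where "x A = cabv_on \<mu> A /\<^sub>R norm (cabv_on \<mu> A)" for A
  have x: "norm (x A) \<le> 1" for A by (cases "cabv_on \<mu> A = 0") (simp_all add: x_def)
  have prod: "scalar_prod (x A) (cabv_on \<mu> A) = of_real (norm (cabv_on \<mu> A))" for A
    unfolding x_def scalar_prod.scaleR_left scalar_prod_self
    by (cases "cabv_on \<mu> A = 0")
       (simp_all add: power2_eq_square scaleR_conv_of_real flip: of_real_inverse of_real_mult)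
  define s where "s t = (\<Sum>A\<in>P. indicator A t *\<^sub>R x A)" for t
  have s: "simple_function borel s" and vs: "simple_vint s \<mu> = of_real S"
    unfolding s_def[abs_def] by (simp_all add: simple_vint_step[OF P(1,2)] prod S_def)
  have s1: "norm (s t) \<le> 1" for t
  proof -
    obtain A where A: "A \<in> P" "t \<in> A"
      using P(3) unfolding partition_on_def by (metis UNIV_I UnionE)
    have "t \<notin> B" if "B \<in> P" "B \<noteq> A" for B
      using P(3) that A by (auto simp: partition_on_def dest: disjointD)
    then have "s t = x A"
      unfolding s_def using A P(1) by (subst sum.remove[of P A]) (auto intro!: sum.neutral)
    then show ?thesis using x by simp
  qed
  define \<delta> where "\<delta> = (S - c) / (real (card P) + 1)"
  have \<delta>: "0 < \<delta>" "real (card P) * \<delta> < S - c"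
  proof -
    have "0 < S - c" using gt by (simp add: S_def)
    then show "0 < \<delta>" "real (card P) * \<delta> < S - c" by (simp_all add: \<delta>_def field_simps)
  qed
  have "\<exists>\<phi>\<in>unit_lipschitz. (\<integral>t. \<bar>\<phi> t - indicator A t\<bar> \<partial>?V) < \<delta>" if "A \<in> P" for A
    using lipschitz_approximable_borel[OF V, of A] that P(2) \<delta>(1)
    unfolding lipschitz_approximable_def by blast
  then obtain \<phi> where \<phi>: "\<And>A. A \<in> P \<Longrightarrow> \<phi> A \<in> unit_lipschitz"
      "\<And>A. A \<in> P \<Longrightarrow> (\<integral>t. \<bar>\<phi> A t - indicator A t\<bar> \<partial>?V) < \<delta>"
    by metis
  define u where "u t = (\<Sum>A\<in>P. \<phi> A t *\<^sub>R x A)" for t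
  have "\<exists>L. L-lipschitz_on UNIV u"
    unfolding u_def
  proof (rule lipschitz_sum[OF P(1)])
    show "\<exists>L. L-lipschitz_on UNIV (\<lambda>t. \<phi> A t *\<^sub>R x A)" if "A \<in> P" for A
      using \<phi>(1)[OF that] lipschitz_scaleR[OF _ x] unfolding unit_lipschitz_def by blast
  qed
  then obtain L where L: "L-lipschitz_on UNIV u" ..
  \<comment> \<open>The function \<open>u\<close> may exceed the bound 1; the projection onto the unit ball removes the excess.\<close>
  let ?B = "cball (0 :: 'k ^ 'n) 1"
  define f where "f t = closest_point ?B (u t)" for t
  have retract: "dist (closest_point ?B y) (closest_point ?B z) \<le> dist y z" for y z
    by (rule closest_point_lipschitz) auto
  have f_lip: "L-lipschitz_on UNIV f"
  proof (rule lipschitz_onI)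
    show "dist (f t) (f t') \<le> L * dist t t'" for t t'
      unfolding f_def using order_trans[OF retract lipschitz_onD[OF L]] by simp
  qed (rule lipschitz_on_nonneg[OF L])
  have f1: "norm (f t) \<le> 1" for t
    using closest_point_in_set[of ?B "u t"] by (simp add: f_def)
  have diff: "norm (f t - s t) \<le> (\<Sum>A\<in>P. \<bar>\<phi> A t - indicator A t\<bar>)" for t
  proof -
    have "s t = closest_point ?B (s t)" using s1[of t] by (intro closest_point_self[symmetric]) simp
    then have "norm (f t - s t) \<le> norm (u t - s t)"
      using retract[of "u t" "s t"] by (simp add: f_def dist_norm)
    also have "\<dots> = norm (\<Sum>A\<in>P. (\<phi> A t - indicator A t) *\<^sub>R x A)"
      by (simp add: u_def s_def scaleR_diff_left sum_subtractf)
    also have "\<dots> \<le> (\<Sum>A\<in>P. \<bar>\<phi> A t - indicator A t\<bar>)"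
      using x by (intro sum_norm_le) (simp add: mult_left_le)
    finally show ?thesis .
  qed
  have int: "integrable ?V (\<lambda>t. \<bar>\<phi> A t - indicator A t\<bar>)" if "A \<in> P" for A
    using \<phi>(1)[OF that] P(2) that by (blast intro: integrable_unit_lipschitz[OF V])
  have fc: "continuous_on UNIV f" using f_lip by (rule lipschitz_imp_continuous)
  have fsm: "(\<lambda>t. norm (f t - s t)) \<in> borel_measurable ?V"
    using borel_measurable_continuous_onI[OF fc] borel_measurable_simple_function[OF s] by simp
  have "norm (vint f \<mu> - of_real S) \<le> (\<integral>t. norm (f t - s t) \<partial>?V)"
    using norm_vint_diff_simple_le[OF fc s, of \<mu>] by (simp add: vs)
  also have "\<dots> \<le> (\<integral>t. (\<Sum>A\<in>P. \<bar>\<phi> A t - indicator A t\<bar>) \<partial>?V)"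
  proof (rule integral_mono')
    show "integrable ?V (\<lambda>t. \<Sum>A\<in>P. \<bar>\<phi> A t - indicator A t\<bar>)"
      using int by (intro Bochner_Integration.integrable_sum)
  qed (use diff in auto)
  also have "\<dots> = (\<Sum>A\<in>P. \<integral>t. \<bar>\<phi> A t - indicator A t\<bar> \<partial>?V)"
    using int by (intro Bochner_Integration.integral_sum)
  also have "\<dots> \<le> (\<Sum>A\<in>P. \<delta>)" using \<phi>(2) by (intro sum_mono less_imp_le)
  also have "\<dots> < S - c" using \<delta>(2) by simp
  finally have "norm (vint f \<mu> - of_real S) < S - c" .
  moreover have "S \<le> norm (vint f \<mu>) + norm (vint f \<mu> - of_real S)"
  proof -
    have "0 \<le> S" by (simp add: S_def sum_nonneg)
    then show ?thesis
      using norm_triangle_ineq4[of "vint f \<mu>" "vint f \<mu> - of_real S"] by simp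
  qed
  ultimately have "c < norm (vint f \<mu>)" by simp
  then show thesis using that[OF f_lip f1] by blast
qed

end

section \<open>Positive functionals on continuous functions\<close>

context compact_metric
begin

lemma dini_zero:
  fixes h :: "nat \<Rightarrow> 't \<Rightarrow> real"
  assumes cont: "\<And>n. continuous_on UNIV (h n)"
    and dec: "\<And>n t. h (Suc n) t \<le> h n t"
    and lim: "\<And>t. (\<lambda>n. h n t) \<longlonglongrightarrow> 0" and "0 < \<epsilon>"
  shows "\<exists>n. \<forall>t. h n t < \<epsilon>"
proof -
  have mono: "h m t \<le> h n t" if "n \<le> m" for n m t
    using that dec by (rule lift_Suc_antimono_le[of "\<lambda>n. h n t", rotated])
  have "open {t. h n t < \<epsilon>}" for n
    by (intro open_Collect_less cont continuous_on_const)
  moreover have "UNIV \<subseteq> (\<Union>n. {t. h n t < \<epsilon>})"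
  proof
    fix t :: 't
    have "\<forall>\<^sub>F n in sequentially. h n t < \<epsilon>" using lim \<open>0 < \<epsilon>\<close> by (rule order_tendstoD(2))
    then show "t \<in> (\<Union>n. {t. h n t < \<epsilon>})" by (auto simp: eventually_sequentially)
  qed
  ultimately obtain K where K: "finite K" "UNIV \<subseteq> (\<Union>n\<in>K. {t. h n t < \<epsilon>})"
    by (rule compactE_image[OF compact_UNIV]) auto
  have "h (Max K) t < \<epsilon>" for t
  proof -
    obtain n where "n \<in> K" "h n t < \<epsilon>" using K(2) by auto
    then show ?thesis using mono[of n "Max K" t] K(1) by simp
  qed
  then show ?thesis by blast
qed

end

lemma sum_clamp: "0 \<le> x \<Longrightarrow> (\<Sum>i<m. min 1 (max 0 (x - real i))) = min (real m) x"
  by (induction m) (auto simp: min_def max_def)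

lemma le_sum_of_bool_less:
  assumes "0 \<le> x" "x \<le> real n"
  shows "x \<le> (\<Sum>j<n. of_bool (real j < x))"
proof -
  have "{..<n} \<inter> {j. real j < x} = {..<nat \<lceil>x\<rceil>}"
    using assms by (auto simp: less_ceiling_iff) linarith+
  then have "(\<Sum>j<n. of_bool (real j < x)) = real (nat \<lceil>x\<rceil>)"
    by (simp add: sum_of_bool_eq)
  also have "x \<le> real (nat \<lceil>x\<rceil>)" by (rule real_nat_ceiling_ge)
  finally show ?thesis .
qed

text \<open>
  The part of \<open>T \<times> \<real>\<close> between the graphs of \<open>f\<close> and \<open>g\<close>.  For a positive functional \<open>\<Lambda>\<close>
  the value \<open>\<Lambda> (g - f)\<close> is the volume that this region will receive.  Regions are a semiring of
  sets with values prescribed by \<open>\<Lambda>\<close>, which gives no immediate value to subsets of \<open>T\<close>.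
\<close>

definition region :: "('t \<Rightarrow> real) \<Rightarrow> ('t \<Rightarrow> real) \<Rightarrow> ('t \<times> real) set" where
  "region f g = {(t, y). f t \<le> y \<and> y < g t}"

definition cont_le :: "('t::topological_space \<Rightarrow> real) \<Rightarrow> ('t \<Rightarrow> real) \<Rightarrow> bool" where
  "cont_le f g \<longleftrightarrow> continuous_on UNIV f \<and> continuous_on UNIV g \<and> (\<forall>t. f t \<le> g t)"

text \<open>
  Over each point of \<open>T\<close> this is the statement for half-open intervals.  The upper bounds are
  cut off from below by the lower bounds, so that an empty interval is represented with equal
  bounds.
\<close>

lemma semiring_of_regions:
  "semiring_of_sets UNIV {region f g | f g. cont_le (f :: 't::topological_space \<Rightarrow> real) g}"
proof (unfold_locales)
  let ?M = "{region f g | f g. cont_le (f :: 't \<Rightarrow> real) g}"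
  show "?M \<subseteq> Pow UNIV" by simp
  have "region (\<lambda>_. 0) (\<lambda>_. 0) = ({} :: ('t \<times> real) set)" by (auto simp: region_def)
  moreover have "cont_le (\<lambda>_::'t. 0) (\<lambda>_. 0)" by (simp add: cont_le_def)
  ultimately show "{} \<in> ?M" by (metis (mono_tags, lifting) mem_Collect_eq)
  fix a b assume "a \<in> ?M" "b \<in> ?M"
  then obtain f g f' g' where a: "a = region f g" "cont_le f g" and b: "b = region f' g'" "cont_le f' g'"
    by blast
  let ?l = "\<lambda>t. max (f t) (f' t)"
  let ?u = "\<lambda>t. max (?l t) (min (g t) (g' t))"
  have "a \<inter> b = region ?l ?u" by (auto simp: a b region_def less_max_iff_disj)
  moreover have "cont_le ?l ?u"
    using a b by (auto simp: cont_le_def intro!: continuous_intros)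
  ultimately show "a \<inter> b \<in> ?M" by blast
  let ?c = "region f (\<lambda>t. max (f t) (min (g t) (f' t)))"
  let ?d = "region (\<lambda>t. max (f t) (g' t)) (\<lambda>t. max (max (f t) (g' t)) (g t))"
  have le: "f' t \<le> g' t" for t using b(2) by (simp add: cont_le_def)
  have "a - b = \<Union>{?c, ?d}"
    by (auto simp: a b region_def less_max_iff_disj not_le not_less)
  moreover have "?c \<inter> ?d = {}"
    using order_trans[OF le] by (auto simp: region_def less_max_iff_disj) (meson le less_le_trans not_less)+
  then have "disjoint {?c, ?d}" by (auto simp: disjoint_def)
  moreover have "{?c, ?d} \<subseteq> ?M"
  proof -
    have "cont_le f (\<lambda>t. max (f t) (min (g t) (f' t)))"
      "cont_le (\<lambda>t. max (f t) (g' t)) (\<lambda>t. max (max (f t) (g' t)) (g t))"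
      using a b by (auto simp: cont_le_def intro!: continuous_intros)
    then show ?thesis by blast
  qed
  ultimately show "\<exists>C\<subseteq>?M. finite C \<and> disjoint C \<and> a - b = \<Union>C"
    by (intro exI[of _ "{?c, ?d}"]) auto
qed

text \<open>
  The axioms constrain \<open>\<Lambda>\<close> on nonnegative functions only.  This admits functionals such as
  \<open>|\<Phi>|\<close>, which are given by a supremum over dominated functions and so make sense only there.
\<close>

locale positive_functional = compact_metric T for T :: "'t::metric_space itself" +
  fixes \<Lambda> :: "('t \<Rightarrow> real) \<Rightarrow> real"
  assumes nonneg: "continuous_on UNIV f \<Longrightarrow> (\<And>t. 0 \<le> f t) \<Longrightarrow> 0 \<le> \<Lambda> f"
    and add: "continuous_on UNIV f \<Longrightarrow> continuous_on UNIV g \<Longrightarrow> (\<And>t. 0 \<le> f t) \<Longrightarrow> (\<And>t. 0 \<le> g t)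
      \<Longrightarrow> \<Lambda> (\<lambda>t. f t + g t) = \<Lambda> f + \<Lambda> g"
    and scale: "continuous_on UNIV f \<Longrightarrow> (\<And>t. 0 \<le> f t) \<Longrightarrow> 0 \<le> c \<Longrightarrow> \<Lambda> (\<lambda>t. c * f t) = c * \<Lambda> f"
begin

lemma zero: "\<Lambda> (\<lambda>_. 0) = 0"
  using scale[of "\<lambda>_. 0" 0] by simp

lemma mono:
  assumes "continuous_on UNIV f" "continuous_on UNIV g" "\<And>t. 0 \<le> f t" "\<And>t. f t \<le> g t"
  shows "\<Lambda> f \<le> \<Lambda> g"
proof -
  have c: "continuous_on UNIV (\<lambda>t. g t - f t)" using assms by (intro continuous_intros)
  have "\<Lambda> g = \<Lambda> f + \<Lambda> (\<lambda>t. g t - f t)"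
    using add[OF assms(1) c] assms by simp
  then show ?thesis using nonneg[OF c] assms(4) by simp
qed

lemma sum:
  assumes "finite I" "\<And>i. i \<in> I \<Longrightarrow> continuous_on UNIV (f i)" "\<And>i t. i \<in> I \<Longrightarrow> 0 \<le> f i t"
  shows "\<Lambda> (\<lambda>t. \<Sum>i\<in>I. f i t) = (\<Sum>i\<in>I. \<Lambda> (f i))"
  using assms
proof (induction I rule: finite_induct)
  case (insert i I)
  have "\<Lambda> (\<lambda>t. f i t + (\<Sum>i\<in>I. f i t)) = \<Lambda> (f i) + \<Lambda> (\<lambda>t. \<Sum>i\<in>I. f i t)"
    using insert.prems by (intro add continuous_on_sum sum_nonneg) auto
  then show ?case using insert by simp
qed (simp add: zero)

text \<open>
  Countable additivity of \<open>\<Lambda> (k - j)\<close> on regions.  Pointwise it is countable additivity of the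
  length of intervals; by Dini's theorem the resulting series of continuous functions
  converges uniformly, and a positive functional respects uniform convergence.
\<close>

lemma region_sums:
  assumes A: "\<And>n. cont_le (A n) (B n)" and jk: "cont_le j k"
    and disj: "disjoint_family (\<lambda>n. region (A n) (B n))"
    and un: "(\<Union>n. region (A n) (B n)) = region j k"
  shows "(\<lambda>n. \<Lambda> (\<lambda>t. B n t - A n t)) sums \<Lambda> (\<lambda>t. k t - j t)"
proof -
  define u where "u n t = B n t - A n t" for n t
  have u: "continuous_on UNIV (u n)" "0 \<le> u n t" for n t
    using A by (auto simp: cont_le_def u_def[abs_def] intro!: continuous_intros)
  have w: "continuous_on UNIV (\<lambda>t. k t - j t)"
    using jk by (auto simp: cont_le_def intro!: continuous_intros)
  have sums: "(\<lambda>n. u n t) sums (k t - j t)" for t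
  proof -
    have "(\<Sum>n. emeasure lborel {A n t..<B n t}) = emeasure lborel (\<Union>n. {A n t..<B n t})"
    proof (rule suminf_emeasure)
      have "{A n t..<B n t} = Pair t -` region (A n) (B n)" for n by (auto simp: region_def)
      then show "disjoint_family (\<lambda>n. {A n t..<B n t})"
        using disj unfolding disjoint_family_on_def by (metis vimage_Int vimage_empty)
    qed auto
    also have "(\<Union>n. {A n t..<B n t}) = Pair t -` (\<Union>n. region (A n) (B n))"
      by (auto simp: region_def)
    also have "\<dots> = {j t..<k t}" unfolding un by (auto simp: region_def)
    finally have "(\<Sum>n. ennreal (u n t)) = ennreal (k t - j t)"
      using A jk by (simp add: u_def cont_le_def)
    moreover have "(\<lambda>n. ennreal (u n t)) sums (\<Sum>n. ennreal (u n t))"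
      by (rule summable_sums) auto
    ultimately show ?thesis using u jk by (simp add: cont_le_def)
  qed
  define h where "h n t = (k t - j t) - (\<Sum>i<n. u i t)" for n t
  have h: "continuous_on UNIV (h n)" "0 \<le> h n t" for n t
  proof -
    show "continuous_on UNIV (h n)"
      unfolding h_def by (intro continuous_intros w u)
    have "(\<Sum>i<n. u i t) \<le> (\<Sum>i. u i t)" using sums u by (intro sum_le_suminf) (auto simp: sums_iff)
    then show "0 \<le> h n t" using sums[of t] by (simp add: h_def sums_iff)
  qed
  have split: "\<Lambda> (\<lambda>t. k t - j t) = (\<Sum>i<n. \<Lambda> (u i)) + \<Lambda> (h n)" for n
  proof -
    have "\<Lambda> (\<lambda>t. (\<Sum>i<n. u i t) + h n t) = \<Lambda> (\<lambda>t. \<Sum>i<n. u i t) + \<Lambda> (h n)"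
      using u h by (intro add continuous_on_sum sum_nonneg) auto
    then show ?thesis using u by (simp add: sum h_def)
  qed
  have "(\<lambda>n. \<Lambda> (h n)) \<longlonglongrightarrow> 0"
  proof (rule LIMSEQ_I)
    fix \<epsilon> :: real assume "0 < \<epsilon>"
    define K where "K = \<Lambda> (\<lambda>_. 1)"
    have "0 \<le> K" unfolding K_def by (rule nonneg) auto
    define \<delta> where "\<delta> = \<epsilon> / (K + 1)"
    have "0 < \<delta>" "\<delta> * K < \<epsilon>" using \<open>0 \<le> K\<close> \<open>0 < \<epsilon>\<close> by (simp_all add: \<delta>_def field_simps)
    have dec: "h (Suc n) t \<le> h n t" for n t using u(2) by (simp add: h_def)
    have "(\<lambda>n. h n t) \<longlonglongrightarrow> (k t - j t) - (k t - j t)" for t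
      unfolding h_def using sums[of t] by (intro tendsto_diff tendsto_const) (simp add: sums_def)
    then obtain n where n: "\<And>t. h n t < \<delta>"
      using dini_zero[of h \<delta>] h(1) dec \<open>0 < \<delta>\<close> by auto
    have "norm (\<Lambda> (h m) - 0) < \<epsilon>" if "n \<le> m" for m
    proof -
      have hm: "h m t \<le> h n t" for t
        using that dec by (rule lift_Suc_antimono_le[of "\<lambda>n. h n t", rotated])
      have "h m t \<le> \<delta> * 1" for t using hm[of t] n[of t] by linarith
      then have "\<Lambda> (h m) \<le> \<Lambda> (\<lambda>_. \<delta> * 1)" using h by (intro mono) auto
      also have "\<dots> = \<delta> * K" unfolding K_def using \<open>0 < \<delta>\<close> by (intro scale) auto
      finally show ?thesis using \<open>\<delta> * K < \<epsilon>\<close> nonneg[OF h] by simp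
    qed
    then show "\<exists>n. \<forall>m\<ge>n. norm (\<Lambda> (h m) - 0) < \<epsilon>" by blast
  qed
  then have "(\<lambda>n. \<Lambda> (\<lambda>t. k t - j t) - \<Lambda> (h n)) \<longlonglongrightarrow> \<Lambda> (\<lambda>t. k t - j t) - 0"
    by (intro tendsto_intros)
  moreover have "\<Lambda> (\<lambda>t. k t - j t) - \<Lambda> (h n) = (\<Sum>i<n. \<Lambda> (u i))" for n
    using split[of n] by simp
  ultimately show ?thesis by (simp add: sums_def u_def[abs_def])
qed

definition region_measure :: "('t \<times> real) measure" where
  "region_measure = extend_measure UNIV {(f, g). cont_le f g} (\<lambda>(f, g). region f g)
     (\<lambda>(f, g). ennreal (\<Lambda> (\<lambda>t. g t - f t)))"

lemma emeasure_region:
  assumes "cont_le f g"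
  shows "emeasure region_measure (region f g) = ennreal (\<Lambda> (\<lambda>t. g t - f t))"
proof (rule extend_measure_caratheodory_pair[OF region_measure_def assms semiring_of_regions])
  have Z: "(\<lambda>t. g t - f t) = (\<lambda>_. 0)" if "cont_le f g" "region f g = {}" for f g :: "'t \<Rightarrow> real"
  proof
    fix t
    have "(t, f t) \<notin> region f g" using that by simp
    then have "\<not> f t < g t" by (simp add: region_def)
    moreover have "f t \<le> g t" using that by (simp add: cont_le_def)
    ultimately show "g t - f t = 0" by linarith
  qed
  show "ennreal (\<Lambda> (\<lambda>t. g t - f t)) = 0" if "cont_le f g" "region f g = {}" for f g
    using Z[OF that] zero by simp
  show "ennreal (\<Lambda> (\<lambda>t. g t - f t)) = ennreal (\<Lambda> (\<lambda>t. l t - k t))"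
    if fg: "cont_le f g" and kl: "cont_le k l" and eq: "region f g = region k l" for f g k l
  proof -
    have "g t - f t = l t - k t" for t
    proof -
      have "{f t..<g t} = Pair t -` region f g" "{k t..<l t} = Pair t -` region k l"
        by (auto simp: region_def)
      then have "{f t..<g t} = {k t..<l t}" using eq by simp
      moreover have "f t \<le> g t" "k t \<le> l t" using fg kl by (simp_all add: cont_le_def)
      ultimately show ?thesis by (auto simp: Ico_eq_Ico)
    qed
    then show ?thesis by presburger
  qed
  show "(\<Sum>n. ennreal (\<Lambda> (\<lambda>t. B n t - A n t))) = ennreal (\<Lambda> (\<lambda>t. k t - j t))"
    if "\<And>n. cont_le (A n) (B n)" "cont_le j k" "disjoint_family (\<lambda>n. region (A n) (B n))"
      "(\<Union>n. region (A n) (B n)) = region j k" for A B :: "nat \<Rightarrow> 't \<Rightarrow> real" and j k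
  proof (rule suminf_ennreal_eq[OF _ region_sums[OF that]])
    show "0 \<le> \<Lambda> (\<lambda>t. B n t - A n t)" for n
      using that(1)[of n] by (intro nonneg) (auto simp: cont_le_def intro!: continuous_intros)
  qed
qed simp

lemma sets_region: "cont_le f g \<Longrightarrow> region f g \<in> sets region_measure"
  unfolding region_measure_def by (subst sets_extend_measure) (auto intro!: sigma_sets.Basic)

lemma space_region_measure: "space region_measure = UNIV"
  unfolding region_measure_def by (subst space_extend_measure) auto

text \<open>
  The measure of a Borel set \<open>B\<close> will be the volume of the cylinder \<open>B \<times> {0..<1}\<close> in this strip.
\<close>

definition unit_strip :: "('t \<times> real) set" where
  "unit_strip = region (\<lambda>_. 0) (\<lambda>_. 1)"

lemma unit_strip_eq: "unit_strip = UNIV \<times> {0..<1}"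
  by (auto simp: unit_strip_def region_def)

lemma sets_unit_strip: "unit_strip \<in> sets region_measure"
  unfolding unit_strip_def by (rule sets_region) (simp add: cont_le_def)

text \<open>
  The cylinder over an open set is the union of the regions below the continuous functions
  \<open>min 1 (n dist(t, - U))\<close>, which increase to the indicator of \<open>U\<close>.  The whole
  space is treated apart because \<open>infdist\<close> from the empty set is 0 by convention.
\<close>

lemma sets_open_strip:
  assumes U: "open U"
  shows "U \<times> {0..<1} \<in> sets region_measure"
proof (cases "U = UNIV")
  case True
  then show ?thesis using sets_unit_strip by (simp add: unit_strip_eq)
next
  case False
  define u where "u n t = min 1 (real n * infdist t (- U))" for n :: nat and t
  have "cont_le (\<lambda>_. 0) (u n)" for n
    unfolding u_def cont_le_def by (auto intro!: continuous_intros simp: infdist_nonneg)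
  then have "(\<Union>n. region (\<lambda>_. 0) (u n)) \<in> sets region_measure"
    by (intro sets.countable_UN) (auto intro: sets_region)
  also have "(\<Union>n. region (\<lambda>_. 0) (u n)) = U \<times> {0..<1}"
  proof (intro equalityI subsetI)
    fix p assume "p \<in> (\<Union>n. region (\<lambda>_. 0) (u n))"
    then obtain n t y where p: "p = (t, y)" "0 \<le> y" "y < u n t" by (auto simp: region_def)
    have "t \<in> U"
    proof (rule ccontr)
      assume "t \<notin> U"
      then have "infdist t (- U) = 0" by simp
      then show False using p by (simp add: u_def)
    qed
    then show "p \<in> U \<times> {0..<1}" using p by (simp add: u_def)
  next
    fix p assume "p \<in> U \<times> {0..<1::real}"
    then obtain t y where p: "p = (t, y)" "t \<in> U" "0 \<le> y" "y < 1" by auto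
    have "0 < infdist t (- U)"
      using in_closed_iff_infdist_zero[of "- U" t] U False p(2) infdist_nonneg[of t "- U"] by force
    then obtain n :: nat where "1 < real n * infdist t (- U)" using reals_Archimedean3 by blast
    then have "p \<in> region (\<lambda>_. 0) (u n)" using p by (simp add: region_def u_def)
    then show "p \<in> (\<Union>n. region (\<lambda>_. 0) (u n))" by blast
  qed
  finally show ?thesis .
qed

definition riesz_measure :: "'t measure" where
  "riesz_measure = distr (restrict_space region_measure unit_strip) borel fst"

lemma sets_riesz_measure [simp, measurable_cong]: "sets riesz_measure = sets borel"
  and space_riesz_measure [simp]: "space riesz_measure = UNIV"
  by (simp_all add: riesz_measure_def)

lemma fst_measurable: "fst \<in> restrict_space region_measure unit_strip \<rightarrow>\<^sub>M borel"
proof (rule borel_measurableI)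
  fix U :: "'t set" assume "open U"
  have "fst -` U \<inter> space (restrict_space region_measure unit_strip) = U \<times> {0..<1}"
    by (auto simp: space_restrict_space space_region_measure unit_strip_eq)
  then show "fst -` U \<inter> space (restrict_space region_measure unit_strip)
      \<in> sets (restrict_space region_measure unit_strip)"
    using sets_open_strip[OF \<open>open U\<close>] sets_unit_strip
    by (auto simp: sets_restrict_space_iff space_region_measure unit_strip_eq)
qed

lemma emeasure_riesz_measure:
  assumes "B \<in> sets borel"
  shows "emeasure riesz_measure B = emeasure region_measure (B \<times> {0..<1})"
proof -
  have "fst -` B \<inter> space (restrict_space region_measure unit_strip) = B \<times> {0..<1}"
    by (auto simp: space_restrict_space space_region_measure unit_strip_eq)
  then show ?thesis
    unfolding riesz_measure_def using assms fst_measurable sets_unit_strip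
    by (simp add: emeasure_distr emeasure_restrict_space unit_strip_eq space_region_measure
        Sigma_mono)
qed

lemma emeasure_riesz_measure_UNIV: "emeasure riesz_measure UNIV = ennreal (\<Lambda> (\<lambda>_. 1))"
proof -
  have "emeasure riesz_measure UNIV = emeasure region_measure (region (\<lambda>_. 0) (\<lambda>_. 1))"
    by (simp add: emeasure_riesz_measure flip: unit_strip_eq unit_strip_def)
  then show ?thesis by (simp add: emeasure_region cont_le_def)
qed

lemma finite_riesz_measure: "finite_measure riesz_measure"
  by (rule finite_measureI) (simp add: emeasure_riesz_measure_UNIV)

lemma measure_riesz_measure_UNIV: "measure riesz_measure UNIV = \<Lambda> (\<lambda>_. 1)"
  using nonneg[of "\<lambda>_. 1"] by (simp add: measure_def emeasure_riesz_measure_UNIV)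

lemma measure_riesz_open_le:
  assumes U: "open U" and f: "continuous_on UNIV f" "\<And>t. 0 \<le> f t" "\<And>t. t \<in> U \<Longrightarrow> 1 \<le> f t"
  shows "measure riesz_measure U \<le> \<Lambda> f"
proof -
  interpret finite_measure riesz_measure by (rule finite_riesz_measure)
  have cf: "cont_le (\<lambda>_. 0) f" using f by (simp add: cont_le_def)
  have "emeasure riesz_measure U = emeasure region_measure (U \<times> {0..<1})"
    using U by (simp add: emeasure_riesz_measure)
  also have "\<dots> \<le> emeasure region_measure (region (\<lambda>_. 0) f)"
    using f(3) by (intro emeasure_mono sets_region cf) (fastforce simp: region_def)
  also have "\<dots> = ennreal (\<Lambda> f)" by (simp add: emeasure_region[OF cf])
  finally show ?thesis using nonneg[OF f(1,2)] by (simp add: emeasure_eq_measure)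
qed

text \<open>
  Cut \<open>f\<close> into \<open>n\<close> slices of height \<open>1 / n\<close>.  Up to the factor \<open>1 / n\<close>, the \<open>i\<close>-th slice
  dominates the indicator of the open set where the next slice begins, and this compares
  the sum of the measures of those sets with \<open>\<Lambda> f\<close>.  Only the lowest set is left over, and
  its contribution vanishes as \<open>n\<close> grows.
\<close>

lemma riesz_integral_le:
  assumes f: "continuous_on UNIV f" "\<And>t. 0 \<le> f t" "\<And>t. f t \<le> 1"
  shows "(\<integral>t. f t \<partial>riesz_measure) \<le> \<Lambda> f"
proof -
  interpret finite_measure riesz_measure by (rule finite_riesz_measure)
  let ?K = "measure riesz_measure UNIV"
  have bound: "(\<integral>t. f t \<partial>riesz_measure) \<le> ?K / real (Suc m) + \<Lambda> f" for m
  proof -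
    \<comment> \<open>On \<open>U (Suc i)\<close> the slice \<open>g i\<close> has already reached its full height 1.\<close>
    define U where "U j = {t. real j < real (Suc m) * f t}" for j
    define g where "g i t = min 1 (max 0 (real (Suc m) * f t - real i))" for i t
    have U: "open (U j)" for j
      unfolding U_def using f(1) by (intro open_Collect_less continuous_intros)
    have int: "integrable riesz_measure (indicat_real (U j))" for j
    proof -
      have "U j \<in> sets riesz_measure" using borel_open[OF U[of j]] by simp
      then show ?thesis by (simp add: emeasure_eq_measure)
    qed
    have g: "continuous_on UNIV (g i)" "0 \<le> g i t" for i t
      using f(1) by (auto simp: g_def[abs_def] intro!: continuous_intros)
    have "real (Suc m) * (\<integral>t. f t \<partial>riesz_measure) = (\<integral>t. real (Suc m) * f t \<partial>riesz_measure)"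
      by simp
    also have "\<dots> \<le> (\<integral>t. (\<Sum>j<Suc m. indicator (U j) t) \<partial>riesz_measure)"
    proof (rule integral_mono)
      show "integrable riesz_measure (\<lambda>t. real (Suc m) * f t)"
        using f(1) by (intro integrable_continuous finite_riesz_measure continuous_intros) auto
      show "integrable riesz_measure (\<lambda>t. \<Sum>j<Suc m. indicat_real (U j) t)"
        using int by (intro Bochner_Integration.integrable_sum)
      fix t
      have "real (Suc m) * f t \<le> real (Suc m)"
        using mult_left_mono[OF f(3)[of t], of "real (Suc m)"] by simp
      then have "real (Suc m) * f t \<le> (\<Sum>j<Suc m. of_bool (real j < real (Suc m) * f t))"
        using f(2) by (intro le_sum_of_bool_less) auto
      then show "real (Suc m) * f t \<le> (\<Sum>j<Suc m. indicator (U j) t)"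
        by (simp only: U_def indicator_def mem_Collect_eq)
    qed
    also have "\<dots> = (\<Sum>j<Suc m. \<integral>t. indicator (U j) t \<partial>riesz_measure)"
      using int by (intro Bochner_Integration.integral_sum)
    also have "\<dots> = (\<Sum>j<Suc m. measure riesz_measure (U j))" by simp
    also have "\<dots> = measure riesz_measure (U 0) + (\<Sum>i<m. measure riesz_measure (U (Suc i)))"
      by (rule sum.lessThan_Suc_shift)
    also have "\<dots> \<le> ?K + (\<Sum>i<m. \<Lambda> (g i))"
    proof (intro add_mono sum_mono)
      show "measure riesz_measure (U 0) \<le> ?K" by (rule finite_measure_mono) auto
      show "measure riesz_measure (U (Suc i)) \<le> \<Lambda> (g i)" for i
        by (intro measure_riesz_open_le U g) (auto simp: U_def g_def)
    qed
    also have "(\<Sum>i<m. \<Lambda> (g i)) \<le> (\<Sum>i<Suc m. \<Lambda> (g i))" using nonneg[OF g] by simp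
    also have "(\<Sum>i<Suc m. \<Lambda> (g i)) = \<Lambda> (\<lambda>t. \<Sum>i<Suc m. g i t)" using g by (intro sum[symmetric]) auto
    also have "(\<lambda>t. \<Sum>i<Suc m. g i t) = (\<lambda>t. real (Suc m) * f t)"
    proof
      fix t
      have "(\<Sum>i<Suc m. g i t) = min (real (Suc m)) (real (Suc m) * f t)"
        unfolding g_def using f(2)[of t] by (intro sum_clamp) simp
      also have "\<dots> = real (Suc m) * f t"
        using mult_left_mono[OF f(3)[of t], of "real (Suc m)"] by simp
      finally show "(\<Sum>i<Suc m. g i t) = real (Suc m) * f t" .
    qed
    also have "\<Lambda> (\<lambda>t. real (Suc m) * f t) = real (Suc m) * \<Lambda> f" using f by (intro scale) auto
    finally show ?thesis by (simp add: field_simps)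
  qed
  have "(\<lambda>m. ?K / real (Suc m) + \<Lambda> f) \<longlonglongrightarrow> 0 + \<Lambda> f"
    by (intro tendsto_intros LIMSEQ_Suc[OF lim_const_over_n])
  then show ?thesis using bound by (intro LIMSEQ_le_const[of _ "\<Lambda> f"]) auto
qed

text \<open>
  The inequality \<open>riesz_integral_le\<close>, applied to \<open>g\<close> and to \<open>1 - g\<close>, gives equality for \<open>g\<close> with
  values in \<open>[0, 1]\<close>, since both sides agree on the constant 1.  Scaling does the rest.
\<close>

theorem riesz_representation:
  assumes f: "continuous_on UNIV f" "\<And>t. 0 \<le> f t"
  shows "(\<integral>t. f t \<partial>riesz_measure) = \<Lambda> f"
proof -
  interpret finite_measure riesz_measure by (rule finite_riesz_measure)
  have unit: "(\<integral>t. g t \<partial>riesz_measure) = \<Lambda> g"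
    if g: "continuous_on UNIV g" "\<And>t. 0 \<le> g t" "\<And>t. g t \<le> 1" for g
  proof (rule antisym)
    show "(\<integral>t. g t \<partial>riesz_measure) \<le> \<Lambda> g" by (rule riesz_integral_le[OF g])
    have g': "continuous_on UNIV (\<lambda>t. 1 - g t)" using g(1) by (intro continuous_intros)
    have int: "integrable riesz_measure g"
      by (rule integrable_continuous[OF finite_riesz_measure _ g(1)]) simp
    have "\<Lambda> (\<lambda>_. 1) = \<Lambda> g + \<Lambda> (\<lambda>t. 1 - g t)"
      using add[OF g(1) g'] g(2,3) by simp
    moreover have "(\<integral>t. 1 - g t \<partial>riesz_measure) \<le> \<Lambda> (\<lambda>t. 1 - g t)"
      using g by (intro riesz_integral_le g') auto
    moreover have "(\<integral>t. 1 - g t \<partial>riesz_measure) = \<Lambda> (\<lambda>_. 1) - (\<integral>t. g t \<partial>riesz_measure)"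
      using int by (simp add: measure_riesz_measure_UNIV)
    ultimately show "\<Lambda> g \<le> (\<integral>t. g t \<partial>riesz_measure)" by simp
  qed
  obtain C where "0 \<le> C" and C: "\<And>t. norm (f t) \<le> C" using continuous_norm_bounded[OF f(1)] by blast
  define D where "D = C + 1"
  have D: "0 < D" "f t \<le> D" for t using \<open>0 \<le> C\<close> C[of t] by (auto simp: D_def)
  have cont: "continuous_on UNIV (\<lambda>t. f t / D)" using f(1) D by (intro continuous_intros) auto
  have "(\<integral>t. f t / D \<partial>riesz_measure) = \<Lambda> (\<lambda>t. f t / D)"
    using D f(2) by (intro unit cont) auto
  moreover have "\<Lambda> f = D * \<Lambda> (\<lambda>t. f t / D)"
    using scale[OF cont, of D] D f(2) by simp
  ultimately show ?thesis using D(1) by (simp add: field_simps)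
qed

end

section \<open>Completeness of the space of measures and the Markov operator\<close>

lemma norm_cabv_upper:
  "P \<in> borel_partitions \<Longrightarrow> (\<Sum>A\<in>P. norm (cabv_on \<mu> A)) \<le> norm \<mu>"
  unfolding norm_cabv.rep_eq using cabv_on[of \<mu>] by (intro var_sums_le) auto

lemma norm_cabv_leI:
  assumes "\<And>P. P \<in> borel_partitions \<Longrightarrow> (\<Sum>A\<in>P. norm (cabv_on \<mu> A)) \<le> C"
  shows "norm \<mu> \<le> C"
  unfolding norm_cabv.rep_eq
  using assms by (intro cSup_least var_sums_nonempty) (auto simp: var_sums_def)

lemma norm_cabv_apply_le: "norm (cabv_apply R \<mu>) \<le> norm R * norm \<mu>"
proof (rule norm_cabv_leI)
  fix P :: "'a set set" assume P: "P \<in> borel_partitions"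
  have "(\<Sum>A\<in>P. norm (cabv_on (cabv_apply R \<mu>) A)) \<le> (\<Sum>A\<in>P. norm R * norm (cabv_on \<mu> A))"
    by (intro sum_mono) (simp add: norm_blinfun)
  also have "\<dots> = norm R * (\<Sum>A\<in>P. norm (cabv_on \<mu> A))" by (simp add: sum_distrib_left)
  also have "\<dots> \<le> norm R * norm \<mu>" by (intro mult_left_mono norm_cabv_upper P) simp
  finally show "(\<Sum>A\<in>P. norm (cabv_on (cabv_apply R \<mu>) A)) \<le> norm R * norm \<mu>" .
qed

lemma norm_cabv_image_le:
  assumes h: "h \<in> borel \<rightarrow>\<^sub>M borel"
  shows "norm (cabv_image h \<mu>) \<le> norm \<mu>"
proof (rule norm_cabv_leI)
  fix P :: "'a set set" assume "P \<in> borel_partitions"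
  then have P: "finite P" "P \<subseteq> sets borel" "disjoint P"
    by (auto simp: borel_partitions_def partition_on_def)
  have "ennreal (\<Sum>A\<in>P. norm (cabv_on \<mu> (h -` A))) \<le> variation \<mu> UNIV"
  proof (rule sum_norm_le_variation[OF P(1)])
    show "h -` A \<in> sets borel" if "A \<in> P" for A
      using measurable_sets[OF h, of A] that P(2) by auto
    show "h -` A \<inter> h -` A' = {}" if "A \<in> P" "A' \<in> P" "A \<noteq> A'" for A A'
      using disjointD[OF P(3) that] by blast
  qed simp
  then have "(\<Sum>A\<in>P. norm (cabv_on \<mu> (h -` A))) \<le> norm \<mu>" by (simp add: variation_UNIV)
  also have "(\<Sum>A\<in>P. norm (cabv_on \<mu> (h -` A))) = (\<Sum>A\<in>P. norm (cabv_on (cabv_image h \<mu>) A))"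
    using P(2) by (intro sum.cong) (auto simp: cabv_on_image[OF h])
  finally show "(\<Sum>A\<in>P. norm (cabv_on (cabv_image h \<mu>) A)) \<le> norm \<mu>" .
qed

lemma bounded_linear_cabv_on: "bounded_linear (\<lambda>\<mu>. cabv_on \<mu> B)"
  by (rule bounded_linear_intro[of _ 1]) (simp_all add: norm_cabv_on_le)

lemma sum_cabv_on_lessThan:
  fixes A :: "nat \<Rightarrow> 't::topological_space set"
  assumes A: "range A \<subseteq> sets borel" "disjoint_family A"
  shows "(\<Sum>i<k. cabv_on \<mu> (A i)) = cabv_on \<mu> (\<Union>i<k. A i)"
proof -
  let ?A = "\<lambda>i. if i < k then A i else {}"
  have "(\<lambda>i. cabv_on \<mu> (?A i)) sums cabv_on \<mu> (\<Union>i. ?A i)"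
    using A by (intro sums_cabv_on) (auto simp: disjoint_family_on_def)
  moreover have "(\<lambda>i. cabv_on \<mu> (?A i)) sums (\<Sum>i<k. cabv_on \<mu> (?A i))"
    by (rule sums_finite) auto
  ultimately have "cabv_on \<mu> (\<Union>i. ?A i) = (\<Sum>i<k. cabv_on \<mu> (?A i))"
    by (rule sums_unique2)
  moreover have "(\<Union>i. ?A i) = (\<Union>i<k. A i)" by (auto split: if_splits)
  ultimately show ?thesis by simp
qed

text \<open>
  A Cauchy sequence converges setwise.  Its Cauchy estimates survive the limit uniformly over
  finite partitions and finite unions, and this uniformity gives countable additivity and
  bounded variation of the limit as well as convergence in norm.
\<close>

instance cabv :: (topological_space, banach) banach
proof
  fix X :: "nat \<Rightarrow> ('a, 'b) cabv" assume X: "Cauchy X"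
  define m where "m B = lim (\<lambda>n. cabv_on (X n) B)" for B
  have lim: "(\<lambda>n. cabv_on (X n) B) \<longlonglongrightarrow> m B" for B
    using bounded_linear.Cauchy[OF bounded_linear_cabv_on X, of B]
    unfolding m_def by (simp add: Cauchy_convergent_iff convergent_LIMSEQ_iff)
  have limit_le: "\<exists>N. \<forall>n\<ge>N. \<forall>q l. (\<forall>k. q k \<le> norm (X n - X k)) \<longrightarrow> q \<longlonglongrightarrow> l \<longrightarrow> l \<le> \<epsilon>"
    if "0 < \<epsilon>" for \<epsilon>
  proof -
    obtain N where N: "\<And>n k. n \<ge> N \<Longrightarrow> k \<ge> N \<Longrightarrow> norm (X n - X k) < \<epsilon>"
      using CauchyD[OF X \<open>0 < \<epsilon>\<close>] by blast
    have "l \<le> \<epsilon>" if "n \<ge> N" "\<forall>k. q k \<le> norm (X n - X k)" "q \<longlonglongrightarrow> l" for n q l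
    proof (rule LIMSEQ_le_const2[OF that(3)], intro exI[of _ N] allI impI)
      show "q k \<le> \<epsilon>" if "N \<le> k" for k
        using \<open>\<forall>k. q k \<le> norm (X n - X k)\<close> N[OF \<open>n \<ge> N\<close> that] by (meson less_imp_le order_trans)
    qed
    then show ?thesis by blast
  qed
  have close: "\<exists>N. \<forall>n\<ge>N. \<forall>P\<in>borel_partitions. (\<Sum>A\<in>P. norm (cabv_on (X n) A - m A)) \<le> \<epsilon>"
    if "0 < \<epsilon>" for \<epsilon>
  proof -
    have "(\<lambda>k. \<Sum>A\<in>P. norm (cabv_on (X n) A - cabv_on (X k) A))
        \<longlonglongrightarrow> (\<Sum>A\<in>P. norm (cabv_on (X n) A - m A))" for n P
      by (intro tendsto_intros lim)
    moreover have "(\<Sum>A\<in>P. norm (cabv_on (X n) A - cabv_on (X k) A)) \<le> norm (X n - X k)"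
      if "P \<in> borel_partitions" for n k P
      using norm_cabv_upper[OF that, of "X n - X k"] by simp
    ultimately show ?thesis using limit_le[OF that] by meson
  qed
  have close_sum: "\<exists>N. \<forall>n\<ge>N. \<forall>k. dist (\<Sum>i<k. cabv_on (X n) (A i)) (\<Sum>i<k. m (A i)) \<le> \<epsilon>"
    if A: "range A \<subseteq> sets borel" "disjoint_family A" and "0 < \<epsilon>" for A :: "nat \<Rightarrow> 'a set" and \<epsilon>
  proof -
    have "(\<lambda>j. dist (\<Sum>i<k. cabv_on (X n) (A i)) (\<Sum>i<k. cabv_on (X j) (A i)))
        \<longlonglongrightarrow> dist (\<Sum>i<k. cabv_on (X n) (A i)) (\<Sum>i<k. m (A i))" for n k
      by (intro tendsto_intros lim)
    moreover have "dist (\<Sum>i<k. cabv_on (X n) (A i)) (\<Sum>i<k. cabv_on (X j) (A i))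
        \<le> norm (X n - X j)" for n j k
      using norm_cabv_on_le[of "X n - X j" "\<Union>i<k. A i"]
      by (simp add: sum_cabv_on_lessThan[OF A] dist_norm)
    ultimately show ?thesis using limit_le[OF \<open>0 < \<epsilon>\<close>] by meson
  qed
  have "sigma_additive m"
    unfolding sigma_additive_def
  proof (intro allI impI)
    fix A :: "nat \<Rightarrow> 'a set" assume A: "range A \<subseteq> sets borel" "disjoint_family A"
    have "(\<lambda>k. \<Sum>i<k. m (A i)) \<longlonglongrightarrow> m (\<Union>i. A i)"
    proof (rule swap_uniform_limit'[where f = "\<lambda>n k. \<Sum>i<k. cabv_on (X n) (A i)"
          and g = "\<lambda>n. cabv_on (X n) (\<Union>i. A i)" and F = sequentially and S = UNIV])
      show "\<forall>\<^sub>F n in sequentially. (\<lambda>k. \<Sum>i<k. cabv_on (X n) (A i)) \<longlonglongrightarrow> cabv_on (X n) (\<Union>i. A i)"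
        by (intro always_eventually allI sums_cabv_on[OF A, unfolded sums_def])
      show "uniform_limit UNIV (\<lambda>n k. \<Sum>i<k. cabv_on (X n) (A i)) (\<lambda>k. \<Sum>i<k. m (A i)) sequentially"
      proof (rule uniform_limitI)
        fix \<epsilon> :: real assume "0 < \<epsilon>"
        then obtain N where N: "\<And>n k. n \<ge> N \<Longrightarrow>
            dist (\<Sum>i<k. cabv_on (X n) (A i)) (\<Sum>i<k. m (A i)) \<le> \<epsilon> / 2"
          using close_sum[OF A, of "\<epsilon> / 2"] by auto
        show "\<forall>\<^sub>F n in sequentially. \<forall>k\<in>UNIV.
            dist (\<Sum>i<k. cabv_on (X n) (A i)) (\<Sum>i<k. m (A i)) < \<epsilon>"
        proof (rule eventually_sequentiallyI[of N], intro ballI)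
          show "dist (\<Sum>i<k. cabv_on (X n) (A i)) (\<Sum>i<k. m (A i)) < \<epsilon>" if "N \<le> n" for n k
            using N[OF that, of k] \<open>0 < \<epsilon>\<close> by simp
        qed
      qed
    qed (auto intro: lim)
    then show "(\<lambda>i. m (A i)) sums m (\<Union>i. A i)" by (simp add: sums_def)
  qed
  moreover have "bdd_above (var_sums m)"
  proof -
    obtain N where N: "\<And>P. P \<in> borel_partitions \<Longrightarrow> (\<Sum>A\<in>P. norm (cabv_on (X N) A - m A)) \<le> 1"
      using close[of 1] by auto
    have "(\<Sum>A\<in>P. norm (m A)) \<le> norm (X N) + 1" if P: "P \<in> borel_partitions" for P
    proof -
      have "(\<Sum>A\<in>P. norm (m A)) \<le> (\<Sum>A\<in>P. norm (cabv_on (X N) A) + norm (cabv_on (X N) A - m A))"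
        by (intro sum_mono) (metis norm_minus_commute norm_triangle_sub)
      then show ?thesis
        using N[OF P] norm_cabv_upper[OF P, of "X N"] by (simp add: sum.distrib)
    qed
    then show ?thesis by (auto simp: bdd_above_def var_sums_def)
  qed
  moreover have "m B = 0" if "B \<notin> sets borel" for B
  proof -
    have "cabv_on (X n) B = 0" for n using cabv_on[of "X n"] that by simp
    then show ?thesis using lim[of B] by (simp add: LIMSEQ_const_iff)
  qed
  ultimately have m: "cabv_on (Abs_cabv m) = m" by (intro Abs_cabv_inverse) simp
  have "X \<longlonglongrightarrow> Abs_cabv m"
  proof (rule LIMSEQ_I)
    fix \<epsilon> :: real assume "0 < \<epsilon>"
    then obtain N where N: "\<And>n P. n \<ge> N \<Longrightarrow> P \<in> borel_partitions
        \<Longrightarrow> (\<Sum>A\<in>P. norm (cabv_on (X n) A - m A)) \<le> \<epsilon> / 2"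
      using close[of "\<epsilon> / 2"] by auto
    have "norm (X n - Abs_cabv m) < \<epsilon>" if "n \<ge> N" for n
    proof -
      have "norm (X n - Abs_cabv m) \<le> \<epsilon> / 2"
        using N[OF that] by (intro norm_cabv_leI) (simp add: m)
      then show ?thesis using \<open>0 < \<epsilon>\<close> by simp
    qed
    then show "\<exists>N. \<forall>n\<ge>N. norm (X n - Abs_cabv m) < \<epsilon>" by blast
  qed
  then show "convergent X" by (rule convergentI)
qed

lemma cabv_image_diff:
  assumes "h \<in> borel \<rightarrow>\<^sub>M borel"
  shows "cabv_image h (\<mu> - \<nu>) = cabv_image h \<mu> - cabv_image h \<nu>"
  by (rule cabv_eqI) (simp add: cabv_on_image[OF assms])

lemma cabv_apply_diff: "cabv_apply R (\<mu> - \<nu>) = cabv_apply R \<mu> - cabv_apply R \<nu>"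
  by (rule cabv_eqI) (simp add: blinfun.diff_right)

locale markov_system =
  fixes \<omega> :: "nat \<Rightarrow> 't::topological_space \<Rightarrow> 't" and R :: "nat \<Rightarrow> 'x::banach \<Rightarrow>\<^sub>L 'x"
  assumes measurable_\<omega>: "\<omega> i \<in> borel \<rightarrow>\<^sub>M borel"
    and summable_R: "summable (\<lambda>i. norm (R i))"
begin

abbreviation "branch i \<mu> \<equiv> cabv_apply (R i) (cabv_image (\<omega> i) \<mu>)"

lemma norm_branch_le: "norm (branch i \<mu>) \<le> norm (R i) * norm \<mu>"
  using norm_cabv_apply_le[of "R i" "cabv_image (\<omega> i) \<mu>"]
    mult_left_mono[OF norm_cabv_image_le[OF measurable_\<omega>, of i \<mu>], of "norm (R i)"]
  by simp

lemma summable_norm_branch: "summable (\<lambda>i. norm (branch i \<mu>))"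
  using summable_mult2[OF summable_R, of "norm \<mu>"]
  by (rule summable_comparison_test') (simp add: norm_branch_le)

text \<open>
  The space of measures is complete, so the absolutely convergent series that defines the
  operator converges in the variational norm.
\<close>

lemma branch_sums: "(\<lambda>i. branch i \<mu>) sums markov_op R \<omega> \<mu>"
  unfolding markov_op_def by (rule summable_sums) (rule summable_norm_cancel[OF summable_norm_branch])

lemma norm_markov_op_le: "norm (markov_op R \<omega> \<mu>) \<le> (\<Sum>i. norm (R i)) * norm \<mu>"
proof -
  have "norm (markov_op R \<omega> \<mu>) \<le> (\<Sum>i. norm (branch i \<mu>))"
    unfolding markov_op_def by (rule summable_norm[OF summable_norm_branch])
  also have "\<dots> \<le> (\<Sum>i. norm (R i) * norm \<mu>)"
    by (intro suminf_le norm_branch_le summable_norm_branch summable_mult2 summable_R)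
  also have "\<dots> = (\<Sum>i. norm (R i)) * norm \<mu>" by (rule suminf_mult2[OF summable_R, symmetric])
  finally show ?thesis .
qed

lemma markov_op_diff: "markov_op R \<omega> (\<mu> - \<nu>) = markov_op R \<omega> \<mu> - markov_op R \<omega> \<nu>"
proof -
  have "(\<lambda>i. branch i (\<mu> - \<nu>)) sums (markov_op R \<omega> \<mu> - markov_op R \<omega> \<nu>)"
    unfolding cabv_image_diff[OF measurable_\<omega>] cabv_apply_diff by (intro sums_diff branch_sums)
  then show ?thesis using branch_sums sums_unique2 by blast
qed

lemma markov_op_mass: "cabv_on (markov_op R \<omega> \<mu>) UNIV = (\<Sum>i. R i) (cabv_on \<mu> UNIV)"
proof -
  have "(\<lambda>i. cabv_on (branch i \<mu>) UNIV) sums cabv_on (markov_op R \<omega> \<mu>) UNIV"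
    by (rule bounded_linear.sums[OF bounded_linear_cabv_on branch_sums])
  moreover have "cabv_on (branch i \<mu>) UNIV = R i (cabv_on \<mu> UNIV)" for i
    by (simp add: cabv_on_image[OF measurable_\<omega>])
  moreover have "R sums (\<Sum>i. R i)" by (rule summable_sums[OF summable_norm_cancel[OF summable_R]])
  then have "(\<lambda>i. R i (cabv_on \<mu> UNIV)) sums (\<Sum>i. R i) (cabv_on \<mu> UNIV)"
    by (rule bounded_linear.sums[OF blinfun.bounded_linear_left])
  ultimately show ?thesis using sums_unique2 by (metis (no_types, lifting) sums_cong)
qed

end

section \<open>The Monge-Kantorovich metric and the weak* topology\<close>

context compact_metric
begin

lemma ex_dist_bound: "\<exists>D\<ge>0. \<forall>x y :: 't. dist x y \<le> D"
  using compact_imp_bounded[OF compact_UNIV] bounded_two_points[of "UNIV :: 't set"]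
  by (metis UNIV_I dual_order.trans linear)

text \<open>
  Subtracting the constant \<open>f t0\<close> does not change the integral against a measure of total mass
  0, and it makes \<open>f\<close> bounded by its Lipschitz constant times the diameter of \<open>T\<close>.  Hence the
  supremum that defines the Monge-Kantorovich norm is finite.
\<close>

lemma norm_vint_lipschitz_le:
  fixes f :: "'t \<Rightarrow> 'k::real_or_complex ^ 'n::finite"
  assumes f: "L-lipschitz_on UNIV f" and \<mu>: "cabv_on \<mu> UNIV = 0" and D: "\<And>x y :: 't. dist x y \<le> D"
  shows "norm (vint f \<mu>) \<le> (L * D) * norm \<mu>"
proof -
  have fc: "continuous_on UNIV f" by (rule lipschitz_imp_continuous[OF f])
  obtain t0 :: 't where True by simp
  have "vint (\<lambda>t. f t - f t0) \<mu> = vint f \<mu>"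
    using fc by (simp add: vint_diff vint_const \<mu> scalar_prod.zero_right)
  moreover have "norm (vint (\<lambda>t. f t - f t0) \<mu>) \<le> (L * D) * norm \<mu>"
  proof (rule norm_vint_le)
    show "norm (f t - f t0) \<le> L * D" for t
    proof -
      have "norm (f t - f t0) \<le> L * dist t t0"
        using lipschitz_onD[OF f, of t t0] by (simp add: dist_norm)
      also have "\<dots> \<le> L * D" using D lipschitz_on_nonneg[OF f] by (intro mult_left_mono)
      finally show ?thesis .
    qed
  qed (intro continuous_intros fc)
  ultimately show ?thesis by simp
qed

lemma lip_le_1_iff: "lip f \<le> 1 \<longleftrightarrow> 1-lipschitz_on UNIV f"
  using lip_le_iff[of 1 f] by simp

lemma mk_norm_leI:
  fixes \<mu> :: "('t, 'k::real_or_complex ^ 'n::finite) cabv"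
  assumes "0 \<le> C" "\<And>f. 1-lipschitz_on UNIV f \<Longrightarrow> norm (vint f \<mu>) \<le> C"
  shows "mk_norm \<mu> \<le> C"
proof -
  have "(SUP f \<in> {f. lip f \<le> 1}. ennreal (norm (vint f \<mu>))) \<le> ennreal C"
    using assms by (intro SUP_least ennreal_leI) (auto simp: lip_le_1_iff)
  then have "enn2real (SUP f \<in> {f. lip f \<le> 1}. ennreal (norm (vint f \<mu>))) \<le> enn2real (ennreal C)"
    by (rule enn2real_mono) simp
  then show ?thesis using assms(1) by (simp add: mk_norm_def)
qed

lemma mk_norm_nonneg: "0 \<le> mk_norm \<mu>"
  by (simp add: mk_norm_def)

lemma norm_vint_le_mk_norm:
  fixes f :: "'t \<Rightarrow> 'k::real_or_complex ^ 'n::finite"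
  assumes f: "1-lipschitz_on UNIV f" and \<mu>: "cabv_on \<mu> UNIV = 0"
  shows "norm (vint f \<mu>) \<le> mk_norm \<mu>"
proof -
  obtain D where D: "0 \<le> D" "\<And>x y :: 't. dist x y \<le> D" using ex_dist_bound by blast
  let ?S = "SUP f \<in> {f. lip f \<le> 1}. ennreal (norm (vint f \<mu>))"
  have "?S \<le> ennreal (D * norm \<mu>)"
    using norm_vint_lipschitz_le[OF _ \<mu> D(2), of 1]
    by (intro SUP_least ennreal_leI) (auto simp: lip_le_1_iff)
  then have "?S < top" by (rule le_less_trans) simp
  moreover have "ennreal (norm (vint f \<mu>)) \<le> ?S"
    using f by (intro SUP_upper) (simp add: lip_le_1_iff)
  ultimately have "enn2real (ennreal (norm (vint f \<mu>))) \<le> enn2real ?S" by (intro enn2real_mono)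
  then show ?thesis by (simp add: mk_norm_def)
qed

lemma norm_vint_le_lipschitz_mk_norm:
  fixes f :: "'t \<Rightarrow> 'k::real_or_complex ^ 'n::finite"
  assumes f: "L-lipschitz_on UNIV f" and \<mu>: "cabv_on \<mu> UNIV = 0"
  shows "norm (vint f \<mu>) \<le> L * mk_norm \<mu>"
proof (cases "L = 0")
  case True
  then show ?thesis
    using ex_dist_bound norm_vint_lipschitz_le[OF f \<mu>] by auto
next
  case False
  then have L: "0 < L" using lipschitz_on_nonneg[OF f] by simp
  have fc: "continuous_on UNIV f" by (rule lipschitz_imp_continuous[OF f])
  have "(\<bar>1 / L\<bar> * L)-lipschitz_on UNIV (\<lambda>t. (1 / L) *\<^sub>R f t)"
    using f by (rule lipschitz_on_cmult)
  then have "1-lipschitz_on UNIV (\<lambda>t. (1 / L) *\<^sub>R f t)" using L by simp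
  from norm_vint_le_mk_norm[OF this \<mu>] show ?thesis
    using L unfolding vint_scaleR[OF fc] by (simp add: field_simps)
qed

lemma vint_diff_measure:
  fixes f :: "'t \<Rightarrow> 'k::real_or_complex ^ 'n::finite"
  assumes "continuous_on UNIV f"
  shows "vint f (\<mu> - \<nu>) = vint f \<mu> - vint f \<nu>"
  by (rule linear_diff[OF bounded_linear.linear[OF bounded_linear_vint[OF assms]]])

lemma mk_norm_eq_0:
  fixes \<mu> :: "('t, 'k::real_or_complex ^ 'n::finite) cabv"
  assumes \<mu>: "cabv_on \<mu> UNIV = 0" and "mk_norm \<mu> = 0"
  shows "\<mu> = 0"
proof (rule ccontr)
  assume "\<mu> \<noteq> 0"
  then have "0 < norm \<mu>" by simp
  then obtain f L where f: "L-lipschitz_on UNIV f" and pos: "0 < norm (vint f \<mu>)"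
    by (rule ex_lipschitz_vint_gt) blast
  have "norm (vint f \<mu>) \<le> L * mk_norm \<mu>" by (rule norm_vint_le_lipschitz_mk_norm[OF f \<mu>])
  then show False using pos assms(2) by simp
qed

lemma Metric_space_mk_dist:
  fixes A :: "('t, 'k::real_or_complex ^ 'n::finite) cabv set"
  assumes A: "\<And>\<mu>. \<mu> \<in> A \<Longrightarrow> cabv_on \<mu> UNIV = v"
  shows "Metric_space A mk_dist"
proof
  fix \<mu> \<nu> :: "('t, 'k ^ 'n) cabv"
  show "0 \<le> mk_dist \<mu> \<nu>" by (simp add: mk_dist_def mk_norm_nonneg)
  have "ennreal (norm (vint f (\<mu> - \<nu>))) = ennreal (norm (vint f (\<nu> - \<mu>)))" if "lip f \<le> 1" for f
  proof -
    have "continuous_on UNIV f" using that lipschitz_imp_continuous by (auto simp: lip_le_1_iff)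
    then show ?thesis by (simp add: vint_diff_measure norm_minus_commute)
  qed
  then show "mk_dist \<mu> \<nu> = mk_dist \<nu> \<mu>"
    unfolding mk_dist_def mk_norm_def by (intro arg_cong[where f = enn2real] SUP_cong) auto
next
  fix \<mu> \<nu> assume in_A: "\<mu> \<in> A" "\<nu> \<in> A"
  have "mk_norm (0 :: ('t, 'k ^ 'n) cabv) \<le> 0"
  proof (rule mk_norm_leI)
    fix f :: "'t \<Rightarrow> 'k ^ 'n" assume "1-lipschitz_on UNIV f"
    then have "linear (vint f)"
      by (intro bounded_linear.linear bounded_linear_vint lipschitz_imp_continuous)
    then show "norm (vint f 0) \<le> 0" by (simp add: linear_0)
  qed simp
  then have "mk_norm (0 :: ('t, 'k ^ 'n) cabv) = 0" using mk_norm_nonneg antisym by blast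
  moreover have "cabv_on (\<mu> - \<nu>) UNIV = 0" using A in_A by simp
  ultimately show "mk_dist \<mu> \<nu> = 0 \<longleftrightarrow> \<mu> = \<nu>"
    using mk_norm_eq_0[of "\<mu> - \<nu>"] by (auto simp: mk_dist_def)
next
  fix \<mu> \<nu> \<kappa> assume in_A: "\<mu> \<in> A" "\<nu> \<in> A" "\<kappa> \<in> A"
  show "mk_dist \<mu> \<kappa> \<le> mk_dist \<mu> \<nu> + mk_dist \<nu> \<kappa>"
    unfolding mk_dist_def
  proof (rule mk_norm_leI)
    fix f :: "'t \<Rightarrow> 'k ^ 'n" assume f: "1-lipschitz_on UNIV f"
    then have fc: "continuous_on UNIV f" by (rule lipschitz_imp_continuous)
    have "norm (vint f (\<mu> - \<kappa>)) = norm (vint f (\<mu> - \<nu>) + vint f (\<nu> - \<kappa>))"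
      by (simp add: vint_diff_measure[OF fc])
    also have "\<dots> \<le> norm (vint f (\<mu> - \<nu>)) + norm (vint f (\<nu> - \<kappa>))" by (rule norm_triangle_ineq)
    also have "\<dots> \<le> mk_norm (\<mu> - \<nu>) + mk_norm (\<nu> - \<kappa>)"
      using A in_A by (intro add_mono norm_vint_le_mk_norm f) auto
    finally show "norm (vint f (\<mu> - \<kappa>)) \<le> mk_norm (\<mu> - \<nu>) + mk_norm (\<nu> - \<kappa>)" .
  qed (simp add: mk_norm_nonneg)
qed

lemma openin_weak_star_vimage:
  fixes f :: "'a::topological_space \<Rightarrow> 'k::real_or_complex ^ 'n::finite"
  shows "continuous_on UNIV f \<Longrightarrow> open U \<Longrightarrow> openin weak_star (vint f -` U)"
  unfolding weak_star_def by (intro topology_generated_by_Basis) blast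

lemma topspace_weak_star [simp]:
  "topspace (weak_star :: ('a::topological_space, 'k::real_or_complex ^ 'n::finite) cabv topology) = UNIV"
  using openin_subset[OF openin_weak_star_vimage[of "\<lambda>_::'a. 0 :: 'k ^ 'n" UNIV]] by auto

lemma closedin_weak_star_vimage:
  fixes f :: "'a::topological_space \<Rightarrow> 'k::real_or_complex ^ 'n::finite"
  shows "continuous_on UNIV f \<Longrightarrow> closed C \<Longrightarrow> closedin weak_star (vint f -` C)"
  using openin_weak_star_vimage[of f "- C"]
  by (simp add: closedin_def vimage_Compl open_Compl flip: Compl_eq_Diff_UNIV)

text \<open>
  The ball is an intersection of weak* closed conditions: \<open>|\<integral> f d\<mu>| \<le> a\<close> for all continuous \<open>f\<close>
  bounded by 1, which characterizes \<open>\<parallel>\<mu>\<parallel> \<le> a\<close> by duality, and prescribed integrals of the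
  constant functions, which characterize the total mass.
\<close>

lemma closedin_weak_star_ball:
  fixes v :: "'k::real_or_complex ^ 'n::finite"
  assumes "0 \<le> a"
  shows "closedin weak_star (cabv_ball_at a v :: ('t, 'k ^ 'n) cabv set)"
proof -
  let ?F = "{f :: 't \<Rightarrow> 'k ^ 'n. continuous_on UNIV f \<and> (\<forall>t. norm (f t) \<le> 1)}"
  let ?B = "(\<Inter>f\<in>?F. vint f -` cball 0 a)"
  let ?M = "(\<Inter>x. vint (\<lambda>_ :: 't. x) -` {scalar_prod x v})"
  have "(\<lambda>_. 0) \<in> ?F" by simp
  then have "?F \<noteq> {}" by blast
  then have "closedin weak_star ?B" by (intro closedin_INT closedin_weak_star_vimage) auto
  moreover have "closedin weak_star ?M"
    by (intro closedin_INT closedin_weak_star_vimage) auto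
  moreover have "cabv_ball_at a v = ?B \<inter> ?M"
  proof (intro equalityI subsetI)
    fix \<mu> :: "('t, 'k ^ 'n) cabv" assume \<mu>: "\<mu> \<in> cabv_ball_at a v"
    then have "norm (vint f \<mu>) \<le> a" if "f \<in> ?F" for f
      using norm_vint_le[of f 1 \<mu>] that by (auto simp: cabv_ball_at_def)
    then show "\<mu> \<in> ?B \<inter> ?M" using \<mu> by (auto simp: vint_const cabv_ball_at_def)
  next
    fix \<mu> :: "('t, 'k ^ 'n) cabv" assume \<mu>: "\<mu> \<in> ?B \<inter> ?M"
    have "norm \<mu> \<le> a"
    proof (rule ccontr)
      assume "\<not> norm \<mu> \<le> a"
      then have "a < norm \<mu>" by simp
      then obtain f L where f: "L-lipschitz_on UNIV f" "\<And>t. norm (f t) \<le> 1" "a < norm (vint f \<mu>)"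
        by (rule ex_lipschitz_vint_gt) blast
      then have "f \<in> ?F" using lipschitz_imp_continuous by blast
      then show False using \<mu> f(3) by auto
    qed
    moreover have "cabv_on \<mu> UNIV = v"
    proof -
      let ?x = "cabv_on \<mu> UNIV - v"
      have "scalar_prod ?x (cabv_on \<mu> UNIV) = scalar_prod ?x v" using \<mu> by (auto simp: vint_const)
      then have "scalar_prod ?x ?x = 0" by (simp add: scalar_prod.diff_right)
      then show ?thesis by (simp add: scalar_prod_self)
    qed
    ultimately show "\<mu> \<in> cabv_ball_at a v" by (simp add: cabv_ball_at_def)
  qed
  ultimately show ?thesis by (simp add: closedin_Int)
qed

lemma weak_star_limit_in_closed:
  fixes A :: "('t, 'k::real_or_complex ^ 'n::finite) cabv set"
  assumes A: "closedin weak_star A" and \<sigma>: "\<And>k::nat. \<sigma> k \<in> A"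
    and lim: "\<And>f. continuous_on UNIV f \<Longrightarrow> (\<lambda>k. vint f (\<sigma> k)) \<longlonglongrightarrow> vint f \<mu>"
  shows "\<mu> \<in> A"
proof (rule ccontr)
  assume "\<mu> \<notin> A"
  let ?S = "{vint f -` U | (f :: 't \<Rightarrow> 'k ^ 'n) U. continuous_on UNIV f \<and> open U}"
  have ev: "\<mu> \<in> V \<Longrightarrow> \<forall>\<^sub>F k in sequentially. \<sigma> k \<in> V" if "generate_topology_on ?S V" for V
    using that
  proof induction
    case (Int a b)
    then show ?case by (auto intro: eventually_conj)
  next
    case (UN K)
    then obtain k where "k \<in> K" "\<mu> \<in> k" by blast
    then have "\<forall>\<^sub>F i in sequentially. \<sigma> i \<in> k" using UN.IH by blast
    then show ?case using \<open>k \<in> K\<close> by (auto elim: eventually_mono)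
  next
    case (Basis s)
    then obtain f U where "s = vint f -` U" "continuous_on UNIV f" "open U" by blast
    then show ?case using topological_tendstoD[OF lim, of f U] Basis.prems by simp
  qed simp
  have "openin weak_star (- A)" using A by (simp add: closedin_def Compl_eq_Diff_UNIV)
  then have "\<forall>\<^sub>F k in sequentially. \<sigma> k \<in> - A"
    using ev[of "- A"] \<open>\<mu> \<notin> A\<close> by (simp add: weak_star_def openin_topology_generated_by_iff)
  then show False using \<sigma> by simp
qed

text \<open>
  The adjoint formula turns \<open>\<integral> f d(H \<mu>)\<close> into a series of integrals
  against \<open>\<mu>\<close> of functions with Lipschitz constants at most \<open>\<parallel>R\<^sub>i\<parallel> r\<^sub>i\<close>.
\<close>

lemma mk_norm_markov_op_le:
  fixes \<omega> :: "nat \<Rightarrow> 't \<Rightarrow> 't" and R :: "nat \<Rightarrow> ('k::real_or_complex ^ 'n::finite) \<Rightarrow>\<^sub>L ('k ^ 'n)"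
  assumes \<omega>: "\<And>i. (r i)-lipschitz_on UNIV (\<omega> i)" and R: "summable (\<lambda>i. norm (R i))"
    and Rr: "summable (\<lambda>i. norm (R i) * r i)"
    and lin: "\<And>i. Vector_Spaces.linear (*s) (*s) (blinfun_apply (R i))"
    and \<mu>: "cabv_on \<mu> UNIV = 0"
  shows "mk_norm (markov_op R \<omega> \<mu>) \<le> (\<Sum>i. norm (R i) * r i) * mk_norm \<mu>"
proof -
  have \<omega>c: "continuous_on UNIV (\<omega> i)" for i by (rule lipschitz_imp_continuous[OF \<omega>])
  interpret markov_system \<omega> R
    using \<omega>c R by unfold_locales (rule borel_measurable_continuous_onI)
  have r: "0 \<le> r i" for i by (rule lipschitz_on_nonneg[OF \<omega>])
  show ?thesis
  proof (rule mk_norm_leI)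
    show "0 \<le> (\<Sum>i. norm (R i) * r i) * mk_norm \<mu>"
      using r by (intro mult_nonneg_nonneg suminf_nonneg Rr mk_norm_nonneg) auto
    fix f :: "'t \<Rightarrow> 'k ^ 'n" assume f: "1-lipschitz_on UNIV f"
    have fc: "continuous_on UNIV f" by (rule lipschitz_imp_continuous[OF f])
    have term_le: "norm (vint f (branch i \<mu>)) \<le> norm (R i) * r i * mk_norm \<mu>" for i
    proof -
      have "(norm (R i) * r i)-lipschitz_on UNIV (\<lambda>t. kadjoint (R i) (f (\<omega> i t)))"
      proof (rule lipschitz_onI)
        fix x y
        have "dist (kadjoint (R i) (f (\<omega> i x))) (kadjoint (R i) (f (\<omega> i y)))
            = norm (kadjoint (R i) (f (\<omega> i x) - f (\<omega> i y)))"
          by (simp add: dist_norm kadjoint_diff)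
        also have "\<dots> \<le> norm (R i) * norm (f (\<omega> i x) - f (\<omega> i y))"
          by (rule norm_kadjoint_le[OF lin])
        also have "\<dots> \<le> norm (R i) * (r i * dist x y)"
        proof (rule mult_left_mono)
          have "norm (f (\<omega> i x) - f (\<omega> i y)) \<le> dist (\<omega> i x) (\<omega> i y)"
            using lipschitz_onD[OF f, of "\<omega> i x" "\<omega> i y"] by (simp add: dist_norm)
          also have "\<dots> \<le> r i * dist x y" using lipschitz_onD[OF \<omega>] by simp
          finally show "norm (f (\<omega> i x) - f (\<omega> i y)) \<le> r i * dist x y" .
        qed simp
        finally show "dist (kadjoint (R i) (f (\<omega> i x))) (kadjoint (R i) (f (\<omega> i y)))
            \<le> norm (R i) * r i * dist x y" by (simp add: mult.assoc)
      qed (use r in simp)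
      then have "norm (vint (\<lambda>t. kadjoint (R i) (f (\<omega> i t))) \<mu>) \<le> norm (R i) * r i * mk_norm \<mu>"
        using \<mu> by (rule norm_vint_le_lipschitz_mk_norm)
      then show ?thesis by (simp add: vint_apply_image[OF fc \<omega>c lin])
    qed
    have sums: "(\<lambda>i. vint f (branch i \<mu>)) sums vint f (markov_op R \<omega> \<mu>)"
      by (rule bounded_linear.sums[OF bounded_linear_vint[OF fc] branch_sums])
    have dom: "summable (\<lambda>i. norm (R i) * r i * mk_norm \<mu>)" by (rule summable_mult2[OF Rr])
    have "norm (\<Sum>i. vint f (branch i \<mu>)) \<le> (\<Sum>i. norm (R i) * r i * mk_norm \<mu>)"
      by (rule norm_suminf_le[OF term_le dom])
    also have "\<dots> = (\<Sum>i. norm (R i) * r i) * mk_norm \<mu>" by (rule suminf_mult2[OF Rr, symmetric])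
    finally show "norm (vint f (markov_op R \<omega> \<mu>)) \<le> (\<Sum>i. norm (R i) * r i) * mk_norm \<mu>"
      using sums by (simp add: sums_iff)
  qed
qed

end

text \<open>
  The point mass \<open>v\<close> at \<open>t\<close>; it shows that balls with prescribed total mass \<open>v\<close> are not empty.
\<close>

lemma ex_dirac_measure:
  fixes t :: "'t::topological_space" and v :: "'x::euclidean_space"
  shows "\<exists>\<mu> :: ('t, 'x) cabv. norm \<mu> \<le> norm v \<and> cabv_on \<mu> UNIV = v"
proof -
  define m where "m B = (if B \<in> sets borel \<and> t \<in> B then v else 0)" for B
  have "sigma_additive m"
    unfolding sigma_additive_def
  proof (intro allI impI)
    fix A :: "nat \<Rightarrow> 't set" assume A: "range A \<subseteq> sets borel" "disjoint_family A"
    then have UA: "(\<Union>i. A i) \<in> sets borel" "\<And>i. A i \<in> sets borel" by auto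
    show "(\<lambda>i. m (A i)) sums m (\<Union>i. A i)"
    proof (cases "\<exists>j. t \<in> A j")
      case True
      then obtain j where j: "t \<in> A j" ..
      then have "t \<notin> A i" if "i \<noteq> j" for i using A(2) that by (auto simp: disjoint_family_on_def)
      then have "(\<lambda>i. m (A i)) = (\<lambda>i. if i = j then v else 0)" using UA j by (auto simp: m_def)
      moreover have "m (\<Union>i. A i) = v" using UA j by (auto simp: m_def)
      ultimately show ?thesis using sums_single[of j "\<lambda>_. v"] by simp
    qed (simp add: m_def)
  qed
  moreover have le: "(\<Sum>A\<in>P. norm (m A)) \<le> norm v" if P: "P \<in> borel_partitions" for P
  proof -
    have fin: "finite P" and disj: "disjoint P" and un: "\<Union>P = UNIV" and sets: "P \<subseteq> sets borel"
      using P by (auto simp: borel_partitions_def partition_on_def)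
    obtain B where B: "B \<in> P" "t \<in> B" using un by (metis UNIV_I UnionE)
    have "norm (m A) = 0" if "A \<in> P - {B}" for A
      using disjointD[OF disj _ B(1), of A] that B(2) by (auto simp: m_def)
    then have "(\<Sum>A\<in>P. norm (m A)) = norm (m B)" using fin B by (subst sum.remove[of P B]) auto
    then show ?thesis using B sets by (auto simp: m_def)
  qed
  then have "bdd_above (var_sums m)" by (auto simp: var_sums_def bdd_above_def)
  ultimately have m: "cabv_on (Abs_cabv m) = m" by (intro Abs_cabv_inverse) (auto simp: m_def)
  have "norm (Abs_cabv m) \<le> norm v" using le by (intro norm_cabv_leI) (simp add: m)
  moreover have "cabv_on (Abs_cabv m) UNIV = v" by (simp add: m m_def)
  ultimately show ?thesis by blast
qed

section \<open>Weak* limits of sequences of measures\<close>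

lemma lipschitz_mult:
  fixes f g :: "'a::metric_space \<Rightarrow> real"
  assumes f: "L-lipschitz_on UNIV f" and g: "M-lipschitz_on UNIV g"
    and C: "\<And>t. \<bar>f t\<bar> \<le> C" and D: "\<And>t. \<bar>g t\<bar> \<le> D"
  shows "(C * M + D * L)-lipschitz_on UNIV (\<lambda>t. f t * g t)"
proof (rule lipschitz_onI)
  have nn: "0 \<le> C" "0 \<le> D" using C[of undefined] D[of undefined] by (auto intro: order_trans[OF abs_ge_zero])
  show "0 \<le> C * M + D * L"
    using nn lipschitz_on_nonneg[OF f] lipschitz_on_nonneg[OF g] by simp
  fix x y
  have fd: "\<bar>f x - f y\<bar> \<le> L * dist x y" and gd: "\<bar>g x - g y\<bar> \<le> M * dist x y"
    using lipschitz_onD[OF f, of x y] lipschitz_onD[OF g, of x y] by (simp_all add: dist_real_def)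
  have "dist (f x * g x) (f y * g y) = \<bar>f x * (g x - g y) + g y * (f x - f y)\<bar>"
    by (simp add: dist_real_def algebra_simps)
  also have "\<dots> \<le> \<bar>f x\<bar> * \<bar>g x - g y\<bar> + \<bar>g y\<bar> * \<bar>f x - f y\<bar>"
    by (rule order_trans[OF abs_triangle_ineq]) (simp add: abs_mult)
  also have "\<dots> \<le> C * (M * dist x y) + D * (L * dist x y)"
    using fd gd C D nn by (intro add_mono mult_mono) auto
  finally show "dist (f x * g x) (f y * g y) \<le> (C * M + D * L) * dist x y"
    by (simp add: algebra_simps)
qed

context compact_metric
begin

text \<open>
  Stone-Weierstrass: on a compact space Lipschitz functions are bounded and so form a
  ring, and they separate points through the functions \<open>dist _ x\<close>.
\<close>

lemma ex_lipschitz_close_real: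
  fixes f :: "'t \<Rightarrow> real"
  assumes f: "continuous_on UNIV f" and "0 < \<epsilon>"
  shows "\<exists>g. (\<exists>L. L-lipschitz_on UNIV g) \<and> (\<forall>t. \<bar>f t - g t\<bar> < \<epsilon>)"
proof -
  interpret function_ring_on "{g :: 't \<Rightarrow> real. \<exists>L. L-lipschitz_on UNIV g}" UNIV
  proof
    show "compact (UNIV :: 't set)" by (rule compact_UNIV)
    fix p assume "p \<in> {g :: 't \<Rightarrow> real. \<exists>L. L-lipschitz_on UNIV g}"
    then obtain L where p: "L-lipschitz_on UNIV p" by blast
    then show pc: "continuous_on UNIV p" by (rule lipschitz_imp_continuous)
    fix q assume "q \<in> {g :: 't \<Rightarrow> real. \<exists>L. L-lipschitz_on UNIV g}"
    then obtain M where q: "M-lipschitz_on UNIV q" by blast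
    then have qc: "continuous_on UNIV q" by (rule lipschitz_imp_continuous)
    show "(\<lambda>t. p t + q t) \<in> {g. \<exists>L. L-lipschitz_on UNIV g}"
      using lipschitz_on_add[OF p q] by blast
    obtain C where "\<And>t. norm (p t) \<le> C" using continuous_norm_bounded[OF pc] by blast
    moreover obtain D where "\<And>t. norm (q t) \<le> D" using continuous_norm_bounded[OF qc] by blast
    ultimately have "(C * M + D * L)-lipschitz_on UNIV (\<lambda>t. p t * q t)"
      by (intro lipschitz_mult p q) simp_all
    then show "(\<lambda>t. p t * q t) \<in> {g. \<exists>L. L-lipschitz_on UNIV g}" by blast
  next
    show "(\<lambda>_. c) \<in> {g :: 't \<Rightarrow> real. \<exists>L. L-lipschitz_on UNIV g}" for c
      by (auto simp: lipschitz_on_def)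
  next
    fix x y :: 't assume "x \<noteq> y"
    have "1-lipschitz_on UNIV (\<lambda>t. dist t x)"
    proof (rule lipschitz_onI)
      show "dist (dist s x) (dist t x) \<le> 1 * dist s t" for s t
        using dist_triangle[of s x t] dist_triangle[of t x s] by (simp add: dist_real_def dist_commute)
    qed simp
    moreover have "dist x x \<noteq> dist y x" using \<open>x \<noteq> y\<close> by simp
    ultimately show "\<exists>g\<in>{g :: 't \<Rightarrow> real. \<exists>L. L-lipschitz_on UNIV g}. g x \<noteq> g y"
      by (intro bexI[of _ "\<lambda>t. dist t x"]) auto
  qed
  show ?thesis using Stone_Weierstrass_basic[OF f \<open>0 < \<epsilon>\<close>] by blast
qed

lemma ex_lipschitz_close:
  fixes f :: "'t \<Rightarrow> 'b::euclidean_space"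
  assumes f: "continuous_on UNIV f" and "0 < \<epsilon>"
  obtains g L where "L-lipschitz_on UNIV g" "\<And>t. norm (f t - g t) \<le> \<epsilon>"
proof -
  let ?\<delta> = "\<epsilon> / real DIM('b)"
  have "\<exists>g. (\<exists>L. L-lipschitz_on UNIV g) \<and> (\<forall>t. \<bar>f t \<bullet> b - g t\<bar> < ?\<delta>)" for b
    using \<open>0 < \<epsilon>\<close> by (intro ex_lipschitz_close_real continuous_intros f) simp
  then obtain g where g: "\<And>b. \<exists>L. L-lipschitz_on UNIV (g b)" "\<And>b t. \<bar>f t \<bullet> b - g b t\<bar> < ?\<delta>"
    by metis
  define h where "h t = (\<Sum>b\<in>Basis. g b t *\<^sub>R b)" for t
  have "\<exists>L. L-lipschitz_on UNIV h"
    unfolding h_def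
  proof (rule lipschitz_sum)
    show "\<exists>L. L-lipschitz_on UNIV (\<lambda>t. g b t *\<^sub>R b)" if "b \<in> Basis" for b
      using g(1)[of b] lipschitz_scaleR[of _ "g b" b] that by auto
  qed simp
  moreover have "norm (f t - h t) \<le> \<epsilon>" for t
  proof -
    have "norm (f t - h t) \<le> (\<Sum>b\<in>Basis. \<bar>(f t - h t) \<bullet> b\<bar>)" by (rule norm_le_l1)
    also have "\<dots> \<le> (\<Sum>b\<in>(Basis :: 'b set). ?\<delta>)"
      using g(2) by (intro sum_mono) (simp add: h_def inner_diff_left less_imp_le)
    finally show ?thesis by simp
  qed
  ultimately show thesis using that by blast
qed

lemma vint_convergent_continuous:
  fixes \<sigma> :: "nat \<Rightarrow> ('t, 'k::real_or_complex ^ 'n::finite) cabv"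
  assumes a: "\<And>k. norm (\<sigma> k) \<le> a"
    and lim: "\<And>f L. L-lipschitz_on UNIV f \<Longrightarrow> Cauchy (\<lambda>k. vint f (\<sigma> k))"
    and f: "continuous_on UNIV f"
  shows "convergent (\<lambda>k. vint f (\<sigma> k))"
  unfolding Cauchy_convergent_iff[symmetric]
proof (rule CauchyI)
  fix \<epsilon> :: real assume "0 < \<epsilon>"
  have "0 \<le> a" using a[of 0] norm_ge_zero order_trans by blast
  define \<delta> where "\<delta> = \<epsilon> / (3 * (a + 1))"
  have \<delta>: "0 < \<delta>" "\<delta> * a < \<epsilon> / 3"
    using \<open>0 \<le> a\<close> \<open>0 < \<epsilon>\<close> by (simp_all add: \<delta>_def field_simps)
  obtain g L where g: "L-lipschitz_on UNIV g" "\<And>t. norm (f t - g t) \<le> \<delta>"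
    using ex_lipschitz_close[OF f \<delta>(1)] by blast
  have gc: "continuous_on UNIV g" by (rule lipschitz_imp_continuous[OF g(1)])
  have close: "norm (vint f (\<sigma> k) - vint g (\<sigma> k)) < \<epsilon> / 3" for k
  proof -
    have "norm (vint (\<lambda>t. f t - g t) (\<sigma> k)) \<le> \<delta> * norm (\<sigma> k)"
      by (intro norm_vint_le continuous_intros f gc g(2))
    also have "\<dots> \<le> \<delta> * a" using a \<delta>(1) by (intro mult_left_mono) auto
    finally show ?thesis using \<delta>(2) by (simp add: vint_diff[OF f gc])
  qed
  obtain M where M: "\<And>m n. m \<ge> M \<Longrightarrow> n \<ge> M \<Longrightarrow> norm (vint g (\<sigma> m) - vint g (\<sigma> n)) < \<epsilon> / 3"
    using CauchyD[OF lim[OF g(1)], of "\<epsilon> / 3"] \<open>0 < \<epsilon>\<close> by auto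
  have "norm (vint f (\<sigma> m) - vint f (\<sigma> n)) < \<epsilon>" if "m \<ge> M" "n \<ge> M" for m n
  proof -
    have "vint f (\<sigma> m) - vint f (\<sigma> n) = (vint f (\<sigma> m) - vint g (\<sigma> m))
        + (vint g (\<sigma> m) - vint g (\<sigma> n)) - (vint f (\<sigma> n) - vint g (\<sigma> n))" by simp
    also have "norm \<dots> < \<epsilon>"
      using close[of m] close[of n] M[OF that]
        norm_triangle_ineq4[of "(vint f (\<sigma> m) - vint g (\<sigma> m)) + (vint g (\<sigma> m) - vint g (\<sigma> n))"
          "vint f (\<sigma> n) - vint g (\<sigma> n)"]
        norm_triangle_ineq[of "vint f (\<sigma> m) - vint g (\<sigma> m)" "vint g (\<sigma> m) - vint g (\<sigma> n)"]
      by linarith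
    finally show ?thesis .
  qed
  then show "\<exists>M. \<forall>m\<ge>M. \<forall>n\<ge>M. norm (vint f (\<sigma> m) - vint f (\<sigma> n)) < \<epsilon>" by blast
qed

end

text \<open>
  A bounded real functional on \<open>C(T, X)\<close>.  The bound is one-sided; applied to \<open>- f\<close> it bounds the
  absolute value.
\<close>

locale bounded_functional = compact_metric T for T :: "'t::metric_space itself" +
  fixes \<Phi> :: "('t \<Rightarrow> 'x::euclidean_space) \<Rightarrow> real" and a :: real
  assumes l_add: "continuous_on UNIV f \<Longrightarrow> continuous_on UNIV g \<Longrightarrow> \<Phi> (\<lambda>t. f t + g t) = \<Phi> f + \<Phi> g"
    and l_scaleR: "continuous_on UNIV f \<Longrightarrow> \<Phi> (\<lambda>t. c *\<^sub>R f t) = c * \<Phi> f"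
    and l_bound: "continuous_on UNIV f \<Longrightarrow> (\<And>t. norm (f t) \<le> C) \<Longrightarrow> \<Phi> f \<le> a * C"
begin

definition dominated :: "('t \<Rightarrow> real) \<Rightarrow> ('t \<Rightarrow> 'x) set" where
  "dominated \<phi> = {g. continuous_on UNIV g \<and> (\<forall>t. norm (g t) \<le> \<phi> t)}"

definition total_variation :: "('t \<Rightarrow> real) \<Rightarrow> real" where
  "total_variation \<phi> = Sup (\<Phi> ` dominated \<phi>)"

lemma l_zero: "\<Phi> (\<lambda>_. 0) = 0"
  using l_scaleR[of "\<lambda>_. 0" 0] by simp

lemma l_uminus: "continuous_on UNIV f \<Longrightarrow> \<Phi> (\<lambda>t. - f t) = - \<Phi> f"
  using l_scaleR[of f "-1"] by simp

lemma l_diff: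
  assumes "continuous_on UNIV f" "continuous_on UNIV g"
  shows "\<Phi> (\<lambda>t. f t - g t) = \<Phi> f - \<Phi> g"
  using l_add[OF assms(1) continuous_on_minus[OF assms(2)]] l_uminus[OF assms(2)] by simp

lemma l_sum:
  assumes "finite I" "\<And>i. i \<in> I \<Longrightarrow> continuous_on UNIV (f i)"
  shows "\<Phi> (\<lambda>t. \<Sum>i\<in>I. f i t) = (\<Sum>i\<in>I. \<Phi> (f i))"
  using assms
proof (induction I rule: finite_induct)
  case (insert i I)
  have "\<Phi> (\<lambda>t. f i t + (\<Sum>i\<in>I. f i t)) = \<Phi> (f i) + \<Phi> (\<lambda>t. \<Sum>i\<in>I. f i t)"
    using insert.prems by (intro l_add continuous_on_sum) auto
  then show ?case using insert by simp
qed (simp add: l_zero)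

lemma a_nonneg: "0 \<le> a"
  using l_bound[of "\<lambda>_. 0" 1] l_zero by simp

lemma le_total_variation:
  assumes \<phi>: "continuous_on UNIV \<phi>" and g: "continuous_on UNIV g" "\<And>t. norm (g t) \<le> \<phi> t"
  shows "\<Phi> g \<le> total_variation \<phi>"
  unfolding total_variation_def
proof (rule cSup_upper)
  show "\<Phi> g \<in> \<Phi> ` dominated \<phi>" using g by (auto simp: dominated_def)
  obtain C where C: "\<And>t. norm (\<phi> t) \<le> C" using continuous_norm_bounded[OF \<phi>] by blast
  have "\<Phi> h \<le> a * C" if "h \<in> dominated \<phi>" for h
  proof (rule l_bound)
    show "norm (h t) \<le> C" for t
      using that C[of t] by (auto simp: dominated_def intro: order_trans)
  qed (use that in \<open>simp add: dominated_def\<close>)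
  then show "bdd_above (\<Phi> ` dominated \<phi>)" by (auto simp: bdd_above_def)
qed

lemma total_variation_leI:
  assumes "\<And>t. 0 \<le> \<phi> t" and "\<And>g. continuous_on UNIV g \<Longrightarrow> (\<And>t. norm (g t) \<le> \<phi> t) \<Longrightarrow> \<Phi> g \<le> C"
  shows "total_variation \<phi> \<le> C"
  unfolding total_variation_def
proof (rule cSup_least)
  have "(\<lambda>_. 0) \<in> dominated \<phi>" using assms(1) by (simp add: dominated_def)
  then show "\<Phi> ` dominated \<phi> \<noteq> {}" by blast
qed (use assms(2) in \<open>auto simp: dominated_def\<close>)

lemma total_variation_nonneg:
  assumes "continuous_on UNIV \<phi>" "\<And>t. 0 \<le> \<phi> t"
  shows "0 \<le> total_variation \<phi>"
  using le_total_variation[OF assms(1), of "\<lambda>_. 0"] assms(2) l_zero by simp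

text \<open>
  Superadditivity holds because dominated functions can be added.  For the converse, a
  function dominated by \<open>\<phi> + \<psi>\<close> has to be split into parts dominated by \<open>\<phi>\<close> and by \<open>\<psi>\<close>.
\<close>

lemma total_variation_add:
  assumes \<phi>: "continuous_on UNIV \<phi>" "\<And>t. 0 \<le> \<phi> t" and \<psi>: "continuous_on UNIV \<psi>" "\<And>t. 0 \<le> \<psi> t"
  shows "total_variation (\<lambda>t. \<phi> t + \<psi> t) = total_variation \<phi> + total_variation \<psi>"
proof (rule antisym)
  have sum_c: "continuous_on UNIV (\<lambda>t. \<phi> t + \<psi> t)" by (intro continuous_intros \<phi> \<psi>)
  have "total_variation \<phi> \<le> total_variation (\<lambda>t. \<phi> t + \<psi> t) - \<Phi> h"
    if h: "continuous_on UNIV h" "\<And>t. norm (h t) \<le> \<psi> t" for h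
  proof (rule total_variation_leI[OF \<phi>(2)])
    fix g :: "'t \<Rightarrow> 'x" assume g: "continuous_on UNIV g" "\<And>t. norm (g t) \<le> \<phi> t"
    have "\<Phi> (\<lambda>t. g t + h t) \<le> total_variation (\<lambda>t. \<phi> t + \<psi> t)"
      using g h by (intro le_total_variation[OF sum_c] continuous_intros norm_triangle_mono)
    then show "\<Phi> g \<le> total_variation (\<lambda>t. \<phi> t + \<psi> t) - \<Phi> h" by (simp add: l_add[OF g(1) h(1)])
  qed
  then have "total_variation \<psi> \<le> total_variation (\<lambda>t. \<phi> t + \<psi> t) - total_variation \<phi>"
    by (intro total_variation_leI \<psi>(2)) (simp add: algebra_simps)
  then show "total_variation \<phi> + total_variation \<psi> \<le> total_variation (\<lambda>t. \<phi> t + \<psi> t)" by simp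
next
  show "total_variation (\<lambda>t. \<phi> t + \<psi> t) \<le> total_variation \<phi> + total_variation \<psi>"
  proof (rule total_variation_leI)
    show "0 \<le> \<phi> t + \<psi> t" for t using \<phi>(2) \<psi>(2) by simp
    fix g :: "'t \<Rightarrow> 'x" assume g: "continuous_on UNIV g" "\<And>t. norm (g t) \<le> \<phi> t + \<psi> t"
    have bound: "\<Phi> g \<le> total_variation \<phi> + total_variation \<psi> + a * \<delta>" if "0 < \<delta>" for \<delta>
    proof -
      \<comment> \<open>The weights \<open>\<phi> / (\<phi> + \<psi>)\<close> and \<open>\<psi> / (\<phi> + \<psi>)\<close> may be discontinuous where \<open>\<phi> + \<psi>\<close> vanishes.
        Adding \<open>\<delta>\<close> to the denominator makes them continuous and leaves a remainder
        of norm at most \<open>\<delta>\<close>.\<close>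
      define q where "q t = \<phi> t + \<psi> t + \<delta>" for t
      have q: "0 < q t" "norm (g t) \<le> q t" for t
        using \<phi>(2)[of t] \<psi>(2)[of t] g(2)[of t] that by (auto simp: q_def)
      have qc: "continuous_on UNIV q" unfolding q_def by (intro continuous_intros \<phi> \<psi>)
      define part where "part p t = (p t / q t) *\<^sub>R g t" for p :: "'t \<Rightarrow> real" and t
      have part_c: "continuous_on UNIV (part p)" if "continuous_on UNIV p" for p
        unfolding part_def using q(1) by (intro continuous_intros that qc g(1)) (metis less_irrefl)
      have part_le: "norm (part p t) \<le> p t" if "0 \<le> p t" for p t
      proof -
        have "norm (part p t) = p t * (norm (g t) / q t)"
          using that q(1)[of t] by (simp add: part_def)
        also have "\<dots> \<le> p t * 1"
          using that q[of t] by (intro mult_left_mono) (auto simp: divide_le_eq)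
        finally show ?thesis by simp
      qed
      have "g t = part \<phi> t + part \<psi> t + part (\<lambda>_. \<delta>) t" for t
      proof -
        have "part \<phi> t + part \<psi> t + part (\<lambda>_. \<delta>) t = (q t / q t) *\<^sub>R g t"
          unfolding part_def scaleR_add_left[symmetric] add_divide_distrib[symmetric]
          by (simp only: q_def)
        then show ?thesis using q(1)[of t] by simp
      qed
      then have "g = (\<lambda>t. part \<phi> t + part \<psi> t + part (\<lambda>_. \<delta>) t)" by blast
      then have "\<Phi> g = \<Phi> (\<lambda>t. part \<phi> t + part \<psi> t + part (\<lambda>_. \<delta>) t)" by simp
      also have "\<dots> = \<Phi> (part \<phi>) + \<Phi> (part \<psi>) + \<Phi> (part (\<lambda>_. \<delta>))"
        using \<phi>(1) \<psi>(1) by (simp add: l_add part_c continuous_on_add)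
      also have "\<dots> \<le> total_variation \<phi> + total_variation \<psi> + a * \<delta>"
        using \<phi> \<psi> that by (intro add_mono le_total_variation l_bound part_c part_le) auto
      finally show ?thesis .
    qed
    show "\<Phi> g \<le> total_variation \<phi> + total_variation \<psi>"
    proof (rule field_le_epsilon)
      fix \<epsilon> :: real assume "0 < \<epsilon>"
      then have "0 < \<epsilon> / (a + 1)" "a * (\<epsilon> / (a + 1)) \<le> \<epsilon>"
        using a_nonneg by (simp_all add: field_simps)
      then show "\<Phi> g \<le> total_variation \<phi> + total_variation \<psi> + \<epsilon>"
        using bound[of "\<epsilon> / (a + 1)"] by simp
    qed
  qed
qed

lemma total_variation_scale:
  assumes \<phi>: "continuous_on UNIV \<phi>" "\<And>t. 0 \<le> \<phi> t" and "0 \<le> c"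
  shows "total_variation (\<lambda>t. c * \<phi> t) = c * total_variation \<phi>"
proof (cases "c = 0")
  case True
  have "total_variation (\<lambda>_. 0) \<le> 0"
    using l_bound[where C = 0] by (intro total_variation_leI) auto
  then have "total_variation (\<lambda>_. 0) = 0"
    using total_variation_nonneg[of "\<lambda>_. 0"] by simp
  then show ?thesis using True by simp
next
  case False
  then have "0 < c" using \<open>0 \<le> c\<close> by simp
  have ge: "c * total_variation \<phi> \<le> total_variation (\<lambda>t. c * \<phi> t)"
    if "0 < c" "continuous_on UNIV \<phi>" "\<And>t. 0 \<le> \<phi> t" for c \<phi>
  proof -
    have "total_variation \<phi> \<le> total_variation (\<lambda>t. c * \<phi> t) / c"
    proof (rule total_variation_leI[OF that(3)])
      fix g :: "'t \<Rightarrow> 'x" assume g: "continuous_on UNIV g" "\<And>t. norm (g t) \<le> \<phi> t"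
      have "\<Phi> (\<lambda>t. c *\<^sub>R g t) \<le> total_variation (\<lambda>t. c * \<phi> t)"
        using that g by (intro le_total_variation continuous_intros) auto
      then show "\<Phi> g \<le> total_variation (\<lambda>t. c * \<phi> t) / c"
        using that(1) by (simp add: l_scaleR[OF g(1)] field_simps)
    qed
    then show ?thesis using that(1) by (simp add: field_simps)
  qed
  have "(1 / c) * total_variation (\<lambda>t. c * \<phi> t) \<le> total_variation (\<lambda>t. (1 / c) * (c * \<phi> t))"
    using \<open>0 < c\<close> \<phi> by (intro ge continuous_intros) auto
  then have "total_variation (\<lambda>t. c * \<phi> t) \<le> c * total_variation \<phi>"
    using \<open>0 < c\<close> by (simp add: field_simps)
  with ge[OF \<open>0 < c\<close> \<phi>] show ?thesis by simp
qed

text \<open>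
  The analogue for functionals of the measure \<open>(|\<mu>| + \<mu> \<bullet> e) / 2\<close>.
\<close>

definition jordan_part :: "'x \<Rightarrow> ('t \<Rightarrow> real) \<Rightarrow> real" where
  "jordan_part e \<phi> = (total_variation \<phi> + \<Phi> (\<lambda>t. \<phi> t *\<^sub>R e)) / 2"

lemma positive_functional_jordan_part:
  assumes e: "norm e = 1"
  shows "positive_functional (jordan_part e)"
proof
  have c: "continuous_on UNIV (\<lambda>t. \<phi> t *\<^sub>R e)" if "continuous_on UNIV \<phi>" for \<phi> :: "'t \<Rightarrow> real"
    using that by (intro continuous_intros)
  show "0 \<le> jordan_part e f" if f: "continuous_on UNIV f" "\<And>t. 0 \<le> f t" for f
  proof -
    have "\<Phi> (\<lambda>t. - (f t *\<^sub>R e)) \<le> total_variation f"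
      using f e by (intro le_total_variation continuous_intros) auto
    then show ?thesis by (simp add: jordan_part_def l_uminus[OF c[OF f(1)]])
  qed
  show "jordan_part e (\<lambda>t. f t + g t) = jordan_part e f + jordan_part e g"
    if "continuous_on UNIV f" "continuous_on UNIV g" "\<And>t. 0 \<le> f t" "\<And>t. 0 \<le> g t" for f g
    using that by (simp add: jordan_part_def total_variation_add scaleR_add_left l_add[OF c c] add_divide_distrib)
  show "jordan_part e (\<lambda>t. k * f t) = k * jordan_part e f"
    if "continuous_on UNIV f" "\<And>t. 0 \<le> f t" "0 \<le> k" for f k
    using that l_scaleR[OF c[OF that(1)], of k]
    by (simp add: jordan_part_def total_variation_scale distrib_left)
qed

text \<open>
  Represent the positive functionals \<open>jordan_part e\<close> by measures.  In the difference of the parts for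
  \<open>b\<close> and \<open>- b\<close> the total variation cancels, which leaves \<open>\<Phi> (u b)\<close>; summing over the basis
  recovers \<open>\<Phi> f\<close>.
\<close>

theorem vector_riesz_representation:
  obtains N where "\<And>e. e \<in> signed_Basis \<Longrightarrow> finite_measure (N e)"
    "\<And>e. e \<in> signed_Basis \<Longrightarrow> sets (N e) = sets borel"
    "\<And>f. continuous_on UNIV f \<Longrightarrow> \<Phi> f = (\<Sum>e\<in>signed_Basis. \<integral>t. f t \<bullet> e \<partial>N e)"
proof -
  define N where "N e = positive_functional.riesz_measure (jordan_part e)" for e
  have pf: "positive_functional (jordan_part e)" if "e \<in> signed_Basis" for e
    by (rule positive_functional_jordan_part[OF norm_signed_Basis[OF that]])
  have fin: "finite_measure (N e)" and sets: "sets (N e) = sets borel"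
    if "e \<in> signed_Basis" for e
    unfolding N_def
    by (rule positive_functional.finite_riesz_measure[OF pf[OF that]],
        rule positive_functional.sets_riesz_measure[OF pf[OF that]])
  have rep: "(\<integral>t. u t \<partial>N e) = jordan_part e u"
    if "e \<in> signed_Basis" "continuous_on UNIV u" "\<And>t. 0 \<le> u t" for e u
    unfolding N_def by (rule positive_functional.riesz_representation[OF pf[OF that(1)] that(2,3)])
  have diff: "(\<integral>t. u t \<partial>N b) - (\<integral>t. u t \<partial>N (- b)) = \<Phi> (\<lambda>t. u t *\<^sub>R b)"
    if b: "b \<in> Basis" and u: "continuous_on UNIV u" for b u
  proof -
    have sb: "b \<in> signed_Basis" "- b \<in> signed_Basis" using b by (auto simp: signed_Basis_def)
    have pos: "(\<integral>t. p t \<partial>N b) - (\<integral>t. p t \<partial>N (- b)) = \<Phi> (\<lambda>t. p t *\<^sub>R b)"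
      if p: "continuous_on UNIV p" "\<And>t. 0 \<le> p t" for p
    proof -
      have "continuous_on UNIV (\<lambda>t. p t *\<^sub>R b)" using p by (intro continuous_intros)
      from l_uminus[OF this] show ?thesis
        by (simp add: rep[OF sb(1) p] rep[OF sb(2) p] jordan_part_def field_simps)
    qed
    define p m where "p t = max (u t) 0" and "m t = max (- u t) 0" for t
    have c: "continuous_on UNIV p" "continuous_on UNIV m"
      unfolding p_def m_def by (intro continuous_intros u)+
    have nn: "0 \<le> p t" "0 \<le> m t" and upm: "u t = p t - m t" for t by (auto simp: p_def m_def)
    have int: "integrable (N e) p" "integrable (N e) m" if "e \<in> signed_Basis" for e
      using fin[OF that] sets[OF that] c by (auto intro: integrable_continuous)
    have "\<Phi> (\<lambda>t. u t *\<^sub>R b) = \<Phi> (\<lambda>t. p t *\<^sub>R b) - \<Phi> (\<lambda>t. m t *\<^sub>R b)"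
      unfolding upm scaleR_diff_left by (intro l_diff continuous_intros c)
    also have "\<dots> = (\<integral>t. u t \<partial>N b) - (\<integral>t. u t \<partial>N (- b))"
      unfolding upm pos[OF c(1) nn(1), symmetric] pos[OF c(2) nn(2), symmetric]
      using int[OF sb(1)] int[OF sb(2)] by simp
    finally show ?thesis by simp
  qed
  have "\<Phi> f = (\<Sum>e\<in>signed_Basis. \<integral>t. f t \<bullet> e \<partial>N e)" if f: "continuous_on UNIV f" for f
  proof -
    have fb: "continuous_on UNIV (\<lambda>t. f t \<bullet> b)" for b by (intro continuous_intros f)
    have "(\<Sum>e\<in>signed_Basis. \<integral>t. f t \<bullet> e \<partial>N e)
        = (\<Sum>b\<in>Basis. (\<integral>t. f t \<bullet> b \<partial>N b) - (\<integral>t. f t \<bullet> b \<partial>N (- b)))"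
      by (simp add: sum_signed_Basis)
    also have "\<dots> = (\<Sum>b\<in>Basis. \<Phi> (\<lambda>t. (f t \<bullet> b) *\<^sub>R b))"
      by (intro sum.cong refl diff fb)
    also have "\<dots> = \<Phi> (\<lambda>t. \<Sum>b\<in>Basis. (f t \<bullet> b) *\<^sub>R b)"
      by (intro l_sum[symmetric] continuous_intros f) auto
    finally show ?thesis by (simp add: euclidean_representation)
  qed
  then show thesis using that fin sets by blast
qed

end

context compact_metric
begin

text \<open>
  The real part of the limit functional is represented by a measure \<open>\<mu>\<close>.  Since both \<open>vint\<close> and
  the limit are linear over the scalar field, equality of the real parts for all \<open>f\<close> implies
  equality: test with the multiple of \<open>f\<close> by the conjugate of the difference of the two values.
\<close>

lemma ex_weak_star_limit:
  fixes \<sigma> :: "nat \<Rightarrow> ('t, 'k::real_or_complex ^ 'n::finite) cabv"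
  assumes a: "\<And>k. norm (\<sigma> k) \<le> a"
    and conv: "\<And>f. continuous_on UNIV f \<Longrightarrow> convergent (\<lambda>k. vint f (\<sigma> k))"
  obtains \<mu> where "\<And>f. continuous_on UNIV f \<Longrightarrow> (\<lambda>k. vint f (\<sigma> k)) \<longlonglongrightarrow> vint f \<mu>"
proof -
  define V where "V f = lim (\<lambda>k. vint f (\<sigma> k))" for f :: "'t \<Rightarrow> 'k ^ 'n"
  have V: "(\<lambda>k. vint f (\<sigma> k)) \<longlonglongrightarrow> V f" if "continuous_on UNIV f" for f
    using conv[OF that] by (simp add: V_def convergent_LIMSEQ_iff)
  define \<Phi> where "\<Phi> f = V f \<bullet> 1" for f
  have \<Phi>: "(\<lambda>k. vint f (\<sigma> k) \<bullet> 1) \<longlonglongrightarrow> \<Phi> f" if "continuous_on UNIV f" for f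
    unfolding \<Phi>_def by (intro tendsto_intros V that)
  interpret bounded_functional "TYPE('t)" \<Phi> a
  proof
    show "\<Phi> (\<lambda>t. f t + g t) = \<Phi> f + \<Phi> g" if "continuous_on UNIV f" "continuous_on UNIV g" for f g
    proof (rule LIMSEQ_unique)
      show "(\<lambda>k. vint (\<lambda>t. f t + g t) (\<sigma> k) \<bullet> 1) \<longlonglongrightarrow> \<Phi> (\<lambda>t. f t + g t)"
        using that by (intro \<Phi> continuous_intros)
      show "(\<lambda>k. vint (\<lambda>t. f t + g t) (\<sigma> k) \<bullet> 1) \<longlonglongrightarrow> \<Phi> f + \<Phi> g"
        using tendsto_add[OF \<Phi>[OF that(1)] \<Phi>[OF that(2)]]
        by (simp add: vint_add[OF that] inner_add_left)
    qed
    show "\<Phi> (\<lambda>t. c *\<^sub>R f t) = c * \<Phi> f" if "continuous_on UNIV f" for c f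
    proof (rule LIMSEQ_unique)
      show "(\<lambda>k. vint (\<lambda>t. c *\<^sub>R f t) (\<sigma> k) \<bullet> 1) \<longlonglongrightarrow> \<Phi> (\<lambda>t. c *\<^sub>R f t)"
        using that by (intro \<Phi> continuous_intros)
      show "(\<lambda>k. vint (\<lambda>t. c *\<^sub>R f t) (\<sigma> k) \<bullet> 1) \<longlonglongrightarrow> c * \<Phi> f"
        using tendsto_mult[OF tendsto_const \<Phi>[OF that]] by (simp add: vint_scaleR[OF that])
    qed
    show "\<Phi> f \<le> a * C" if "continuous_on UNIV f" "\<And>t. norm (f t) \<le> C" for f C
    proof (rule LIMSEQ_le_const2[OF \<Phi>[OF that(1)]], intro exI allI impI)
      fix k :: nat
      have "0 \<le> C" using that(2) norm_ge_zero order_trans by blast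
      have "vint f (\<sigma> k) \<bullet> 1 \<le> norm (vint f (\<sigma> k))"
        using norm_cauchy_schwarz[of "vint f (\<sigma> k)" 1] by simp
      also have "\<dots> \<le> C * norm (\<sigma> k)" by (rule norm_vint_le[OF that])
      also have "\<dots> \<le> C * a" using a \<open>0 \<le> C\<close> by (intro mult_left_mono)
      finally show "vint f (\<sigma> k) \<bullet> 1 \<le> a * C" by (simp add: mult.commute)
    qed
  qed
  obtain N where N: "\<And>e. e \<in> signed_Basis \<Longrightarrow> finite_measure (N e)"
    "\<And>e. e \<in> signed_Basis \<Longrightarrow> sets (N e) = sets borel"
    "\<And>f. continuous_on UNIV f \<Longrightarrow> \<Phi> f = (\<Sum>e\<in>signed_Basis. \<integral>t. f t \<bullet> e \<partial>N e)"
    using vector_riesz_representation by blast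
  obtain \<mu> where \<mu>: "represents N \<mu>" using ex_represented[of N] N(1,2) by blast
  have re: "vint f \<mu> \<bullet> 1 = \<Phi> f" if "continuous_on UNIV f" for f
    by (simp add: vint_inner_1[OF that \<mu>] N(3)[OF that])
  have "vint f \<mu> = V f" if f: "continuous_on UNIV f" for f
  proof -
    let ?d = "vint f \<mu> - V f"
    have fc: "continuous_on UNIV (\<lambda>t. cj ?d *s f t)"
      unfolding vector_scalar_mult_def by (intro continuous_intros f)
    have "(\<lambda>k. cj ?d * vint f (\<sigma> k)) \<longlonglongrightarrow> cj ?d * V f" by (intro tendsto_intros V f)
    then have "V (\<lambda>t. cj ?d *s f t) = cj ?d * V f"
      using V[OF fc] LIMSEQ_unique by (auto simp: vint_scale[OF f])
    then have "(cj ?d * vint f \<mu>) \<bullet> 1 = (cj ?d * V f) \<bullet> 1"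
      using re[OF fc] by (simp add: \<Phi>_def vint_scale[OF f])
    then have "(?d * cj ?d) \<bullet> 1 = 0"
      by (simp add: left_diff_distrib inner_diff_left mult.commute)
    then have "?d \<bullet> ?d = 0" by (simp only: inner_mult_cj)
    then show ?thesis by simp
  qed
  then show thesis using V that[of \<mu>] by simp
qed

end

section \<open>The fixed point\<close>

context compact_metric
begin

text \<open>
  A Cauchy sequence has a weak* limit in \<open>A\<close>.  For a 1-Lipschitz function the Cauchy estimate is
  uniform, so it survives the passage to this limit and yields convergence in the metric.
\<close>

lemma mcomplete_mk_dist:
  fixes A :: "('t, 'k::real_or_complex ^ 'n::finite) cabv set"
  assumes ball: "A \<subseteq> cabv_ball_at a v" and closed: "closedin weak_star A"
  shows "Metric_space.mcomplete A mk_dist"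
proof -
  have mass: "cabv_on \<mu> UNIV = v" and norm: "norm \<mu> \<le> a" if "\<mu> \<in> A" for \<mu>
    using ball that by (auto simp: cabv_ball_at_def)
  interpret Metric_space A mk_dist by (rule Metric_space_mk_dist[OF mass])
  show ?thesis
    unfolding mcomplete_def
  proof (intro allI impI)
    fix \<sigma> assume \<sigma>: "MCauchy \<sigma>"
    then have in_A: "\<sigma> k \<in> A" for k by (auto simp: MCauchy_def)
    have cauchy: "\<exists>N. \<forall>m\<ge>N. \<forall>n\<ge>N. mk_norm (\<sigma> m - \<sigma> n) < \<epsilon>" if "0 < \<epsilon>" for \<epsilon>
    proof -
      from \<sigma> have "\<forall>\<epsilon>>0. \<exists>N. \<forall>m n. N \<le> m \<longrightarrow> N \<le> n \<longrightarrow> mk_norm (\<sigma> m - \<sigma> n) < \<epsilon>"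
        by (simp add: MCauchy_def mk_dist_def)
      with that obtain N where "\<forall>m n. N \<le> m \<longrightarrow> N \<le> n \<longrightarrow> mk_norm (\<sigma> m - \<sigma> n) < \<epsilon>"
        by meson
      then show ?thesis by (intro exI[of _ N]) simp
    qed
    have "Cauchy (\<lambda>k. vint f (\<sigma> k))" if f: "L-lipschitz_on UNIV f" for f L
    proof (rule CauchyI)
      fix \<epsilon> :: real assume "0 < \<epsilon>"
      have L: "0 \<le> L" by (rule lipschitz_on_nonneg[OF f])
      then have "0 < \<epsilon> / (L + 1)" using \<open>0 < \<epsilon>\<close> by simp
      from cauchy[OF this] obtain N where
        N: "\<And>m n. m \<ge> N \<Longrightarrow> n \<ge> N \<Longrightarrow> mk_norm (\<sigma> m - \<sigma> n) < \<epsilon> / (L + 1)" by blast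
      have "norm (vint f (\<sigma> m) - vint f (\<sigma> n)) < \<epsilon>" if "m \<ge> N" "n \<ge> N" for m n
      proof -
        have "norm (vint f (\<sigma> m - \<sigma> n)) \<le> L * mk_norm (\<sigma> m - \<sigma> n)"
          by (rule norm_vint_le_lipschitz_mk_norm[OF f]) (simp add: mass in_A)
        also have "\<dots> \<le> L * (\<epsilon> / (L + 1))" using N[OF that] L by (intro mult_left_mono) auto
        also have "\<dots> < \<epsilon>" using L \<open>0 < \<epsilon>\<close> by (simp add: field_simps)
        finally show ?thesis by (simp add: vint_diff_measure[OF lipschitz_imp_continuous[OF f]])
      qed
      then show "\<exists>N. \<forall>m\<ge>N. \<forall>n\<ge>N. norm (vint f (\<sigma> m) - vint f (\<sigma> n)) < \<epsilon>" by blast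
    qed
    then have "convergent (\<lambda>k. vint f (\<sigma> k))" if "continuous_on UNIV f" for f
      using vint_convergent_continuous[of \<sigma> a f] norm[OF in_A] that by blast
    then obtain \<mu> where \<mu>: "\<And>f. continuous_on UNIV f \<Longrightarrow> (\<lambda>k. vint f (\<sigma> k)) \<longlonglongrightarrow> vint f \<mu>"
      using ex_weak_star_limit[of \<sigma> a] norm[OF in_A] by blast
    have "\<mu> \<in> A" by (rule weak_star_limit_in_closed[OF closed in_A \<mu>])
    have "\<exists>N. \<forall>n\<ge>N. \<sigma> n \<in> A \<and> mk_dist (\<sigma> n) \<mu> < \<epsilon>" if "0 < \<epsilon>" for \<epsilon>
    proof -
      obtain N where N: "\<And>m n. m \<ge> N \<Longrightarrow> n \<ge> N \<Longrightarrow> mk_norm (\<sigma> m - \<sigma> n) < \<epsilon> / 2"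
        using cauchy[of "\<epsilon> / 2"] \<open>0 < \<epsilon>\<close> by auto
      have "mk_norm (\<sigma> n - \<mu>) \<le> \<epsilon> / 2" if "n \<ge> N" for n
      proof (rule mk_norm_leI)
        fix f :: "'t \<Rightarrow> 'k ^ 'n" assume f: "1-lipschitz_on UNIV f"
        then have fc: "continuous_on UNIV f" by (rule lipschitz_imp_continuous)
        show "norm (vint f (\<sigma> n - \<mu>)) \<le> \<epsilon> / 2"
        proof (rule LIMSEQ_le_const2)
          show "(\<lambda>m. norm (vint f (\<sigma> n) - vint f (\<sigma> m))) \<longlonglongrightarrow> norm (vint f (\<sigma> n - \<mu>))"
            unfolding vint_diff_measure[OF fc] by (intro tendsto_intros \<mu> fc)
          have "norm (vint f (\<sigma> n) - vint f (\<sigma> m)) \<le> \<epsilon> / 2" if "m \<ge> N" for m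
          proof -
            have "norm (vint f (\<sigma> n - \<sigma> m)) \<le> mk_norm (\<sigma> n - \<sigma> m)"
              by (rule norm_vint_le_mk_norm[OF f]) (simp add: mass in_A)
            then show ?thesis
              using N[OF \<open>n \<ge> N\<close> that] by (simp add: vint_diff_measure[OF fc])
          qed
          then show "\<exists>M. \<forall>m\<ge>M. norm (vint f (\<sigma> n) - vint f (\<sigma> m)) \<le> \<epsilon> / 2" by blast
        qed
      qed (use \<open>0 < \<epsilon>\<close> in simp)
      then have "mk_dist (\<sigma> n) \<mu> < \<epsilon>" if "n \<ge> N" for n
        using that \<open>0 < \<epsilon>\<close> unfolding mk_dist_def by (smt (verit) field_sum_of_halves)
      then show ?thesis using in_A by blast
    qed
    then have "limitin mtopology \<sigma> \<mu> sequentially"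
      using \<open>\<mu> \<in> A\<close> unfolding limit_metric_sequentially by blast
    then show "\<exists>\<mu>. limitin mtopology \<sigma> \<mu> sequentially" ..
  qed
qed

end

text \<open>
  The inequality is strict because at least one weight is nonzero.
\<close>

lemma suminf_mult_less:
  fixes w r :: "nat \<Rightarrow> real"
  assumes w: "\<And>i. 0 \<le> w i" "w sums 1" and r: "\<And>i. 0 \<le> r i" "\<And>i. r i < 1"
  shows "(\<Sum>i. w i * r i) < 1"
proof -
  have sw: "summable w" using w(2) by (rule sums_summable)
  have swr: "summable (\<lambda>i. w i * r i)"
    using sw by (rule summable_comparison_test') (use w r in \<open>simp add: mult_left_le less_imp_le\<close>)
  obtain j where j: "w j \<noteq> 0"
  proof (rule ccontr)
    assume "\<not> thesis"
    then have "w = (\<lambda>_. 0)" using that by blast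
    then show False using w(2) sums_unique2[OF sums_zero] by fastforce
  qed
  have "0 < (\<Sum>i. w i - w i * r i)"
  proof (rule suminf_pos2)
    show "summable (\<lambda>i. w i - w i * r i)" by (rule summable_diff[OF sw swr])
    show "0 \<le> w i - w i * r i" for i using w(1)[of i] r[of i] by (simp add: mult_left_le)
    show "0 < w j - w j * r j" using j w(1)[of j] r(2)[of j] by simp
  qed
  also have "\<dots> = 1 - (\<Sum>i. w i * r i)"
    using suminf_diff[OF sw swr] w(2) by (simp add: sums_iff)
  finally show ?thesis by simp
qed

theorem theorem3p2p1:
  fixes \<omega> :: "nat \<Rightarrow> 't::metric_space \<Rightarrow> 't"
    and R :: "nat \<Rightarrow> ('k::real_or_complex ^ 'n::finite) \<Rightarrow>\<^sub>L ('k ^ 'n)"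
    and r :: "nat \<Rightarrow> real" and a c :: real and v :: "'k ^ 'n"
    and H :: "('t, 'k ^ 'n) cabv \<Rightarrow> ('t, 'k ^ 'n) cabv"
  assumes "compact (UNIV :: 't set)" and "\<exists>x y :: 't. x \<noteq> y"
    and "\<And>i. lip (\<omega> i) < \<infinity>" and "r = (\<lambda>i. enn2real (lip (\<omega> i)))" and "bounded (range r)"
    and "\<And>i. Vector_Spaces.linear (*s) (*s) (blinfun_apply (R i))"
    and "summable (\<lambda>i. norm (R i))"
    and "H = markov_op R \<omega>"
    and "c = (\<Sum>i. norm (R i) * r i)"
    and "(\<Sum>i. R i) = id_blinfun"
    and "0 < a" and "norm v \<le> a"
  shows
    "((\<forall>i. contraction UNIV dist (\<omega> i)) \<and> (\<Sum>i. norm (R i)) = 1 \<longrightarrow> c < 1) \<and>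
     (cabv_ball_at a v :: ('t, 'k ^ 'n) cabv set) \<noteq> {} \<and>
     ((\<forall>\<mu>. norm (H \<mu>) \<le> norm \<mu>) \<longrightarrow>
        H ` cabv_ball_at a v \<subseteq> cabv_ball_at a v \<and> closedin weak_star (cabv_ball_at a v :: ('t, 'k ^ 'n) cabv set)) \<and>
     ((\<Sum>i. norm (R i)) = 1 \<longrightarrow> (\<forall>\<mu>. norm (H \<mu>) \<le> norm \<mu>)) \<and>
     (\<forall>A H\<^sub>1. c < 1 \<and> A \<noteq> {} \<and> A \<subseteq> cabv_ball_at a v \<and> H ` A \<subseteq> A \<and> closedin weak_star A \<and>
          H\<^sub>1 = restrict H A \<longrightarrow>
        Metric_space A mk_dist \<and>
        contraction A mk_dist H\<^sub>1 \<and> lip_const A mk_dist mk_dist H\<^sub>1 \<le> ennreal c \<and>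
        (\<exists>!\<mu>. \<mu> \<in> A \<and> H\<^sub>1 \<mu> = \<mu>))"
proof -
  interpret compact_metric "TYPE('t)" using assms(1) by unfold_locales
  have \<omega>: "(r i)-lipschitz_on UNIV (\<omega> i)" for i
    unfolding assms(4) by (rule lipschitz_on_lip[OF assms(3)])
  have r: "0 \<le> r i" for i by (rule lipschitz_on_nonneg[OF \<omega>])
  interpret markov_system \<omega> R
    using \<omega> assms(7)
    by unfold_locales (auto intro: borel_measurable_continuous_onI lipschitz_imp_continuous)
  note H = \<open>H = markov_op R \<omega>\<close>
  have Rr: "summable (\<lambda>i. norm (R i) * r i)"
  proof -
    obtain K where K: "\<And>i. norm (r i) \<le> K" using assms(5) by (auto simp: bounded_iff)
    have "norm (norm (R i) * r i) \<le> norm (R i) * K" for i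
      using K[of i] by (simp add: abs_mult mult_left_mono)
    then show ?thesis
      by (intro summable_comparison_test'[OF summable_mult2[OF assms(7), of K]])
  qed
  have c0: "0 \<le> c" unfolding assms(9) using r by (intro suminf_nonneg Rr) simp
  have mass_H: "cabv_on (H \<mu>) UNIV = cabv_on \<mu> UNIV" for \<mu>
    unfolding H markov_op_mass assms(10) by simp

  have part1: "c < 1" if "\<forall>i. contraction UNIV dist (\<omega> i)" "(\<Sum>i. norm (R i)) = 1"
    unfolding assms(9)
  proof (rule suminf_mult_less)
    show "(\<lambda>i. norm (R i)) sums 1" using summable_sums[OF assms(7)] that(2) by simp
    show "r i < 1" for i
    proof -
      have "ennreal (r i) = lip (\<omega> i)" unfolding assms(4) using assms(3) by (simp add: less_top)
      then have "ennreal (r i) < 1" using that(1) by (simp add: contraction_def)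
      then show ?thesis using r by (simp add: ennreal_less_one_iff)
    qed
  qed (use r in auto)

  have part2: "(cabv_ball_at a v :: ('t, 'k ^ 'n) cabv set) \<noteq> {}"
    using ex_dirac_measure[of v] assms(12) by (force simp: cabv_ball_at_def)

  have part4: "norm (H \<mu>) \<le> norm \<mu>" if "(\<Sum>i. norm (R i)) = 1" for \<mu>
    using norm_markov_op_le[of \<mu>] that by (simp add: H)

  have part3: "H ` cabv_ball_at a v \<subseteq> cabv_ball_at a v"
    if "\<forall>\<mu>. norm (H \<mu>) \<le> norm \<mu>"
    using that by (auto simp: cabv_ball_at_def mass_H intro: order_trans)
  have part3': "closedin weak_star (cabv_ball_at a v :: ('t, 'k ^ 'n) cabv set)"
    using assms(11) by (intro closedin_weak_star_ball) simp

  have part5: "Metric_space A mk_dist \<and>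
      contraction A mk_dist H\<^sub>1 \<and> lip_const A mk_dist mk_dist H\<^sub>1 \<le> ennreal c \<and>
      (\<exists>!\<mu>. \<mu> \<in> A \<and> H\<^sub>1 \<mu> = \<mu>)"
    if c1: "c < 1" and A: "A \<noteq> {}" "A \<subseteq> cabv_ball_at a v" "H ` A \<subseteq> A" "closedin weak_star A"
      and H\<^sub>1: "H\<^sub>1 = restrict H A" for A and H\<^sub>1 :: "('t, 'k ^ 'n) cabv \<Rightarrow> ('t, 'k ^ 'n) cabv"
  proof -
    have mass: "cabv_on \<mu> UNIV = v" if "\<mu> \<in> A" for \<mu>
      using A(2) that by (auto simp: cabv_ball_at_def)
    have MS: "Metric_space A mk_dist" by (rule Metric_space_mk_dist[OF mass])
    interpret Metric_space A mk_dist by (rule MS)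
    have into: "H\<^sub>1 \<in> A \<rightarrow> A" using A(3) by (auto simp: H\<^sub>1)
    have contr: "mk_dist (H\<^sub>1 \<mu>) (H\<^sub>1 \<nu>) \<le> c * mk_dist \<mu> \<nu>" if "\<mu> \<in> A" "\<nu> \<in> A" for \<mu> \<nu>
    proof -
      have "mk_dist (H\<^sub>1 \<mu>) (H\<^sub>1 \<nu>) = mk_norm (markov_op R \<omega> (\<mu> - \<nu>))"
        using that by (simp add: H\<^sub>1 H mk_dist_def markov_op_diff)
      also have "\<dots> \<le> (\<Sum>i. norm (R i) * r i) * mk_norm (\<mu> - \<nu>)"
        using that mass by (intro mk_norm_markov_op_le \<omega> assms(6,7) Rr) simp
      finally show ?thesis by (simp add: assms(9) mk_dist_def)
    qed
    have lip: "lip_const A mk_dist mk_dist H\<^sub>1 \<le> ennreal c"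
      unfolding lip_const_def
    proof (rule SUP_least, clarify)
      fix \<mu> \<nu> assume "\<mu> \<in> A" "\<nu> \<in> A" "\<mu> \<noteq> \<nu>"
      then have "0 < mk_dist \<mu> \<nu>" by simp
      then show "ennreal (mk_dist (H\<^sub>1 \<mu>) (H\<^sub>1 \<nu>) / mk_dist \<mu> \<nu>) \<le> ennreal c"
        using contr[OF \<open>\<mu> \<in> A\<close> \<open>\<nu> \<in> A\<close>] by (intro ennreal_leI) (simp add: divide_le_eq)
    qed
    also have "ennreal c < 1" using c0 c1 by (simp add: ennreal_less_one_iff)
    finally have contraction: "contraction A mk_dist H\<^sub>1"
      using into by (simp add: contraction_def)
    obtain \<mu> where \<mu>: "\<mu> \<in> A" "H\<^sub>1 \<mu> = \<mu>"
      using Banach_fixedpoint_thm[OF mcomplete_mk_dist[OF A(2,4)] A(1) into c1 contr] by blast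
    have "\<nu> = \<mu>" if "\<nu> \<in> A" "H\<^sub>1 \<nu> = \<nu>" for \<nu>
    proof (rule ccontr)
      assume "\<nu> \<noteq> \<mu>"
      then have "0 < mk_dist \<nu> \<mu>" using that(1) \<mu>(1) by simp
      moreover have "mk_dist \<nu> \<mu> \<le> c * mk_dist \<nu> \<mu>" using contr[OF that(1) \<mu>(1)] that(2) \<mu>(2) by simp
      ultimately show False using c1 by simp
    qed
    then have "\<exists>!\<mu>. \<mu> \<in> A \<and> H\<^sub>1 \<mu> = \<mu>" using \<mu> by blast
    then show ?thesis using MS contraction lip by blast
  qed
  show ?thesis
    by (intro conjI; (intro impI allI)?; (elim conjE)?;
        (rule part2 | (rule part1 part4 part5 conjI[OF part3 part3']; assumption)))
qed

end
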